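(* Let $M(\phi,\xi,\eta,g_M)$ be a cosymplectic manifold, let $(N,g_N)$ be a Riemannian manifold, and let $F:M(\phi,\xi,\eta,g_M)\to(N,g_N)$ be an anti-invariant Riemannian submersion such that $(\ker F_* )^\perp=\phi(\ker F_* )\oplus\{\xi\}$. Then $F$ is a totally geodesic map if and only if $$\mathcal{T}_W\phi V=0\quad\text{for all } W,V\in\Gamma(\ker F_* )$$ and $$\mathcal{A}_X\phi W=0\quad\text{for all } X\in\Gamma((\ker F_* )^\perp),\ W\in\Gamma(\ker F_* ).$$
   Context: An almost contact metric structure $(\phi,\xi,\eta,g)$ on a $(2m+1)$-dimensional manifold $M$ consists of a $(1,1)$-tensor field $\phi$, a vector field $\xi$, a 1-form $\eta$ and a Riemannian metric $g$ with $\phi^2=-I+\eta\otimes\xi$, $\phi\xi=0$, $\eta\circ\phi=0$, $\eta(\xi)=1$, $g(\phi X,\phi Y)=g(X,Y)-\eta(X)\eta(Y)$, $\eta(X)=g(X,\xi)$. It is cosymplectic if it is normal ($[\phi,\phi]+2d\eta\otimes\xi=0$) and both $\eta$ and $\Phi(X,Y)=g(X,\phi Y)$ are closed; the structure equation of a cosymplectic manifold is $(\nabla_X\phi)Y=0$, where $\nabla$ is the Levi-Civita connection of $g$, and then $\nabla_X\xi=0$. A Riemannian submersion $F:(M,g_M)\to(N,g_N)$ is a smooth surjective map of maximal rank whose differential $F_*$ preserves the lengths of horizontal vectors. Vectors in $\ker F_*$ are vertical and vectors in $(\ker F_* )^\perp$ are horizontal; $\mathcal{V}$ and $\mathcal{H}$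 are the orthogonal projections on $\ker F_*$ and $(\ker F_* )^\perp$. $F$ is anti-invariant if $\phi(\ker F_* )\subseteq(\ker F_* )^\perp$. Here $\{\xi\}$ denotes the line distribution spanned by $\xi$. O'Neill's tensors: for vector fields $E,G$ on $M$, $\mathcal{T}_EG=\mathcal{H}\nabla_{\mathcal{V}E}\mathcal{V}G+\mathcal{V}\nabla_{\mathcal{V}E}\mathcal{H}G$ and $\mathcal{A}_EG=\mathcal{V}\nabla_{\mathcal{H}E}\mathcal{H}G+\mathcal{H}\nabla_{\mathcal{H}E}\mathcal{V}G$. The second fundamental form of $F$ is $(\nabla F_* )(X,Y)=\nabla^F_XF_*(Y)-F_*(\nabla_XY)$, where $\nabla^F$ is the pullback connection. $F$ is called totally geodesic if $\nabla F_*=0$. *)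

theory Defs
  imports "HOL-Analysis.Analysis"
begin

section \<open>Smooth functions on open subsets of Euclidean spaces\<close>

text \<open>For open \<open>S\<close> in a finite-dimensional space, the directional-derivative recursion is the usual
  notion of \<open>C^k\<close>.\<close>

primrec Ck_on :: "nat \<Rightarrow> 'a::euclidean_space set \<Rightarrow> ('a \<Rightarrow> 'b::real_normed_vector) \<Rightarrow> bool" where
  "Ck_on 0 S f \<longleftrightarrow> continuous_on S f"
| "Ck_on (Suc k) S f \<longleftrightarrow>
     (\<forall>x\<in>S. f differentiable (at x)) \<and>
     (\<forall>v. Ck_on k S (\<lambda>x. frechet_derivative f (at x) v))"

definition smooth_on :: "'a::euclidean_space set \<Rightarrow> ('a \<Rightarrow> 'b::real_normed_vector) \<Rightarrow> bool" where
  "smooth_on S f \<longleftrightarrow> (\<forall>k. Ck_on k S f)"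


section \<open>Smooth manifolds\<close>

text \<open>The underlying space of a manifold is a whole type \<open>'a\<close> (Hausdorff and second countable by
  its type classes). A chart is a pair of its domain and its coordinate map; values of the
  coordinate map outside the domain are irrelevant. The dimension is \<open>DIM('e)\<close>.\<close>

type_synonym ('a, 'e) chart = "'a set \<times> ('a \<Rightarrow> 'e)"

definition chart_inv :: "('a, 'e) chart \<Rightarrow> 'e \<Rightarrow> 'a" where
  "chart_inv c = inv_into (fst c) (snd c)"

definition smooth_atlas ::
    "('a::{t2_space,second_countable_topology}, 'e::euclidean_space) chart set \<Rightarrow> bool" where
  "smooth_atlas A \<longleftrightarrow>
     (\<Union>c\<in>A. fst c) = UNIV \<and>
     (\<forall>c\<in>A. open (fst c) \<and> open (snd c ` fst c) \<and>
        homeomorphism (fst c) (snd c ` fst c) (snd c) (chart_inv c)) \<and>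
     (\<forall>c\<in>A. \<forall>d\<in>A. smooth_on (snd c ` (fst c \<inter> fst d)) (snd d \<circ> chart_inv c))"

text \<open>The tangent space at \<open>p\<close> is the model space \<open>'e\<close>, a vector being identified with its
  components in one chart \<open>chart_at A p\<close> around \<open>p\<close>, chosen once and for all. The components in
  any other chart are obtained from the derivative of the transition map. The chosen chart may jump
  from point to point, so smoothness of fields is always expressed through \<open>tangent_coords\<close> in a
  fixed chart.\<close>

definition chart_at :: "('a, 'e) chart set \<Rightarrow> 'a \<Rightarrow> ('a, 'e) chart" where
  "chart_at A p = (SOME c. c \<in> A \<and> p \<in> fst c)"

definition tangent_coords ::
    "('a, 'e::euclidean_space) chart set \<Rightarrow> ('a, 'e) chart \<Rightarrow> 'a \<Rightarrow> 'e \<Rightarrow> 'e" where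
  "tangent_coords A c p v =
     frechet_derivative (snd c \<circ> chart_inv (chart_at A p)) (at (snd (chart_at A p) p)) v"

definition smooth_fun_on ::
    "('a, 'e::euclidean_space) chart set \<Rightarrow> 'a set \<Rightarrow> ('a \<Rightarrow> real) \<Rightarrow> bool" where
  "smooth_fun_on A U f \<longleftrightarrow> (\<forall>c\<in>A. smooth_on (snd c ` (U \<inter> fst c)) (f \<circ> chart_inv c))"

text \<open>\<open>vec_deriv A f p v\<close> is \<open>v(f)\<close> for \<open>v\<close> tangent at \<open>p\<close>.\<close>

definition vec_deriv ::
    "('a, 'e::euclidean_space) chart set \<Rightarrow> ('a \<Rightarrow> real) \<Rightarrow> 'a \<Rightarrow> 'e \<Rightarrow> real" where
  "vec_deriv A f p v =
     frechet_derivative (f \<circ> chart_inv (chart_at A p)) (at (snd (chart_at A p) p)) v"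

definition smooth_map ::
    "('a::topological_space, 'e::euclidean_space) chart set \<Rightarrow>
     ('b::topological_space, 'f::euclidean_space) chart set \<Rightarrow> ('a \<Rightarrow> 'b) \<Rightarrow> bool" where
  "smooth_map A B F \<longleftrightarrow>
     continuous_on UNIV F \<and>
     (\<forall>c\<in>A. \<forall>d\<in>B. smooth_on (snd c ` (fst c \<inter> F -` fst d)) (snd d \<circ> F \<circ> chart_inv c))"

definition differential ::
    "('a, 'e::euclidean_space) chart set \<Rightarrow> ('b, 'f::euclidean_space) chart set \<Rightarrow>
     ('a \<Rightarrow> 'b) \<Rightarrow> 'a \<Rightarrow> 'e \<Rightarrow> 'f" where
  "differential A B F p v =
     frechet_derivative (snd (chart_at B (F p)) \<circ> F \<circ> chart_inv (chart_at A p))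
       (at (snd (chart_at A p) p)) v"

text \<open>A section along \<open>F\<close> over the open set \<open>U\<close> assigns to \<open>p \<in> U\<close> a vector tangent at \<open>F p\<close>,
  i.e. it is a smooth section of the pullback bundle. Vector fields are sections along the identity.\<close>

definition section_along ::
    "('a, 'e::euclidean_space) chart set \<Rightarrow> ('b, 'f::euclidean_space) chart set \<Rightarrow>
     ('a \<Rightarrow> 'b) \<Rightarrow> 'a set \<Rightarrow> ('a \<Rightarrow> 'f) \<Rightarrow> bool" where
  "section_along A B F U S \<longleftrightarrow>
     (\<forall>c\<in>A. \<forall>d\<in>B. smooth_on (snd c ` (U \<inter> fst c \<inter> F -` fst d))
        (\<lambda>u. tangent_coords B d (F (chart_inv c u)) (S (chart_inv c u))))"

definition vector_field_on ::
    "('a, 'e::euclidean_space) chart set \<Rightarrow> 'a set \<Rightarrow> ('a \<Rightarrow> 'e) \<Rightarrow> bool" where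
  "vector_field_on A U X \<longleftrightarrow> section_along A A id U X"

text \<open>In coordinates, \<open>[X,Y] = DY(X) - DX(Y)\<close>.\<close>

definition lie_bracket ::
    "('a, 'e::euclidean_space) chart set \<Rightarrow> ('a \<Rightarrow> 'e) \<Rightarrow> ('a \<Rightarrow> 'e) \<Rightarrow> 'a \<Rightarrow> 'e" where
  "lie_bracket A X Y p =
     (let c = chart_at A p;
          loc = (\<lambda>Z u. tangent_coords A c (chart_inv c u) (Z (chart_inv c u)))
      in frechet_derivative (loc Y) (at (snd c p)) (X p)
         - frechet_derivative (loc X) (at (snd c p)) (Y p))"

text \<open>Exterior derivatives of a 1-form and a 2-form, with the normalisation
  \<open>2 d\<eta>(X,Y) = X \<eta>(Y) - Y \<eta>(X) - \<eta>([X,Y])\<close> that goes with the normality condition below.\<close>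

definition ext_deriv1 ::
    "('a, 'e::euclidean_space) chart set \<Rightarrow> ('a \<Rightarrow> 'e \<Rightarrow> real) \<Rightarrow>
     ('a \<Rightarrow> 'e) \<Rightarrow> ('a \<Rightarrow> 'e) \<Rightarrow> 'a \<Rightarrow> real" where
  "ext_deriv1 A \<omega> X Y p =
     (vec_deriv A (\<lambda>q. \<omega> q (Y q)) p (X p) - vec_deriv A (\<lambda>q. \<omega> q (X q)) p (Y p)
      - \<omega> p (lie_bracket A X Y p)) / 2"

definition ext_deriv2 ::
    "('a, 'e::euclidean_space) chart set \<Rightarrow> ('a \<Rightarrow> 'e \<Rightarrow> 'e \<Rightarrow> real) \<Rightarrow>
     ('a \<Rightarrow> 'e) \<Rightarrow> ('a \<Rightarrow> 'e) \<Rightarrow> ('a \<Rightarrow> 'e) \<Rightarrow> 'a \<Rightarrow> real" where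
  "ext_deriv2 A \<omega> X Y Z p =
     (vec_deriv A (\<lambda>q. \<omega> q (Y q) (Z q)) p (X p)
      + vec_deriv A (\<lambda>q. \<omega> q (Z q) (X q)) p (Y p)
      + vec_deriv A (\<lambda>q. \<omega> q (X q) (Y q)) p (Z p)
      - \<omega> p (lie_bracket A X Y p) (Z p)
      - \<omega> p (lie_bracket A Y Z p) (X p)
      - \<omega> p (lie_bracket A Z X p) (Y p)) / 3"


section \<open>Riemannian metrics and connections\<close>

definition riemannian_metric ::
    "('a::topological_space, 'e::euclidean_space) chart set \<Rightarrow> ('a \<Rightarrow> 'e \<Rightarrow> 'e \<Rightarrow> real) \<Rightarrow> bool" where
  "riemannian_metric A g \<longleftrightarrow>
     (\<forall>p. bilinear (g p)) \<and>
     (\<forall>p v w. g p v w = g p w v) \<and>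
     (\<forall>p v. v \<noteq> 0 \<longrightarrow> g p v v > 0) \<and>
     (\<forall>U X Y. open U \<and> vector_field_on A U X \<and> vector_field_on A U Y \<longrightarrow>
        smooth_fun_on A U (\<lambda>p. g p (X p) (Y p)))"

definition riemannian_manifold ::
    "('a::{t2_space,second_countable_topology}, 'e::euclidean_space) chart set \<Rightarrow>
     ('a \<Rightarrow> 'e \<Rightarrow> 'e \<Rightarrow> real) \<Rightarrow> bool" where
  "riemannian_manifold A g \<longleftrightarrow> smooth_atlas A \<and> riemannian_metric A g"

text \<open>Connections in the pullback of the tangent bundle along \<open>F\<close>: \<open>D p v S\<close> is the covariant
  derivative at \<open>p\<close>, in direction \<open>v\<close>, of a section \<open>S\<close> defined near \<open>p\<close>. As sections are total
  functions in HOL, dependence on the germ of \<open>S\<close> only is stated explicitly; \<open>D p v S\<close> is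
  unspecified if \<open>S\<close> is not smooth near \<open>p\<close>.\<close>

definition connection_along ::
    "('a::topological_space, 'e::euclidean_space) chart set \<Rightarrow>
     ('b, 'f::euclidean_space) chart set \<Rightarrow> ('a \<Rightarrow> 'b) \<Rightarrow>
     ('a \<Rightarrow> 'e \<Rightarrow> ('a \<Rightarrow> 'f) \<Rightarrow> 'f) \<Rightarrow> bool" where
  "connection_along A B F D \<longleftrightarrow>
     (\<forall>U S p. open U \<and> p \<in> U \<and> section_along A B F U S \<longrightarrow> linear (\<lambda>v. D p v S)) \<and>
     (\<forall>U S S' p v. open U \<and> p \<in> U \<and> section_along A B F U S \<and> section_along A B F U S' \<longrightarrow>
        D p v (\<lambda>q. S q + S' q) = D p v S + D p v S') \<and>
     (\<forall>U f S p v. open U \<and> p \<in> U \<and> smooth_fun_on A U f \<and> section_along A B F U S \<longrightarrow>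
        D p v (\<lambda>q. f q *\<^sub>R S q) = vec_deriv A f p v *\<^sub>R S p + f p *\<^sub>R D p v S) \<and>
     (\<forall>U S S' p v. open U \<and> p \<in> U \<and> section_along A B F U S \<and> section_along A B F U S' \<and>
        (\<forall>q\<in>U. S q = S' q) \<longrightarrow> D p v S = D p v S') \<and>
     (\<forall>U X S. open U \<and> vector_field_on A U X \<and> section_along A B F U S \<longrightarrow>
        section_along A B F U (\<lambda>p. D p (X p) S))"

definition affine_connection ::
    "('a::topological_space, 'e::euclidean_space) chart set \<Rightarrow>
     ('a \<Rightarrow> 'e \<Rightarrow> ('a \<Rightarrow> 'e) \<Rightarrow> 'e) \<Rightarrow> bool" where
  "affine_connection A D \<longleftrightarrow> connection_along A A id D"

definition levi_civita ::
    "('a::topological_space, 'e::euclidean_space) chart set \<Rightarrow> ('a \<Rightarrow> 'e \<Rightarrow> 'e \<Rightarrow> real) \<Rightarrow>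
     ('a \<Rightarrow> 'e \<Rightarrow> ('a \<Rightarrow> 'e) \<Rightarrow> 'e) \<Rightarrow> bool" where
  "levi_civita A g D \<longleftrightarrow>
     affine_connection A D \<and>
     (\<forall>U X Y p. open U \<and> p \<in> U \<and> vector_field_on A U X \<and> vector_field_on A U Y \<longrightarrow>
        D p (X p) Y - D p (Y p) X = lie_bracket A X Y p) \<and>
     (\<forall>U Y Z p v. open U \<and> p \<in> U \<and> vector_field_on A U Y \<and> vector_field_on A U Z \<longrightarrow>
        vec_deriv A (\<lambda>q. g q (Y q) (Z q)) p v = g p (D p v Y) (Z p) + g p (Y p) (D p v Z))"

text \<open>The pullback along \<open>F\<close> of the connection \<open>DN\<close>; it is determined (on smooth sections) by its
  values on the sections \<open>Z \<circ> F\<close>, since these include the local frames \<open>\<partial>\<^sub>k \<circ> F\<close>.\<close>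

definition pullback_connection ::
    "('a::topological_space, 'e::euclidean_space) chart set \<Rightarrow>
     ('b::topological_space, 'f::euclidean_space) chart set \<Rightarrow> ('a \<Rightarrow> 'b) \<Rightarrow>
     ('b \<Rightarrow> 'f \<Rightarrow> ('b \<Rightarrow> 'f) \<Rightarrow> 'f) \<Rightarrow> ('a \<Rightarrow> 'e \<Rightarrow> ('a \<Rightarrow> 'f) \<Rightarrow> 'f) \<Rightarrow> bool" where
  "pullback_connection A B F DN DF \<longleftrightarrow>
     connection_along A B F DF \<and>
     (\<forall>V Z p v. open V \<and> F p \<in> V \<and> vector_field_on B V Z \<longrightarrow>
        DF p v (Z \<circ> F) = DN (F p) (differential A B F p v) Z)"


section \<open>Cosymplectic manifolds\<close>

definition almost_contact_metric ::
    "('a::{t2_space,second_countable_topology}, 'e::euclidean_space) chart set \<Rightarrow>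
     ('a \<Rightarrow> 'e \<Rightarrow> 'e) \<Rightarrow> ('a \<Rightarrow> 'e) \<Rightarrow> ('a \<Rightarrow> 'e \<Rightarrow> real) \<Rightarrow> ('a \<Rightarrow> 'e \<Rightarrow> 'e \<Rightarrow> real) \<Rightarrow> bool" where
  "almost_contact_metric A \<phi> \<xi> \<eta> g \<longleftrightarrow>
     (\<exists>m::nat. DIM('e) = 2 * m + 1) \<and>
     riemannian_manifold A g \<and>
     (\<forall>p. linear (\<phi> p)) \<and>
     (\<forall>U X. open U \<and> vector_field_on A U X \<longrightarrow> vector_field_on A U (\<lambda>p. \<phi> p (X p))) \<and>
     vector_field_on A UNIV \<xi> \<and>
     (\<forall>p. linear (\<eta> p)) \<and>
     (\<forall>U X. open U \<and> vector_field_on A U X \<longrightarrow> smooth_fun_on A U (\<lambda>p. \<eta> p (X p))) \<and>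
     (\<forall>p v. \<phi> p (\<phi> p v) = - v + \<eta> p v *\<^sub>R \<xi> p) \<and>
     (\<forall>p. \<phi> p (\<xi> p) = 0) \<and>
     (\<forall>p v. \<eta> p (\<phi> p v) = 0) \<and>
     (\<forall>p. \<eta> p (\<xi> p) = 1) \<and>
     (\<forall>p v w. g p (\<phi> p v) (\<phi> p w) = g p v w - \<eta> p v * \<eta> p w) \<and>
     (\<forall>p v. \<eta> p v = g p v (\<xi> p))"

definition nijenhuis ::
    "('a, 'e::euclidean_space) chart set \<Rightarrow> ('a \<Rightarrow> 'e \<Rightarrow> 'e) \<Rightarrow>
     ('a \<Rightarrow> 'e) \<Rightarrow> ('a \<Rightarrow> 'e) \<Rightarrow> 'a \<Rightarrow> 'e" where
  "nijenhuis A \<phi> X Y p =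
     \<phi> p (\<phi> p (lie_bracket A X Y p))
     + lie_bracket A (\<lambda>q. \<phi> q (X q)) (\<lambda>q. \<phi> q (Y q)) p
     - \<phi> p (lie_bracket A (\<lambda>q. \<phi> q (X q)) Y p)
     - \<phi> p (lie_bracket A X (\<lambda>q. \<phi> q (Y q)) p)"

definition normal_structure ::
    "('a::topological_space, 'e::euclidean_space) chart set \<Rightarrow>
     ('a \<Rightarrow> 'e \<Rightarrow> 'e) \<Rightarrow> ('a \<Rightarrow> 'e) \<Rightarrow> ('a \<Rightarrow> 'e \<Rightarrow> real) \<Rightarrow> bool" where
  "normal_structure A \<phi> \<xi> \<eta> \<longleftrightarrow>
     (\<forall>U X Y p. open U \<and> p \<in> U \<and> vector_field_on A U X \<and> vector_field_on A U Y \<longrightarrow>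
        nijenhuis A \<phi> X Y p + (2 * ext_deriv1 A \<eta> X Y p) *\<^sub>R \<xi> p = 0)"

definition closed1 ::
    "('a::topological_space, 'e::euclidean_space) chart set \<Rightarrow> ('a \<Rightarrow> 'e \<Rightarrow> real) \<Rightarrow> bool" where
  "closed1 A \<omega> \<longleftrightarrow>
     (\<forall>U X Y p. open U \<and> p \<in> U \<and> vector_field_on A U X \<and> vector_field_on A U Y \<longrightarrow>
        ext_deriv1 A \<omega> X Y p = 0)"

definition closed2 ::
    "('a::topological_space, 'e::euclidean_space) chart set \<Rightarrow> ('a \<Rightarrow> 'e \<Rightarrow> 'e \<Rightarrow> real) \<Rightarrow> bool" where
  "closed2 A \<omega> \<longleftrightarrow>
     (\<forall>U X Y Z p. open U \<and> p \<in> U \<and>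
        vector_field_on A U X \<and> vector_field_on A U Y \<and> vector_field_on A U Z \<longrightarrow>
        ext_deriv2 A \<omega> X Y Z p = 0)"

definition cosymplectic_manifold ::
    "('a::{t2_space,second_countable_topology}, 'e::euclidean_space) chart set \<Rightarrow>
     ('a \<Rightarrow> 'e \<Rightarrow> 'e) \<Rightarrow> ('a \<Rightarrow> 'e) \<Rightarrow> ('a \<Rightarrow> 'e \<Rightarrow> real) \<Rightarrow> ('a \<Rightarrow> 'e \<Rightarrow> 'e \<Rightarrow> real) \<Rightarrow> bool" where
  "cosymplectic_manifold A \<phi> \<xi> \<eta> g \<longleftrightarrow>
     almost_contact_metric A \<phi> \<xi> \<eta> g \<and>
     normal_structure A \<phi> \<xi> \<eta> \<and>
     closed1 A \<eta> \<and>
     closed2 A (\<lambda>p v w. g p v (\<phi> p w))"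


section \<open>Riemannian submersions\<close>

definition vertical ::
    "('a, 'e::euclidean_space) chart set \<Rightarrow> ('b, 'f::euclidean_space) chart set \<Rightarrow>
     ('a \<Rightarrow> 'b) \<Rightarrow> 'a \<Rightarrow> 'e set" where
  "vertical A B F p = {v. differential A B F p v = 0}"

definition horizontal ::
    "('a, 'e::euclidean_space) chart set \<Rightarrow> ('b, 'f::euclidean_space) chart set \<Rightarrow>
     ('a \<Rightarrow> 'e \<Rightarrow> 'e \<Rightarrow> real) \<Rightarrow> ('a \<Rightarrow> 'b) \<Rightarrow> 'a \<Rightarrow> 'e set" where
  "horizontal A B g F p = {v. \<forall>w\<in>vertical A B F p. g p v w = 0}"

definition riemannian_submersion ::
    "('a::topological_space, 'e::euclidean_space) chart set \<Rightarrow>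
     ('b::topological_space, 'f::euclidean_space) chart set \<Rightarrow>
     ('a \<Rightarrow> 'e \<Rightarrow> 'e \<Rightarrow> real) \<Rightarrow> ('b \<Rightarrow> 'f \<Rightarrow> 'f \<Rightarrow> real) \<Rightarrow> ('a \<Rightarrow> 'b) \<Rightarrow> bool" where
  "riemannian_submersion A B gM gN F \<longleftrightarrow>
     smooth_map A B F \<and> surj F \<and>
     (\<forall>p. surj (differential A B F p)) \<and>
     (\<forall>p. \<forall>v\<in>horizontal A B gM F p.
        sqrt (gN (F p) (differential A B F p v) (differential A B F p v)) = sqrt (gM p v v))"

definition anti_invariant ::
    "('a, 'e::euclidean_space) chart set \<Rightarrow> ('b, 'f::euclidean_space) chart set \<Rightarrow>
     ('a \<Rightarrow> 'e \<Rightarrow> 'e) \<Rightarrow> ('a \<Rightarrow> 'e \<Rightarrow> 'e \<Rightarrow> real) \<Rightarrow> ('a \<Rightarrow> 'b) \<Rightarrow> bool" where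
  "anti_invariant A B \<phi> g F \<longleftrightarrow> (\<forall>p. \<phi> p ` vertical A B F p \<subseteq> horizontal A B g F p)"

definition is_direct_sum :: "'v::real_vector set \<Rightarrow> 'v set \<Rightarrow> 'v set \<Rightarrow> bool" where
  "is_direct_sum W S T \<longleftrightarrow> W = {s + t | s t. s \<in> S \<and> t \<in> T} \<and> S \<inter> T = {0}"

definition orth_proj ::
    "('a \<Rightarrow> 'e::euclidean_space \<Rightarrow> 'e \<Rightarrow> real) \<Rightarrow> 'a \<Rightarrow> 'e set \<Rightarrow> 'e \<Rightarrow> 'e" where
  "orth_proj g p W v = (THE w. w \<in> W \<and> (\<forall>u\<in>W. g p (v - w) u = 0))"

definition ver_proj ::
    "('a, 'e::euclidean_space) chart set \<Rightarrow> ('b, 'f::euclidean_space) chart set \<Rightarrow>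
     ('a \<Rightarrow> 'e \<Rightarrow> 'e \<Rightarrow> real) \<Rightarrow> ('a \<Rightarrow> 'b) \<Rightarrow> 'a \<Rightarrow> 'e \<Rightarrow> 'e" where
  "ver_proj A B g F p v = orth_proj g p (vertical A B F p) v"

definition hor_proj ::
    "('a, 'e::euclidean_space) chart set \<Rightarrow> ('b, 'f::euclidean_space) chart set \<Rightarrow>
     ('a \<Rightarrow> 'e \<Rightarrow> 'e \<Rightarrow> real) \<Rightarrow> ('a \<Rightarrow> 'b) \<Rightarrow> 'a \<Rightarrow> 'e \<Rightarrow> 'e" where
  "hor_proj A B g F p v = orth_proj g p (horizontal A B g F p) v"

definition oneill_T ::
    "('a, 'e::euclidean_space) chart set \<Rightarrow> ('b, 'f::euclidean_space) chart set \<Rightarrow>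
     ('a \<Rightarrow> 'e \<Rightarrow> 'e \<Rightarrow> real) \<Rightarrow> ('a \<Rightarrow> 'e \<Rightarrow> ('a \<Rightarrow> 'e) \<Rightarrow> 'e) \<Rightarrow> ('a \<Rightarrow> 'b) \<Rightarrow>
     ('a \<Rightarrow> 'e) \<Rightarrow> ('a \<Rightarrow> 'e) \<Rightarrow> 'a \<Rightarrow> 'e" where
  "oneill_T A B g D F E G p =
     hor_proj A B g F p (D p (ver_proj A B g F p (E p)) (\<lambda>q. ver_proj A B g F q (G q)))
     + ver_proj A B g F p (D p (ver_proj A B g F p (E p)) (\<lambda>q. hor_proj A B g F q (G q)))"

definition oneill_A ::
    "('a, 'e::euclidean_space) chart set \<Rightarrow> ('b, 'f::euclidean_space) chart set \<Rightarrow>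
     ('a \<Rightarrow> 'e \<Rightarrow> 'e \<Rightarrow> real) \<Rightarrow> ('a \<Rightarrow> 'e \<Rightarrow> ('a \<Rightarrow> 'e) \<Rightarrow> 'e) \<Rightarrow> ('a \<Rightarrow> 'b) \<Rightarrow>
     ('a \<Rightarrow> 'e) \<Rightarrow> ('a \<Rightarrow> 'e) \<Rightarrow> 'a \<Rightarrow> 'e" where
  "oneill_A A B g D F E G p =
     ver_proj A B g F p (D p (hor_proj A B g F p (E p)) (\<lambda>q. hor_proj A B g F q (G q)))
     + hor_proj A B g F p (D p (hor_proj A B g F p (E p)) (\<lambda>q. ver_proj A B g F q (G q)))"

definition second_fundamental_form ::
    "('a, 'e::euclidean_space) chart set \<Rightarrow> ('b, 'f::euclidean_space) chart set \<Rightarrow>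
     ('a \<Rightarrow> 'e \<Rightarrow> ('a \<Rightarrow> 'e) \<Rightarrow> 'e) \<Rightarrow> ('a \<Rightarrow> 'e \<Rightarrow> ('a \<Rightarrow> 'f) \<Rightarrow> 'f) \<Rightarrow>
     ('a \<Rightarrow> 'b) \<Rightarrow> ('a \<Rightarrow> 'e) \<Rightarrow> ('a \<Rightarrow> 'e) \<Rightarrow> 'a \<Rightarrow> 'f" where
  "second_fundamental_form A B DM DF F X Y p =
     DF p (X p) (\<lambda>q. differential A B F q (Y q)) - differential A B F p (DM p (X p) Y)"

definition totally_geodesic_map ::
    "('a::topological_space, 'e::euclidean_space) chart set \<Rightarrow>
     ('b, 'f::euclidean_space) chart set \<Rightarrow>
     ('a \<Rightarrow> 'e \<Rightarrow> ('a \<Rightarrow> 'e) \<Rightarrow> 'e) \<Rightarrow> ('a \<Rightarrow> 'e \<Rightarrow> ('a \<Rightarrow> 'f) \<Rightarrow> 'f) \<Rightarrow> ('a \<Rightarrow> 'b) \<Rightarrow> bool" where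
  "totally_geodesic_map A B DM DF F \<longleftrightarrow>
     (\<forall>X Y. vector_field_on A UNIV X \<and> vector_field_on A UNIV Y \<longrightarrow>
        (\<forall>p. second_fundamental_form A B DM DF F X Y p = 0))"

definition vertical_fields ::
    "('a, 'e::euclidean_space) chart set \<Rightarrow> ('b, 'f::euclidean_space) chart set \<Rightarrow>
     ('a \<Rightarrow> 'b) \<Rightarrow> ('a \<Rightarrow> 'e) set" where
  "vertical_fields A B F = {V. vector_field_on A UNIV V \<and> (\<forall>p. V p \<in> vertical A B F p)}"

definition horizontal_fields ::
    "('a, 'e::euclidean_space) chart set \<Rightarrow> ('b, 'f::euclidean_space) chart set \<Rightarrow>
     ('a \<Rightarrow> 'e \<Rightarrow> 'e \<Rightarrow> real) \<Rightarrow> ('a \<Rightarrow> 'b) \<Rightarrow> ('a \<Rightarrow> 'e) set" where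
  "horizontal_fields A B g F =
     {X. vector_field_on A UNIV X \<and> (\<forall>p. X p \<in> horizontal A B g F p)}"

end

theory Submission
  imports Defs
begin

text \<open>The second fundamental form \<open>B\<close> of \<open>F\<close> is symmetric, since the pullback connection inherits
  torsion-freeness, and \<open>B(X,Y) = 0\<close> for horizontal \<open>X\<close> and \<open>Y\<close>, since \<open>h (B(X,Y), F\<^sub>* Z)\<close> is then
  symmetric in \<open>X, Y\<close> and skew in \<open>Y, Z\<close>. So \<open>F\<close> is totally geodesic iff \<open>B(E,V) = - F\<^sub>* (\<nabla>\<^sub>E V)\<close>
  vanishes for vertical \<open>V\<close>, i.e. iff \<open>\<nabla>\<^sub>E V\<close> is vertical. As \<open>\<nabla>\<phi> = 0\<close> and \<open>\<nabla>\<xi> = 0\<close>, the horizontal part of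
  \<open>\<nabla>\<^sub>E V\<close> is some \<open>\<phi> t\<close> with \<open>t\<close> vertical, and the vertical part of \<open>\<nabla>\<^sub>E (\<phi> V) = \<phi> (\<nabla>\<^sub>E V)\<close> is \<open>- t\<close>;
  it equals \<open>\<T>\<^sub>E \<phi> V\<close> or \<open>\<A>\<^sub>E \<phi> V\<close> for \<open>E\<close> vertical or horizontal.

  No extension of local fields is needed, because the projections of smooth fields are smooth.\<close>

section \<open>Calculus of smooth functions on open sets\<close>

text \<open>The structure equation \<nabla>\<phi> = 0 is not built into
  \<open>cosymplectic_manifold\<close>; it has to be derived from normality and the closedness of
  \<eta> and \<Phi>. Connections act on fields, so \<nabla>\<phi> is first shown to be tensorial;
  its identities then become linear algebra in one tangent space. A second obstacle is that the
  chart behind the tangent space at \<open>p\<close> jumps with \<open>p\<close>, and that the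
  pullback connection is prescribed only on sections \<open>Z \<circ> F\<close>. Both are met by
  expanding in the coordinate frame of one fixed chart: metric compatibility and vanishing torsion
  of the pullback connection then come from those on the target by the chain rule. Smoothness of the
  projections cannot be read off their definite descriptions. It comes from g(HX, E) = h(dF X, dF E)
  for the horizontal part HX of X: the right side is smooth for every smooth field E, and products
  with a smooth frame determine smooth components.\<close>

lemma frechet_derivative_cong_open:
  assumes "open S" "x \<in> S" "\<And>y. y \<in> S \<Longrightarrow> f y = g y"
  shows "frechet_derivative f (at x) = frechet_derivative g (at x)"
proof -
  have "(f has_derivative D) (at x) \<longleftrightarrow> (g has_derivative D) (at x)" for D
    using has_derivative_transform_within_open[of f D x UNIV S g]
      has_derivative_transform_within_open[of g D x UNIV S f] assms by auto
  then show ?thesis by (simp add: frechet_derivative_def)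
qed

lemma frechet_derivative_has_derivative:
  "f differentiable (at x) \<Longrightarrow> (f has_derivative frechet_derivative f (at x)) (at x)"
  by (simp add: frechet_derivative_works[symmetric])

text \<open>The derivative formulas in the closure rules below hold only at points of the open set
  \<open>S\<close>; this lemma lets them replace \<open>frechet_derivative\<close> inside
  \<open>Ck_on\<close>.\<close>

lemma Ck_on_cong:
  assumes "open S" "Ck_on k S f" "\<And>x. x \<in> S \<Longrightarrow> f x = g x"
  shows "Ck_on k S g"
  using assms(2,3)
proof (induction k arbitrary: f g)
  case 0 then show ?case by (auto cong: continuous_on_cong)
next
  case (Suc k)
  have 1: "g differentiable (at x)" if "x \<in> S" for x
  proof -
    have "(f has_derivative frechet_derivative f (at x)) (at x)"
      using Suc.prems(1) that by (simp add: frechet_derivative_has_derivative)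
    then have "(g has_derivative frechet_derivative f (at x)) (at x)"
      using assms(1) that Suc.prems(2) by (rule has_derivative_transform_within_open)
    then show ?thesis by (auto simp: differentiable_def)
  qed
  have 2: "Ck_on k S (\<lambda>x. frechet_derivative g (at x) v)" for v
  proof (rule Suc.IH)
    show "Ck_on k S (\<lambda>x. frechet_derivative f (at x) v)" using Suc.prems by simp
    show "frechet_derivative f (at x) v = frechet_derivative g (at x) v" if "x \<in> S" for x
      using frechet_derivative_cong_open[OF assms(1) that, of f g] Suc.prems by simp
  qed
  show ?case using 1 2 by simp
qed

lemma Ck_on_subset: "Ck_on k S f \<Longrightarrow> T \<subseteq> S \<Longrightarrow> Ck_on k T f"
  by (induction k arbitrary: f) (auto intro: continuous_on_subset)

lemma Ck_on_pred: "Ck_on (Suc k) S f \<Longrightarrow> Ck_on k S f"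
proof (induction k arbitrary: f)
  case 0
  then show ?case
    by (auto intro!: continuous_at_imp_continuous_on differentiable_imp_continuous_within)
next
  case (Suc k)
  then show ?case by (metis Ck_on.simps(2))
qed

lemma Ck_on_local:
  assumes "\<And>x. x \<in> S \<Longrightarrow> \<exists>T. open T \<and> x \<in> T \<and> Ck_on k T f"
  shows "Ck_on k S f"
  using assms
proof (induction k arbitrary: f)
  case 0
  have "continuous (at x) f" if "x \<in> S" for x
    using 0[OF that] by (auto simp: continuous_on_eq_continuous_at)
  then show ?case by (auto intro: continuous_at_imp_continuous_on)
next
  case (Suc k)
  have "f differentiable (at x)" if "x \<in> S" for x using Suc.prems[OF that] by auto
  moreover have "Ck_on k S (\<lambda>x. frechet_derivative f (at x) v)" for v
    by (rule Suc.IH) (use Suc.prems in fastforce)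
  ultimately show ?case by simp
qed

lemma Ck_on_const: "Ck_on k S (\<lambda>x. c)"
  by (induction k arbitrary: c) auto

lemma Ck_on_add:
  assumes "open S" shows "Ck_on k S f \<Longrightarrow> Ck_on k S g \<Longrightarrow> Ck_on k S (\<lambda>x. f x + g x)"
proof (induction k arbitrary: f g)
  case 0 then show ?case by (auto intro: continuous_on_add)
next
  case (Suc k)
  have "Ck_on k S (\<lambda>x. frechet_derivative (\<lambda>x. f x + g x) (at x) v)" for v
  proof (rule Ck_on_cong[OF assms Suc.IH])
    show "Ck_on k S (\<lambda>x. frechet_derivative f (at x) v)" "Ck_on k S (\<lambda>x. frechet_derivative g (at x) v)"
      using Suc.prems by auto
    show "frechet_derivative f (at x) v + frechet_derivative g (at x) v
      = frechet_derivative (\<lambda>x. f x + g x) (at x) v" if "x \<in> S" for x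
      using Suc.prems that
      by (intro frechet_derivative_at[OF has_derivative_add, THEN fun_cong])
        (auto intro: frechet_derivative_has_derivative)
  qed
  then show ?case using Suc.prems by auto
qed

lemma Ck_on_sum:
  assumes "open S" "\<And>i. i \<in> I \<Longrightarrow> Ck_on k S (f i)"
  shows "Ck_on k S (\<lambda>x. \<Sum>i\<in>I. f i x)"
  using assms(2)
  by (induction I rule: infinite_finite_induct) (auto intro: Ck_on_const Ck_on_add[OF assms(1)])

lemma Ck_on_bilinear:
  assumes "open S" and bl: "bounded_bilinear B"
  shows "Ck_on k S f \<Longrightarrow> Ck_on k S g \<Longrightarrow> Ck_on k S (\<lambda>x. B (f x) (g x))"
proof (induction k arbitrary: f g)
  case 0 then show ?case using bounded_bilinear.continuous_on[OF bl] by auto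
next
  case (Suc k)
  have d: "((\<lambda>x. B (f x) (g x)) has_derivative
    (\<lambda>v. B (f x) (frechet_derivative g (at x) v) + B (frechet_derivative f (at x) v) (g x))) (at x)"
    if "x \<in> S" for x
    using Suc.prems that
    by (intro bounded_bilinear.FDERIV[OF bl]) (auto intro: frechet_derivative_has_derivative)
  have "Ck_on k S (\<lambda>x. frechet_derivative (\<lambda>x. B (f x) (g x)) (at x) v)" for v
  proof (rule Ck_on_cong[OF assms(1)])
    \<comment> \<open>The product rule pairs one derivative with the other factor itself, and that
      factor enters with one order of smoothness less.\<close>
    show "Ck_on k S (\<lambda>x. B (f x) (frechet_derivative g (at x) v) + B (frechet_derivative f (at x) v) (g x))"
      using Suc.prems by (intro Ck_on_add[OF assms(1)]; intro Suc.IH) (use Suc.prems[THEN Ck_on_pred] in auto)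
    show "B (f x) (frechet_derivative g (at x) v) + B (frechet_derivative f (at x) v) (g x)
      = frechet_derivative (\<lambda>x. B (f x) (g x)) (at x) v" if "x \<in> S" for x
      by (rule frechet_derivative_at[OF d[OF that], THEN fun_cong])
  qed
  then show ?case using d by (auto simp: differentiable_def)
qed

lemma Ck_on_inverse:
  fixes f :: "'a::euclidean_space \<Rightarrow> real"
  assumes "open S" and nz: "\<And>x. x \<in> S \<Longrightarrow> f x \<noteq> 0"
  shows "Ck_on k S f \<Longrightarrow> Ck_on k S (\<lambda>x. inverse (f x))"
proof (induction k)
  case 0 then show ?case using nz by (auto intro: continuous_on_inverse)
next
  case (Suc k)
  have d: "((\<lambda>x. inverse (f x)) has_derivative
    (\<lambda>v. - (inverse (f x) * frechet_derivative f (at x) v * inverse (f x)))) (at x)"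
    if "x \<in> S" for x
    by (rule Deriv.has_derivative_inverse)
      (use Suc.prems that nz in \<open>auto intro: frechet_derivative_has_derivative\<close>)
  have I: "Ck_on k S (\<lambda>x. inverse (f x))" using Suc Ck_on_pred by blast
  have "Ck_on k S (\<lambda>x. frechet_derivative (\<lambda>x. inverse (f x)) (at x) v)" for v
  proof (rule Ck_on_cong[OF assms(1)])
    show "Ck_on k S (\<lambda>x. (-1) * (inverse (f x) * frechet_derivative f (at x) v * inverse (f x)))"
      using I Suc.prems by (intro Ck_on_bilinear[OF assms(1) bounded_bilinear_mult] Ck_on_const) auto
    show "(-1) * (inverse (f x) * frechet_derivative f (at x) v * inverse (f x))
      = frechet_derivative (\<lambda>x. inverse (f x)) (at x) v" if "x \<in> S" for x
      using frechet_derivative_at[OF d[OF that], THEN fun_cong, of v] by simp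
  qed
  then show ?case using d by (auto simp: differentiable_def)
qed

lemma linear_Basis_expansion:
  fixes f :: "'a::euclidean_space \<Rightarrow> 'b::real_vector"
  assumes "linear f" shows "f v = (\<Sum>b\<in>Basis. (v \<bullet> b) *\<^sub>R f b)"
proof -
  have "f v = f (\<Sum>b\<in>Basis. (v \<bullet> b) *\<^sub>R b)" by (simp add: euclidean_representation)
  also have "\<dots> = (\<Sum>b\<in>Basis. (v \<bullet> b) *\<^sub>R f b)"
    using assms by (simp add: linear_sum linear_scale)
  finally show ?thesis .
qed

lemma Ck_on_compose:
  fixes f :: "'b::euclidean_space \<Rightarrow> 'c::real_normed_vector" and g :: "'a::euclidean_space \<Rightarrow> 'b"
  assumes S: "open S" and T: "open T" and gST: "g ` S \<subseteq> T"
  shows "Ck_on k T f \<Longrightarrow> Ck_on k S g \<Longrightarrow> Ck_on k S (\<lambda>x. f (g x))"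
proof (induction k arbitrary: f)
  case 0 then show ?case using gST by (auto intro: continuous_on_compose2)
next
  case (Suc k)
  have df: "f differentiable (at (g x))" and dg: "g differentiable (at x)" if "x \<in> S" for x
    using Suc.prems that gST by auto
  have d: "((\<lambda>x. f (g x)) has_derivative
    (\<lambda>v. frechet_derivative f (at (g x)) (frechet_derivative g (at x) v))) (at x)" if "x \<in> S" for x
    using has_derivative_compose[OF frechet_derivative_has_derivative[OF dg[OF that]]
        frechet_derivative_has_derivative[OF df[OF that]]] .
  have "Ck_on k S (\<lambda>x. frechet_derivative (\<lambda>x. f (g x)) (at x) v)" for v
  proof (rule Ck_on_cong[OF assms(1)])
    \<comment> \<open>The chain rule applies the derivative of \<open>f\<close> at
      \<open>g x\<close> to a vector that varies with \<open>x\<close>, while the induction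
      hypothesis speaks of fixed directions; expanding in \<open>Basis\<close> separates the
      two.\<close>
    show "Ck_on k S (\<lambda>x. \<Sum>b\<in>Basis. (frechet_derivative g (at x) v \<bullet> b) *\<^sub>R frechet_derivative f (at (g x)) b)"
    proof (rule Ck_on_sum[OF S])
      fix b :: 'b
      have "Ck_on k S (\<lambda>x. frechet_derivative g (at x) v \<bullet> b)"
        by (rule Ck_on_bilinear[OF S bounded_bilinear_inner _ Ck_on_const]) (use Suc.prems in simp)
      moreover have "Ck_on k S (\<lambda>x. frechet_derivative f (at (g x)) b)"
        by (rule Suc.IH[OF _ Ck_on_pred[OF Suc.prems(2)]]) (use Suc.prems in simp)
      ultimately show "Ck_on k S (\<lambda>x. (frechet_derivative g (at x) v \<bullet> b) *\<^sub>R frechet_derivative f (at (g x)) b)"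
        by (rule Ck_on_bilinear[OF S bounded_bilinear_scaleR])
    qed
    show "(\<Sum>b\<in>Basis. (frechet_derivative g (at x) v \<bullet> b) *\<^sub>R frechet_derivative f (at (g x)) b)
      = frechet_derivative (\<lambda>x. f (g x)) (at x) v" if "x \<in> S" for x
      using linear_Basis_expansion[OF linear_frechet_derivative[OF df[OF that]], symmetric]
        frechet_derivative_at[OF d[OF that], THEN fun_cong, of v] by simp
  qed
  then show ?case using d by (auto simp: differentiable_def)
qed

lemma smooth_on_cong:
  "open S \<Longrightarrow> smooth_on S f \<Longrightarrow> (\<And>x. x \<in> S \<Longrightarrow> f x = g x) \<Longrightarrow> smooth_on S g"
  unfolding smooth_on_def by (blast intro: Ck_on_cong)

lemma smooth_on_subset: "smooth_on S f \<Longrightarrow> T \<subseteq> S \<Longrightarrow> smooth_on T f"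
  unfolding smooth_on_def by (blast intro: Ck_on_subset)

lemma smooth_on_local:
  "(\<And>x. x \<in> S \<Longrightarrow> \<exists>T. open T \<and> x \<in> T \<and> smooth_on T f) \<Longrightarrow> smooth_on S f"
  unfolding smooth_on_def by (intro allI Ck_on_local) blast

lemma smooth_on_const: "smooth_on S (\<lambda>x. c)"
  unfolding smooth_on_def by (blast intro: Ck_on_const)

lemma smooth_on_add:
  "open S \<Longrightarrow> smooth_on S f \<Longrightarrow> smooth_on S g \<Longrightarrow> smooth_on S (\<lambda>x. f x + g x)"
  unfolding smooth_on_def by (blast intro: Ck_on_add)

lemma smooth_on_bilinear:
  "open S \<Longrightarrow> bounded_bilinear B \<Longrightarrow> smooth_on S f \<Longrightarrow> smooth_on S g \<Longrightarrow> smooth_on S (\<lambda>x. B (f x) (g x))"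
  unfolding smooth_on_def by (blast intro: Ck_on_bilinear)

lemma smooth_on_inverse:
  fixes f :: "'a::euclidean_space \<Rightarrow> real"
  shows "open S \<Longrightarrow> (\<And>x. x \<in> S \<Longrightarrow> f x \<noteq> 0) \<Longrightarrow> smooth_on S f \<Longrightarrow> smooth_on S (\<lambda>x. inverse (f x))"
  unfolding smooth_on_def by (blast intro: Ck_on_inverse)

lemma smooth_on_compose:
  fixes f :: "'b::euclidean_space \<Rightarrow> 'c::real_normed_vector" and g :: "'a::euclidean_space \<Rightarrow> 'b"
  assumes "open S" "open T" "smooth_on T f" "smooth_on S g" "g ` S \<subseteq> T"
  shows "smooth_on S (\<lambda>x. f (g x))"
  using assms unfolding smooth_on_def by (blast intro: Ck_on_compose)

lemma smooth_on_differentiable: "smooth_on S f \<Longrightarrow> x \<in> S \<Longrightarrow> f differentiable (at x)"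
  unfolding smooth_on_def by (metis Ck_on.simps(2))

lemma smooth_on_continuous: "smooth_on S f \<Longrightarrow> continuous_on S f"
  unfolding smooth_on_def by (metis Ck_on.simps(1))

lemma smooth_on_frechet_derivative: "smooth_on S f \<Longrightarrow> smooth_on S (\<lambda>x. frechet_derivative f (at x) v)"
  unfolding smooth_on_def by (metis Ck_on.simps(2))

text \<open>The mean value theorem is applied twice: along \<open>v\<close> to the difference of
  \<open>G\<close> on two parallel segments, then along \<open>w\<close> to the derivative of
  \<open>G\<close> in direction \<open>v\<close>.\<close>

lemma second_difference_mean_value:
  fixes G :: "'a::euclidean_space \<Rightarrow> real"
  assumes S: "smooth_on S G" and t: "0 < t" and x: "ball x d \<subseteq> S" and d: "t * (norm v + norm w) < d"
  obtains a b where "0 < a" "a < t" "0 < b" "b < t"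
    "G (x + t *\<^sub>R v + t *\<^sub>R w) - G (x + t *\<^sub>R v) - G (x + t *\<^sub>R w) + G x
     = t * t * frechet_derivative (\<lambda>y. frechet_derivative G (at y) v) (at (x + a *\<^sub>R v + b *\<^sub>R w)) w"
proof -
  define Gv where "Gv = (\<lambda>y. frechet_derivative G (at y) v)"
  \<comment> \<open>The whole parallelogram spanned by \<open>t *\<^sub>R v\<close> and
    \<open>t *\<^sub>R w\<close> stays in the ball, hence in the region of smoothness.\<close>
  have inS: "x + a *\<^sub>R v + b *\<^sub>R w \<in> S" if "0 \<le> a" "a \<le> t" "0 \<le> b" "b \<le> t" for a b
  proof -
    have "norm (a *\<^sub>R v + b *\<^sub>R w) \<le> a * norm v + b * norm w"
      using that norm_triangle_ineq[of "a *\<^sub>R v" "b *\<^sub>R w"] by simp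
    also have "\<dots> \<le> t * norm v + t * norm w" using that by (intro add_mono mult_right_mono) auto
    also have "\<dots> < d" using d by (simp add: algebra_simps)
    finally have "x + (a *\<^sub>R v + b *\<^sub>R w) \<in> ball x d" by (metis mem_ball dist_norm dist_commute add_diff_cancel_left')
    then show ?thesis using x by (auto simp: add.assoc)
  qed
  have curve: "((\<lambda>s. H (y + s *\<^sub>R u)) has_real_derivative frechet_derivative H (at (y + s *\<^sub>R u)) u) (at s)"
    if "H differentiable (at (y + s *\<^sub>R u))" for H :: "'a \<Rightarrow> real" and y u s
  proof -
    have "((\<lambda>s. y + s *\<^sub>R u) has_derivative (\<lambda>h. h *\<^sub>R u)) (at s)"
      by (auto intro!: derivative_eq_intros)
    from has_derivative_compose[OF this frechet_derivative_has_derivative[OF that]]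
    have "((\<lambda>s. H (y + s *\<^sub>R u)) has_derivative (\<lambda>h. frechet_derivative H (at (y + s *\<^sub>R u)) (h *\<^sub>R u))) (at s)" .
    then show ?thesis
      using linear_frechet_derivative[OF that]
      by (simp add: has_field_derivative_def linear_scale mult_commute_abs)
  qed
  have dG: "G differentiable (at y)" and dGv: "Gv differentiable (at y)" if "y \<in> S" for y
    using smooth_on_differentiable[OF S that]
      smooth_on_differentiable[OF smooth_on_frechet_derivative[OF S] that, of v] by (auto simp: Gv_def)
  have "\<exists>a. 0 < a \<and> a < t \<and>
     (G (x + t *\<^sub>R w + t *\<^sub>R v) - G (x + t *\<^sub>R v)) - (G (x + t *\<^sub>R w + 0 *\<^sub>R v) - G (x + 0 *\<^sub>R v))
      = (t - 0) * (Gv (x + t *\<^sub>R w + a *\<^sub>R v) - Gv (x + a *\<^sub>R v))"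
  proof (rule MVT2[OF t])
    fix s :: real assume s: "0 \<le> s" "s \<le> t"
    have "x + t *\<^sub>R w + s *\<^sub>R v \<in> S" "x + s *\<^sub>R v \<in> S"
      using inS[of s t] inS[of s 0] s t by (auto simp: algebra_simps)
    then show "((\<lambda>s. G (x + t *\<^sub>R w + s *\<^sub>R v) - G (x + s *\<^sub>R v)) has_real_derivative
        (Gv (x + t *\<^sub>R w + s *\<^sub>R v) - Gv (x + s *\<^sub>R v))) (at s)"
      unfolding Gv_def by (intro DERIV_diff curve dG)
  qed
  then obtain a where a: "0 < a" "a < t"
    "(G (x + t *\<^sub>R w + t *\<^sub>R v) - G (x + t *\<^sub>R v)) - (G (x + t *\<^sub>R w + 0 *\<^sub>R v) - G (x + 0 *\<^sub>R v))
      = (t - 0) * (Gv (x + t *\<^sub>R w + a *\<^sub>R v) - Gv (x + a *\<^sub>R v))" by blast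
  have "\<exists>b. 0 < b \<and> b < t \<and> Gv (x + a *\<^sub>R v + t *\<^sub>R w) - Gv (x + a *\<^sub>R v + 0 *\<^sub>R w)
     = (t - 0) * frechet_derivative Gv (at (x + a *\<^sub>R v + b *\<^sub>R w)) w"
    by (rule MVT2[OF t]) (use a in \<open>auto intro!: curve dGv inS\<close>)
  then obtain b where b: "0 < b" "b < t" "Gv (x + a *\<^sub>R v + t *\<^sub>R w) - Gv (x + a *\<^sub>R v)
     = t * frechet_derivative Gv (at (x + a *\<^sub>R v + b *\<^sub>R w)) w" by auto
  have "G (x + t *\<^sub>R v + t *\<^sub>R w) - G (x + t *\<^sub>R v) - G (x + t *\<^sub>R w) + G x
     = t * t * frechet_derivative Gv (at (x + a *\<^sub>R v + b *\<^sub>R w)) w"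
    using a(3) b(3) by (simp add: add_ac mult.assoc)
  then show thesis using that a b unfolding Gv_def by blast
qed

text \<open>The second difference of \<open>G\<close> is unchanged when \<open>v\<close> and
  \<open>w\<close> are swapped, and up to the factor \<open>t * t\<close> it is a value of either
  mixed derivative near \<open>x\<close>; continuity at \<open>x\<close> does the rest.\<close>

lemma second_derivative_symmetric_real:
  fixes G :: "'a::euclidean_space \<Rightarrow> real"
  assumes S: "smooth_on S G" "open S" "x \<in> S"
  shows "frechet_derivative (\<lambda>y. frechet_derivative G (at y) v) (at x) w
       = frechet_derivative (\<lambda>y. frechet_derivative G (at y) w) (at x) v"
proof (rule ccontr)
  define H where "H = (\<lambda>v w y. frechet_derivative (\<lambda>y. frechet_derivative G (at y) v) (at y) w)"
  assume "\<not> ?thesis"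
  \<comment> \<open>The tolerance is half the supposed gap: one common value cannot be closer than
    that to both mixed derivatives at \<open>x\<close>.\<close>
  then have e: "\<bar>H v w x - H w v x\<bar> / 2 > 0" (is "?e > 0") by (simp add: H_def)
  have "continuous_on S (H v w)" for v w
    unfolding H_def by (intro smooth_on_continuous smooth_on_frechet_derivative S)
  then have cont: "continuous (at x) (H v w)" for v w
    using S continuous_on_eq_continuous_at by blast
  have near: "\<exists>r>0. \<forall>y. dist y x < r \<longrightarrow> \<bar>H v w y - H v w x\<bar> < ?e" for v w
    using cont[of v w, unfolded continuous_at_eps_delta dist_real_def, rule_format, OF e] .
  obtain r1 where r1: "r1 > 0" "\<And>y. dist y x < r1 \<Longrightarrow> \<bar>H v w y - H v w x\<bar> < ?e" using near by blast
  obtain r2 where r2: "r2 > 0" "\<And>y. dist y x < r2 \<Longrightarrow> \<bar>H w v y - H w v x\<bar> < ?e" using near by blast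
  obtain r3 where r3: "r3 > 0" "ball x r3 \<subseteq> S" using S open_contains_ball by blast
  define r where "r = min r1 (min r2 r3)"
  \<comment> \<open>The summand 1 keeps the denominator positive when \<open>v\<close> and
    \<open>w\<close> are both zero; with this \<open>t\<close> the parallelogram lies within
    \<open>r\<close> of \<open>x\<close>.\<close>
  define t where "t = r / (norm v + norm w + 1) / 2"
  have r: "r > 0" using r1 r2 r3 by (simp add: r_def)
  have t: "t > 0" using r by (simp add: t_def add_nonneg_pos)
  have "norm v + norm w + 1 > 0" by (simp add: add_nonneg_pos)
  then have "t * (norm v + norm w + 1) = r / 2" by (simp add: t_def field_simps)
  then have tr: "t * (norm v + norm w) < r" using r t by (simp add: algebra_simps)
  have dist: "dist (x + a *\<^sub>R v' + b *\<^sub>R w') x < r"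
    if "0 < a" "a < t" "0 < b" "b < t" "norm v' + norm w' = norm v + norm w" for a b v' w'
  proof -
    have "norm (a *\<^sub>R v' + b *\<^sub>R w') \<le> a * norm v' + b * norm w'"
      using that norm_triangle_ineq[of "a *\<^sub>R v'" "b *\<^sub>R w'"] by simp
    also have "\<dots> \<le> t * norm v' + t * norm w'" using that by (intro add_mono mult_right_mono) auto
    also have "\<dots> < r" using tr that(5) by (simp add: distrib_left[symmetric])
    finally show ?thesis by (simp add: dist_norm add.assoc)
  qed
  have ball: "ball x r \<subseteq> S" using r3 by (auto simp: r_def)
  obtain a b where ab: "0 < a" "a < t" "0 < b" "b < t"
    "G (x + t *\<^sub>R v + t *\<^sub>R w) - G (x + t *\<^sub>R v) - G (x + t *\<^sub>R w) + G x
     = t * t * H v w (x + a *\<^sub>R v + b *\<^sub>R w)"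
    using second_difference_mean_value[OF S(1) t ball tr] unfolding H_def by blast
  obtain a' b' where ab': "0 < a'" "a' < t" "0 < b'" "b' < t"
    "G (x + t *\<^sub>R w + t *\<^sub>R v) - G (x + t *\<^sub>R w) - G (x + t *\<^sub>R v) + G x
     = t * t * H w v (x + a' *\<^sub>R w + b' *\<^sub>R v)"
    using second_difference_mean_value[OF S(1) t ball, of w v] tr unfolding H_def
    by (metis add.commute)
  have "t * t * H v w (x + a *\<^sub>R v + b *\<^sub>R w) = t * t * H w v (x + a' *\<^sub>R w + b' *\<^sub>R v)"
    using ab(5) ab'(5) by (simp add: algebra_simps)
  then have "H v w (x + a *\<^sub>R v + b *\<^sub>R w) = H w v (x + a' *\<^sub>R w + b' *\<^sub>R v)" using t by simp
  moreover have "\<bar>H v w (x + a *\<^sub>R v + b *\<^sub>R w) - H v w x\<bar> < ?e"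
    using dist[OF ab(1-4)] by (intro r1) (auto simp: r_def)
  moreover have "\<bar>H w v (x + a' *\<^sub>R w + b' *\<^sub>R v) - H w v x\<bar> < ?e"
    using dist[OF ab'(1-4), of w v] by (intro r2) (auto simp: r_def)
  ultimately show False by (smt (verit) field_sum_of_halves)
qed

lemma frechet_derivative_inner_right:
  assumes "f differentiable (at x)"
  shows "frechet_derivative (\<lambda>y. f y \<bullet> c) (at x) v = frechet_derivative f (at x) v \<bullet> c"
  by (rule frechet_derivative_at[THEN fun_cong, symmetric])
    (rule has_derivative_inner_left[OF frechet_derivative_has_derivative[OF assms]])

lemma second_derivative_symmetric:
  fixes G :: "'a::euclidean_space \<Rightarrow> 'b::euclidean_space"
  assumes S: "smooth_on S G" "open S" "x \<in> S"
  shows "frechet_derivative (\<lambda>y. frechet_derivative G (at y) v) (at x) w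
       = frechet_derivative (\<lambda>y. frechet_derivative G (at y) w) (at x) v"
proof (rule euclidean_eqI)
  fix b :: 'b
  have c: "smooth_on S (\<lambda>y. G y \<bullet> b)"
    by (intro smooth_on_bilinear[OF S(2) bounded_bilinear_inner] S smooth_on_const)
  have 1: "frechet_derivative (\<lambda>y. frechet_derivative G (at y) v) (at x) w \<bullet> b
     = frechet_derivative (\<lambda>y. frechet_derivative (\<lambda>y. G y \<bullet> b) (at y) v) (at x) w" for v w
  proof -
    have "frechet_derivative (\<lambda>y. frechet_derivative G (at y) v) (at x) w \<bullet> b
      = frechet_derivative (\<lambda>y. frechet_derivative G (at y) v \<bullet> b) (at x) w"
      using frechet_derivative_inner_right[OF smooth_on_differentiable[OF smooth_on_frechet_derivative[OF S(1)] S(3)]]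
      by simp
    also have "\<dots> = frechet_derivative (\<lambda>y. frechet_derivative (\<lambda>y. G y \<bullet> b) (at y) v) (at x) w"
      using frechet_derivative_inner_right smooth_on_differentiable[OF S(1)]
      by (intro frechet_derivative_cong_open[OF S(2,3), THEN fun_cong]) force
    finally show ?thesis .
  qed
  show "frechet_derivative (\<lambda>y. frechet_derivative G (at y) v) (at x) w \<bullet> b
      = frechet_derivative (\<lambda>y. frechet_derivative G (at y) w) (at x) v \<bullet> b"
    unfolding 1 by (rule second_derivative_symmetric_real[OF c S(2,3)])
qed

section \<open>Smooth vector-valued functions on manifolds and their derivatives\<close>

text \<open>Tangent coordinates and differentials are instances of \<open>mderiv\<close>, with a coordinate map in place
  of \<open>g\<close>.\<close>

definition msmooth_on :: "('a, 'e::euclidean_space) chart set \<Rightarrow> 'a set \<Rightarrow> ('a \<Rightarrow> 'v::real_normed_vector) \<Rightarrow> bool" where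
  "msmooth_on A U g \<longleftrightarrow> (\<forall>c\<in>A. smooth_on (snd c ` (U \<inter> fst c)) (\<lambda>x. g (chart_inv c x)))"

definition mderiv :: "('a, 'e::euclidean_space) chart set \<Rightarrow> ('a \<Rightarrow> 'v::real_normed_vector) \<Rightarrow> 'a \<Rightarrow> 'e \<Rightarrow> 'v" where
  "mderiv A g p v = frechet_derivative (\<lambda>x. g (chart_inv (chart_at A p) x)) (at (snd (chart_at A p) p)) v"

text \<open>\<open>coord_vec A c p w\<close> is the vector at \<open>p\<close> whose components in the chart \<open>c\<close> are \<open>w\<close>.\<close>

definition coord_vec :: "('a, 'e::euclidean_space) chart set \<Rightarrow> ('a, 'e) chart \<Rightarrow> 'a \<Rightarrow> 'e \<Rightarrow> 'e" where
  "coord_vec A c p w = frechet_derivative (\<lambda>x. snd (chart_at A p) (chart_inv c x)) (at (snd c p)) w"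

lemma smooth_fun_on_eq: "smooth_fun_on A U f = msmooth_on A U f"
  by (simp add: smooth_fun_on_def msmooth_on_def comp_def)

lemma vec_deriv_eq: "vec_deriv A f p v = mderiv A f p v"
  by (simp add: vec_deriv_def mderiv_def comp_def)

lemma tangent_coords_eq: "tangent_coords A c p v = mderiv A (snd c) p v"
  by (simp add: tangent_coords_def mderiv_def comp_def)

lemma differential_eq: "differential A B F p v = mderiv A (\<lambda>q. snd (chart_at B (F p)) (F q)) p v"
  by (simp add: differential_def mderiv_def comp_def)

text \<open>Smoothness of a section is traded for that of its component functions in each target
  chart, so that source charts appear only inside \<open>msmooth_on\<close>.\<close>

lemma section_along_eq:
  "section_along A B F U S \<longleftrightarrow>
    (\<forall>d\<in>B. msmooth_on A (U \<inter> F -` fst d) (\<lambda>q. mderiv B (snd d) (F q) (S q)))"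
proof -
  have eq: "U \<inter> fst c \<inter> F -` fst d = U \<inter> F -` fst d \<inter> fst c" for c :: "('a, 'b) chart" and d :: "('c, 'd) chart"
    by blast
  then show ?thesis
    unfolding section_along_def msmooth_on_def tangent_coords_eq eq by blast
qed

lemma smooth_map_eq:
  "smooth_map A B F \<longleftrightarrow> continuous_on UNIV F \<and> (\<forall>d\<in>B. msmooth_on A (F -` fst d) (\<lambda>q. snd d (F q)))"
  unfolding smooth_map_def msmooth_on_def comp_def by (auto simp: Int_commute)

lemma msmooth_on_subset: "msmooth_on A U g \<Longrightarrow> V \<subseteq> U \<Longrightarrow> msmooth_on A V g"
  unfolding msmooth_on_def by (fast intro: smooth_on_subset)

lemma msmooth_on_const: "msmooth_on A U (\<lambda>x. k)"
  by (simp add: msmooth_on_def smooth_on_const)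

context
  fixes A :: "('a::{t2_space,second_countable_topology}, 'e::euclidean_space) chart set"
  assumes A: "smooth_atlas A"
begin

lemma open_chart: "c \<in> A \<Longrightarrow> open (fst c)"
  using A by (auto simp: smooth_atlas_def)

lemma chart_inv_chart: "c \<in> A \<Longrightarrow> p \<in> fst c \<Longrightarrow> chart_inv c (snd c p) = p"
  using A by (auto simp: smooth_atlas_def homeomorphism_def)

lemma open_chart_image:
  assumes "c \<in> A" "open U" shows "open (snd c ` (U \<inter> fst c))"
proof -
  have h: "homeomorphism (fst c) (snd c ` fst c) (snd c) (chart_inv c)" "open (snd c ` fst c)"
    using A assms by (auto simp: smooth_atlas_def)
  have "snd c ` (U \<inter> fst c) = snd c ` fst c \<inter> chart_inv c -` U"
    using chart_inv_chart[OF assms(1)] by fastforce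
  then show ?thesis
    using h assms(2) by (auto simp: homeomorphism_def intro: continuous_open_preimage)
qed

lemma chart_at_mem: "chart_at A p \<in> A" "p \<in> fst (chart_at A p)"
proof -
  have "p \<in> (\<Union>c\<in>A. fst c)" using A by (simp add: smooth_atlas_def)
  then have "\<exists>c. c \<in> A \<and> p \<in> fst c" by blast
  then have "chart_at A p \<in> A \<and> p \<in> fst (chart_at A p)"
    unfolding chart_at_def by (rule someI_ex)
  then show "chart_at A p \<in> A" "p \<in> fst (chart_at A p)" by auto
qed

lemma msmooth_on_local:
  assumes "\<And>p. p \<in> U \<Longrightarrow> \<exists>V. open V \<and> p \<in> V \<and> msmooth_on A V g"
  shows "msmooth_on A U g"
  unfolding msmooth_on_def
proof (intro ballI smooth_on_local)
  fix c x assume c: "c \<in> A" and "x \<in> snd c ` (U \<inter> fst c)"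
  then obtain p where p: "p \<in> U" "p \<in> fst c" "x = snd c p" by auto
  obtain V where V: "open V" "p \<in> V" "msmooth_on A V g" using assms[OF p(1)] by auto
  show "\<exists>T. open T \<and> x \<in> T \<and> smooth_on T (\<lambda>x. g (chart_inv c x))"
    using open_chart_image[OF c V(1)] V p c
    by (intro exI[of _ "snd c ` (V \<inter> fst c)"]) (auto simp: msmooth_on_def)
qed

lemma msmooth_on_cong:
  assumes "open U" "msmooth_on A U f" "\<And>p. p \<in> U \<Longrightarrow> f p = g p" shows "msmooth_on A U g"
  unfolding msmooth_on_def
proof
  fix c assume c: "c \<in> A"
  have "smooth_on (snd c ` (U \<inter> fst c)) (\<lambda>x. f (chart_inv c x))"
    using assms(2) c by (simp add: msmooth_on_def)
  then show "smooth_on (snd c ` (U \<inter> fst c)) (\<lambda>x. g (chart_inv c x))"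
    by (rule smooth_on_cong[OF open_chart_image[OF c assms(1)]])
      (use assms(3) chart_inv_chart[OF c] in auto)
qed

lemma msmooth_on_compose:
  fixes f :: "'u::euclidean_space \<Rightarrow> 'v::real_normed_vector"
  assumes "open U" "msmooth_on A U g" "open T" "smooth_on T f" "g ` U \<subseteq> T"
  shows "msmooth_on A U (\<lambda>p. f (g p))"
  unfolding msmooth_on_def
proof
  fix c assume c: "c \<in> A"
  show "smooth_on (snd c ` (U \<inter> fst c)) (\<lambda>x. f (g (chart_inv c x)))"
    by (rule smooth_on_compose[OF open_chart_image[OF c assms(1)] assms(3,4)])
      (use assms c chart_inv_chart[OF c] in \<open>auto simp: msmooth_on_def\<close>)
qed

lemma msmooth_on_add:
  "open U \<Longrightarrow> msmooth_on A U f \<Longrightarrow> msmooth_on A U g \<Longrightarrow> msmooth_on A U (\<lambda>p. f p + g p)"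
  by (simp add: msmooth_on_def smooth_on_add open_chart_image)

lemma msmooth_on_bilinear:
  "open U \<Longrightarrow> bounded_bilinear B \<Longrightarrow> msmooth_on A U f \<Longrightarrow> msmooth_on A U g \<Longrightarrow> msmooth_on A U (\<lambda>p. B (f p) (g p))"
  by (auto simp: msmooth_on_def intro!: smooth_on_bilinear[of _ B] open_chart_image)

lemmas msmooth_on_mult = msmooth_on_bilinear[OF _ bounded_bilinear_mult]
lemmas msmooth_on_scaleR = msmooth_on_bilinear[OF _ bounded_bilinear_scaleR]
lemmas msmooth_on_inner = msmooth_on_bilinear[OF _ bounded_bilinear_inner]

lemma msmooth_on_sum:
  "open U \<Longrightarrow> (\<And>i. i \<in> I \<Longrightarrow> msmooth_on A U (f i)) \<Longrightarrow> msmooth_on A U (\<lambda>p. \<Sum>i\<in>I. f i p)"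
  by (induction I rule: infinite_finite_induct) (auto intro: msmooth_on_const msmooth_on_add)

lemma msmooth_on_diff:
  assumes "open U" "msmooth_on A U f" "msmooth_on A U g"
  shows "msmooth_on A U (\<lambda>p. f p - g p)"
  using msmooth_on_add[OF assms(1,2) msmooth_on_scaleR[OF assms(1) msmooth_on_const[of _ _ "-1"] assms(3)]]
  by simp

lemma msmooth_on_divide:
  fixes f g :: "'a \<Rightarrow> real"
  assumes "open U" "msmooth_on A U f" "msmooth_on A U g" "\<And>p. p \<in> U \<Longrightarrow> g p \<noteq> 0"
  shows "msmooth_on A U (\<lambda>p. f p / g p)"
proof -
  have "msmooth_on A U (\<lambda>p. inverse (g p))"
    unfolding msmooth_on_def
  proof
    fix c assume c: "c \<in> A"
    show "smooth_on (snd c ` (U \<inter> fst c)) (\<lambda>x. inverse (g (chart_inv c x)))"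
      by (rule smooth_on_inverse[OF open_chart_image[OF c assms(1)]])
        (use assms c chart_inv_chart[OF c] in \<open>auto simp: msmooth_on_def\<close>)
  qed
  from msmooth_on_mult[OF assms(1,2) this] show ?thesis by (simp add: divide_inverse)
qed

text \<open>This is the smooth-transition clause of the atlas.\<close>

lemma msmooth_on_chart: "c \<in> A \<Longrightarrow> msmooth_on A (fst c) (snd c)"
  using A unfolding smooth_atlas_def msmooth_on_def comp_def by (auto simp: Int_commute)

lemma msmooth_on_differentiable:
  assumes "msmooth_on A U g" "p \<in> U" "c \<in> A" "p \<in> fst c"
  shows "(\<lambda>x. g (chart_inv c x)) differentiable (at (snd c p))"
  using assms unfolding msmooth_on_def by (blast intro: smooth_on_differentiable)

lemma mderiv_has_derivative:
  assumes "msmooth_on A U g" "p \<in> U"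
  shows "((\<lambda>x. g (chart_inv (chart_at A p) x)) has_derivative mderiv A g p) (at (snd (chart_at A p) p))"
  using frechet_derivative_has_derivative[OF msmooth_on_differentiable[OF assms chart_at_mem]]
  unfolding mderiv_def .

lemma mderivI:
  "((\<lambda>x. g (chart_inv (chart_at A p) x)) has_derivative D) (at (snd (chart_at A p) p)) \<Longrightarrow> mderiv A g p v = D v"
  unfolding mderiv_def by (drule frechet_derivative_at) simp

lemma mderiv_linear: "msmooth_on A U g \<Longrightarrow> p \<in> U \<Longrightarrow> linear (mderiv A g p)"
  using mderiv_has_derivative has_derivative_linear by blast

lemma mderiv_cong:
  assumes "open U" "p \<in> U" "\<And>q. q \<in> U \<Longrightarrow> f q = g q"
  shows "mderiv A f p v = mderiv A g p v"
  unfolding mderiv_def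
  by (rule frechet_derivative_cong_open[OF open_chart_image[OF chart_at_mem(1) assms(1)], THEN fun_cong])
    (use assms chart_at_mem chart_inv_chart[OF chart_at_mem(1)] in auto)

lemma mderiv_const: "mderiv A (\<lambda>q. k) p v = 0"
  by (simp add: mderiv_def)

lemma mderiv_add:
  assumes "msmooth_on A U f" "msmooth_on A U g" "p \<in> U"
  shows "mderiv A (\<lambda>q. f q + g q) p v = mderiv A f p v + mderiv A g p v"
  by (rule mderivI) (intro has_derivative_add mderiv_has_derivative[OF _ assms(3)] assms)

lemma mderiv_bilinear:
  assumes "bounded_bilinear B" "msmooth_on A U f" "msmooth_on A U g" "p \<in> U"
  shows "mderiv A (\<lambda>q. B (f q) (g q)) p v = B (f p) (mderiv A g p v) + B (mderiv A f p v) (g p)"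
  using mderivI[OF bounded_bilinear.FDERIV[OF assms(1) mderiv_has_derivative[OF assms(2,4)]
        mderiv_has_derivative[OF assms(3,4)]]]
  by (simp add: chart_inv_chart chart_at_mem)

lemmas mderiv_mult = mderiv_bilinear[OF bounded_bilinear_mult]
lemmas mderiv_inner = mderiv_bilinear[OF bounded_bilinear_inner]

lemma mderiv_sum:
  assumes "finite I" "open U" "\<And>i. i \<in> I \<Longrightarrow> msmooth_on A U (f i)" "p \<in> U"
  shows "mderiv A (\<lambda>q. \<Sum>i\<in>I. f i q) p v = (\<Sum>i\<in>I. mderiv A (f i) p v)"
  using assms(1,3)
proof (induction I)
  case empty then show ?case by (simp add: mderiv_const)
next
  case (insert i I)
  have "msmooth_on A U (\<lambda>q. \<Sum>i\<in>I. f i q)" using insert.prems assms(2) by (intro msmooth_on_sum) auto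
  then show ?case using insert mderiv_add[of U "f i" "\<lambda>q. \<Sum>i\<in>I. f i q" p v] assms(4) by simp
qed

lemma mderiv_inner_const:
  assumes "msmooth_on A U g" "p \<in> U"
  shows "mderiv A (\<lambda>q. g q \<bullet> k) p v = mderiv A g p v \<bullet> k"
  using mderiv_inner[OF assms(1) msmooth_on_const assms(2), of k v] by (simp add: mderiv_const)

lemma mderiv_compose:
  fixes f :: "'u::euclidean_space \<Rightarrow> 'v::real_normed_vector"
  assumes "msmooth_on A U g" "p \<in> U" "f differentiable (at (g p))"
  shows "mderiv A (\<lambda>q. f (g q)) p v = frechet_derivative f (at (g p)) (mderiv A g p v)"
proof (rule mderivI)
  have "(f has_derivative frechet_derivative f (at (g p))) (at (g (chart_inv (chart_at A p) (snd (chart_at A p) p))))"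
    using frechet_derivative_has_derivative[OF assms(3)] by (simp add: chart_inv_chart chart_at_mem)
  from has_derivative_compose[OF mderiv_has_derivative[OF assms(1,2)] this]
  show "((\<lambda>x. f (g (chart_inv (chart_at A p) x))) has_derivative
     (\<lambda>v. frechet_derivative f (at (g p)) (mderiv A g p v))) (at (snd (chart_at A p) p))" .
qed

text \<open>Chain rule for \<open>g\<close> written as its coordinate expression after
  \<open>snd c\<close>: it moves a derivative from the jumping chart \<open>chart_at A p\<close> to
  a fixed chart \<open>c\<close>.\<close>

lemma mderiv_chart:
  assumes "open U" "msmooth_on A U g" "p \<in> U" "c \<in> A" "p \<in> fst c"
  shows "mderiv A g p v = frechet_derivative (\<lambda>x. g (chart_inv c x)) (at (snd c p)) (mderiv A (snd c) p v)"
proof -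
  have "mderiv A g p v = mderiv A (\<lambda>q. g (chart_inv c (snd c q))) p v"
    using open_chart[OF assms(4)] assms(5) chart_inv_chart[OF assms(4)]
    by (intro mderiv_cong[of "fst c"]) auto
  also have "\<dots> = frechet_derivative (\<lambda>x. g (chart_inv c x)) (at (snd c p)) (mderiv A (snd c) p v)"
    by (rule mderiv_compose[OF msmooth_on_chart[OF assms(4)] assms(5)])
      (rule msmooth_on_differentiable[OF assms(2-5)])
  finally show ?thesis .
qed

text \<open>By convention a tangent vector at \<open>p\<close> is its own component vector in
  \<open>chart_at A p\<close>.\<close>

lemma mderiv_chart_at: "mderiv A (snd (chart_at A p)) p v = v"
proof (rule mderivI)
  let ?c = "chart_at A p"
  show "((\<lambda>x. snd ?c (chart_inv ?c x)) has_derivative (\<lambda>v. v)) (at (snd ?c p))"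
    by (rule has_derivative_transform_within_open[OF has_derivative_ident open_chart_image[OF chart_at_mem(1) open_UNIV]])
      (auto simp: chart_at_mem chart_inv_chart)
qed

lemma coord_vec_mderiv:
  assumes "c \<in> A" "p \<in> fst c" shows "coord_vec A c p (mderiv A (snd c) p v) = v"
  using mderiv_chart[OF open_chart msmooth_on_chart _ assms, of "chart_at A p" v]
  by (simp add: coord_vec_def chart_at_mem mderiv_chart_at)

lemma mderiv_coord_vec:
  assumes "c \<in> A" "p \<in> fst c" shows "mderiv A (snd c) p (coord_vec A c p w) = w"
proof -
  have lin: "linear (mderiv A (snd c) p)" using mderiv_linear[OF msmooth_on_chart] assms by blast
  \<comment> \<open>A left inverse gives injectivity; in finite dimension the component map is then
    onto, and the left inverse is also a right inverse.\<close>
  have "inj (mderiv A (snd c) p)" using coord_vec_mderiv[OF assms] by (metis injI)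
  then have "surj (mderiv A (snd c) p)" using linear_injective_imp_surjective[OF lin] by simp
  then obtain v where "w = mderiv A (snd c) p v" by (metis surjD)
  then show ?thesis using coord_vec_mderiv[OF assms] by simp
qed

lemma linear_coord_vec:
  assumes "c \<in> A" "p \<in> fst c" shows "linear (coord_vec A c p)"
  unfolding coord_vec_def
  by (rule linear_frechet_derivative)
    (rule msmooth_on_differentiable[OF msmooth_on_chart[OF chart_at_mem(1)] chart_at_mem(2) assms])

lemma msmooth_on_frechet_derivative:
  assumes "open U" "msmooth_on A U g" "c \<in> A"
  shows "msmooth_on A (U \<inter> fst c) (\<lambda>p. frechet_derivative (\<lambda>x. g (chart_inv c x)) (at (snd c p)) w)"
proof (rule msmooth_on_compose[of "U \<inter> fst c" "snd c" "snd c ` (U \<inter> fst c)"])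
  show "open (U \<inter> fst c)" using assms open_chart by blast
  show "msmooth_on A (U \<inter> fst c) (snd c)" using msmooth_on_chart[OF assms(3)] by (rule msmooth_on_subset) auto
  show "open (snd c ` (U \<inter> fst c))" using open_chart_image assms by blast
  show "smooth_on (snd c ` (U \<inter> fst c)) (\<lambda>x. frechet_derivative (\<lambda>x. g (chart_inv c x)) (at x) w)"
    using assms by (intro smooth_on_frechet_derivative) (auto simp: msmooth_on_def)
qed auto

lemma smooth_map_id: "smooth_map A A id"
  using msmooth_on_chart by (auto simp: smooth_map_eq)

end

lemma section_along_subset:
  "section_along A B F U S \<Longrightarrow> V \<subseteq> U \<Longrightarrow> section_along A B F V S"
  unfolding section_along_eq by (fast intro: msmooth_on_subset)

lemma vector_field_on_subset: "vector_field_on A U X \<Longrightarrow> V \<subseteq> U \<Longrightarrow> vector_field_on A V X"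
  unfolding vector_field_on_def by (rule section_along_subset)

section \<open>Smooth sections along a map\<close>

context
  fixes A :: "('a::{t2_space,second_countable_topology}, 'e::euclidean_space) chart set"
    and B :: "('b::{t2_space,second_countable_topology}, 'f::euclidean_space) chart set"
    and F :: "'a \<Rightarrow> 'b"
  assumes A: "smooth_atlas A" and B: "smooth_atlas B" and F: "smooth_map A B F"
begin

lemma open_vimage_smooth_map: "open V \<Longrightarrow> open (F -` V)"
  using F by (auto simp: smooth_map_def intro: open_vimage)

lemma msmooth_on_chart_smooth_map: "d \<in> B \<Longrightarrow> msmooth_on A (F -` fst d) (\<lambda>q. snd d (F q))"
  using F by (auto simp: smooth_map_eq)

lemma msmooth_on_pullback:
  assumes "open U" "open V" "msmooth_on B V g" "F ` U \<subseteq> V"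
  shows "msmooth_on A U (\<lambda>p. g (F p))"
proof (rule msmooth_on_local[OF A])
  fix p assume p: "p \<in> U"
  let ?d = "chart_at B (F p)"
  let ?W = "U \<inter> F -` fst ?d"
  have d: "?d \<in> B" "F p \<in> fst ?d" using chart_at_mem[OF B] by auto
  have W: "open ?W" using assms open_vimage_smooth_map open_chart[OF B d(1)] by blast
  have "msmooth_on A ?W (\<lambda>q. g (chart_inv ?d (snd ?d (F q))))"
  proof (rule msmooth_on_compose[OF A W _ open_chart_image[OF B d(1) assms(2)]])
    show "msmooth_on A ?W (\<lambda>q. snd ?d (F q))"
      using msmooth_on_chart_smooth_map[OF d(1)] by (rule msmooth_on_subset) auto
    show "smooth_on (snd ?d ` (V \<inter> fst ?d)) (\<lambda>x. g (chart_inv ?d x))"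
      using assms d by (auto simp: msmooth_on_def)
  qed (use assms(4) in auto)
  then have "msmooth_on A ?W (\<lambda>q. g (F q))"
    by (rule msmooth_on_cong[OF A W]) (simp add: chart_inv_chart[OF B d(1)])
  then show "\<exists>W. open W \<and> p \<in> W \<and> msmooth_on A W (\<lambda>p. g (F p))" using W p d by blast
qed

text \<open>\<open>differential\<close> reads \<open>F\<close> in the chart
  \<open>chart_at B (F p)\<close>, the very chart in which \<open>mderiv B\<close> differentiates at
  \<open>F p\<close>, so the two fit together by the chain rule without a change of chart.\<close>

lemma mderiv_pullback:
  assumes "open V" "msmooth_on B V g" "F p \<in> V"
  shows "mderiv A (\<lambda>q. g (F q)) p v = mderiv B g (F p) (differential A B F p v)"
proof -
  let ?d = "chart_at B (F p)"
  have d: "?d \<in> B" "F p \<in> fst ?d" using chart_at_mem[OF B] by auto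
  have "mderiv A (\<lambda>q. g (F q)) p v = mderiv A (\<lambda>q. g (chart_inv ?d (snd ?d (F q)))) p v"
    using d by (intro mderiv_cong[OF A open_vimage_smooth_map[OF open_chart[OF B d(1)]]])
      (auto simp: chart_inv_chart[OF B d(1)])
  also have "\<dots> = frechet_derivative (\<lambda>x. g (chart_inv ?d x)) (at (snd ?d (F p))) (mderiv A (\<lambda>q. snd ?d (F q)) p v)"
    by (rule mderiv_compose[OF A msmooth_on_chart_smooth_map[OF d(1)]])
      (use d msmooth_on_differentiable[OF B assms(2,3) d] in auto)
  also have "\<dots> = mderiv B g (F p) (differential A B F p v)"
    by (simp add: mderiv_def[of B] differential_eq)
  finally show ?thesis .
qed

lemma linear_differential: "linear (differential A B F p)"
  unfolding differential_eq
  by (rule mderiv_linear[OF A msmooth_on_chart_smooth_map]) (auto simp: chart_at_mem[OF B])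

lemma section_along_local:
  assumes "\<And>p. p \<in> U \<Longrightarrow> \<exists>V. open V \<and> p \<in> V \<and> section_along A B F V S"
  shows "section_along A B F U S"
  unfolding section_along_eq
proof (intro ballI msmooth_on_local[OF A])
  fix d p assume d: "d \<in> B" and p: "p \<in> U \<inter> F -` fst d"
  obtain V where V: "open V" "p \<in> V" "section_along A B F V S" using assms p by blast
  have "open (V \<inter> F -` fst d)" using V(1) open_vimage_smooth_map open_chart[OF B d] by blast
  then show "\<exists>W. open W \<and> p \<in> W \<and> msmooth_on A W (\<lambda>q. mderiv B (snd d) (F q) (S q))"
    using V p d by (intro exI[of _ "V \<inter> F -` fst d"]) (auto simp: section_along_eq)
qed

text \<open>One target chart suffices: in another chart the components are multiplied by the
  Jacobian of the transition map, whose columns are smooth on the target and are pulled back along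
  \<open>F\<close>.\<close>

lemma section_along_coords:
  assumes d: "d \<in> B" and U: "open U" "F ` U \<subseteq> fst d"
    and s: "msmooth_on A U (\<lambda>q. mderiv B (snd d) (F q) (S q))"
  shows "section_along A B F U S"
  unfolding section_along_eq
proof
  fix d' assume d': "d' \<in> B"
  let ?W = "U \<inter> F -` fst d'"
  let ?D = "\<lambda>q. frechet_derivative (\<lambda>x. snd d' (chart_inv d x)) (at (snd d (F q)))"
  let ?s = "\<lambda>q. mderiv B (snd d) (F q) (S q)"
  have W: "open ?W" using U open_vimage_smooth_map open_chart[OF B d'] by blast
  have "msmooth_on A ?W (\<lambda>q. \<Sum>b\<in>Basis. (?s q \<bullet> b) *\<^sub>R ?D q b)"
  proof (intro msmooth_on_sum[OF A] msmooth_on_scaleR[OF A] msmooth_on_inner[OF A] W msmooth_on_const)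
    show "msmooth_on A ?W ?s" using s by (rule msmooth_on_subset) auto
    have "msmooth_on B (fst d' \<inter> fst d)
        (\<lambda>p. frechet_derivative (\<lambda>x. snd d' (chart_inv d x)) (at (snd d p)) b)" for b
      by (rule msmooth_on_frechet_derivative[OF B open_chart[OF B d'] msmooth_on_chart[OF B d'] d])
    then show "msmooth_on A ?W (\<lambda>q. ?D q b)" for b
      using U open_chart[OF B d] open_chart[OF B d']
      by (intro msmooth_on_pullback[OF W, of "fst d' \<inter> fst d"]) auto
  qed
  then show "msmooth_on A ?W (\<lambda>q. mderiv B (snd d') (F q) (S q))"
  proof (rule msmooth_on_cong[OF A W])
    fix q assume q: "q \<in> ?W"
    then have q': "F q \<in> fst d'" "F q \<in> fst d" using U by auto
    have "mderiv B (snd d') (F q) (S q) = ?D q (?s q)"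
      by (rule mderiv_chart[OF B open_chart[OF B d'] msmooth_on_chart[OF B d'] q'(1) d q'(2)])
    moreover have "linear (?D q)"
      by (intro linear_frechet_derivative msmooth_on_differentiable[OF B msmooth_on_chart[OF B d']] q' d)
    ultimately show "(\<Sum>b\<in>Basis. (?s q \<bullet> b) *\<^sub>R ?D q b) = mderiv B (snd d') (F q) (S q)"
      using linear_Basis_expansion[of "?D q" "?s q"] by simp
  qed
qed

lemma section_along_add:
  assumes "open U" "section_along A B F U S" "section_along A B F U S'"
  shows "section_along A B F U (\<lambda>q. S q + S' q)"
  unfolding section_along_eq
proof
  fix d assume d: "d \<in> B"
  let ?W = "U \<inter> F -` fst d"
  have W: "open ?W" using assms(1) open_vimage_smooth_map open_chart[OF B d] by blast
  have "msmooth_on A ?W (\<lambda>q. mderiv B (snd d) (F q) (S q) + mderiv B (snd d) (F q) (S' q))"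
    using assms d by (intro msmooth_on_add[OF A W]) (auto simp: section_along_eq)
  then show "msmooth_on A ?W (\<lambda>q. mderiv B (snd d) (F q) (S q + S' q))"
    by (rule msmooth_on_cong[OF A W])
      (use linear_add[OF mderiv_linear[OF B msmooth_on_chart[OF B d]]] in auto)
qed

lemma section_along_scaleR:
  assumes "open U" "msmooth_on A U f" "section_along A B F U S"
  shows "section_along A B F U (\<lambda>q. f q *\<^sub>R S q)"
  unfolding section_along_eq
proof
  fix d assume d: "d \<in> B"
  let ?W = "U \<inter> F -` fst d"
  have W: "open ?W" using assms(1) open_vimage_smooth_map open_chart[OF B d] by blast
  have "msmooth_on A ?W (\<lambda>q. f q *\<^sub>R mderiv B (snd d) (F q) (S q))"
    using assms d by (intro msmooth_on_scaleR[OF A W]) (auto simp: section_along_eq intro: msmooth_on_subset)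
  then show "msmooth_on A ?W (\<lambda>q. mderiv B (snd d) (F q) (f q *\<^sub>R S q))"
    by (rule msmooth_on_cong[OF A W])
      (use linear_scale[OF mderiv_linear[OF B msmooth_on_chart[OF B d]]] in auto)
qed

lemma section_along_zero: "section_along A B F U (\<lambda>q. 0)"
  unfolding section_along_eq
proof
  fix d assume d: "d \<in> B"
  have "msmooth_on A (F -` fst d) (\<lambda>q. mderiv B (snd d) (F q) 0)"
    using linear_0[OF mderiv_linear[OF B msmooth_on_chart[OF B d]]]
    by (intro msmooth_on_cong[OF A open_vimage_smooth_map[OF open_chart[OF B d]] msmooth_on_const[of _ _ 0]]) auto
  then show "msmooth_on A (U \<inter> F -` fst d) (\<lambda>q. mderiv B (snd d) (F q) 0)"
    by (rule msmooth_on_subset) auto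
qed

lemma section_along_sum:
  "open U \<Longrightarrow> (\<And>i. i \<in> I \<Longrightarrow> section_along A B F U (S i)) \<Longrightarrow> section_along A B F U (\<lambda>q. \<Sum>i\<in>I. S i q)"
  by (induction I rule: infinite_finite_induct) (auto intro: section_along_zero section_along_add)

lemma section_along_field:
  assumes "open U" "open V" "vector_field_on B V Z" "F ` U \<subseteq> V"
  shows "section_along A B F U (Z \<circ> F)"
  unfolding section_along_eq
proof
  fix d assume d: "d \<in> B"
  have W: "open (U \<inter> F -` fst d)" using assms(1) open_vimage_smooth_map open_chart[OF B d] by blast
  have "msmooth_on B (V \<inter> fst d) (\<lambda>q. mderiv B (snd d) q (Z q))"
    using assms(3) d by (simp add: vector_field_on_def section_along_eq)
  then show "msmooth_on A (U \<inter> F -` fst d) (\<lambda>q. mderiv B (snd d) (F q) ((Z \<circ> F) q))"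
    unfolding comp_def
    by (rule msmooth_on_pullback[OF W open_Int[OF assms(2) open_chart[OF B d]]]) (use assms in auto)
qed

end

section \<open>Coordinate fields and the Lie bracket\<close>

context
  fixes A :: "('a::{t2_space,second_countable_topology}, 'e::euclidean_space) chart set"
  assumes A: "smooth_atlas A"
begin

lemma vector_field_on_coord_vec:
  assumes c: "c \<in> A" shows "vector_field_on A (fst c) (\<lambda>p. coord_vec A c p w)"
  unfolding vector_field_on_def
proof (rule section_along_coords[OF A A smooth_map_id[OF A] c open_chart[OF A c]])
  show "msmooth_on A (fst c) (\<lambda>q. mderiv A (snd c) (id q) (coord_vec A c q w))"
    by (rule msmooth_on_cong[OF A open_chart[OF A c] msmooth_on_const[of _ _ w]])
      (simp add: mderiv_coord_vec[OF A c])
qed auto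

lemma coord_expansion:
  assumes "c \<in> A" "p \<in> fst c"
  shows "v = (\<Sum>b\<in>Basis. (mderiv A (snd c) p v \<bullet> b) *\<^sub>R coord_vec A c p b)"
  using linear_Basis_expansion[OF linear_coord_vec[OF A assms], of "mderiv A (snd c) p v"]
  by (simp add: coord_vec_mderiv[OF A assms])

lemma vector_field_on_coords:
  assumes "vector_field_on A U X" "c \<in> A"
  shows "msmooth_on A (U \<inter> fst c) (\<lambda>q. mderiv A (snd c) q (X q))"
  using assms by (simp add: vector_field_on_def section_along_eq)

text \<open>\<open>mderiv\<close> refers to a chart that jumps from point to point; in a fixed chart
  the derivative along \<open>X\<close> is a sum of components of \<open>X\<close> times partial
  derivatives of \<open>g\<close>, all of them smooth.\<close>

lemma msmooth_on_mderiv: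
  assumes U: "open U" and g: "msmooth_on A U g" and X: "vector_field_on A U X"
  shows "msmooth_on A U (\<lambda>p. mderiv A g p (X p))"
proof (rule msmooth_on_local[OF A])
  fix p assume p: "p \<in> U"
  let ?c = "chart_at A p"
  let ?W = "U \<inter> fst ?c"
  let ?D = "\<lambda>q. frechet_derivative (\<lambda>x. g (chart_inv ?c x)) (at (snd ?c q))"
  have c: "?c \<in> A" "p \<in> fst ?c" using chart_at_mem[OF A] by auto
  have W: "open ?W" using U open_chart[OF A c(1)] by blast
  have "msmooth_on A ?W (\<lambda>q. \<Sum>b\<in>Basis. (mderiv A (snd ?c) q (X q) \<bullet> b) *\<^sub>R ?D q b)"
    by (intro msmooth_on_sum[OF A] msmooth_on_scaleR[OF A] msmooth_on_inner[OF A] W msmooth_on_const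
        msmooth_on_frechet_derivative[OF A U g c(1)] vector_field_on_coords X c)
  then have "msmooth_on A ?W (\<lambda>q. mderiv A g q (X q))"
  proof (rule msmooth_on_cong[OF A W])
    fix q assume q: "q \<in> ?W"
    then have "linear (?D q)"
      by (intro linear_frechet_derivative msmooth_on_differentiable[OF A g]) (use c in auto)
    then show "(\<Sum>b\<in>Basis. (mderiv A (snd ?c) q (X q) \<bullet> b) *\<^sub>R ?D q b) = mderiv A g q (X q)"
      using mderiv_chart[OF A U g _ c(1)] q linear_Basis_expansion[of "?D q" "mderiv A (snd ?c) q (X q)"] by simp
  qed
  then show "\<exists>V. open V \<and> p \<in> V \<and> msmooth_on A V (\<lambda>p. mderiv A g p (X p))" using W p c by blast
qed

text \<open>The bracket is defined by components in one chart; this recovers it as the commutator of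
  derivations. The second derivatives of \<open>g\<close> cancel by symmetry. Vector values of
  \<open>g\<close> allow coordinate maps to be inserted.\<close>

lemma mderiv_lie_bracket:
  fixes g :: "'a \<Rightarrow> 'v::euclidean_space"
  assumes U: "open U" "p \<in> U" and g: "msmooth_on A U g"
    and X: "vector_field_on A U X" and Y: "vector_field_on A U Y"
  shows "mderiv A g p (lie_bracket A X Y p)
    = mderiv A (\<lambda>q. mderiv A g q (Y q)) p (X p) - mderiv A (\<lambda>q. mderiv A g q (X q)) p (Y p)"
proof -
  define c where "c = chart_at A p"
  define x where "x = snd c p"
  define S where "S = snd c ` (U \<inter> fst c)"
  define G where "G = (\<lambda>u. g (chart_inv c u))"
  define loc where "loc = (\<lambda>Z u. mderiv A (snd c) (chart_inv c u) (Z (chart_inv c u)))"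
  have c: "c \<in> A" "p \<in> fst c" using chart_at_mem[OF A] by (auto simp: c_def)
  have S: "open S" "x \<in> S" using open_chart_image[OF A c(1)] U c by (auto simp: S_def x_def)
  have G: "smooth_on S G" using g c by (simp add: msmooth_on_def S_def G_def)
  have DG: "G differentiable (at y)" if "y \<in> S" for y using smooth_on_differentiable[OF G that] .
  have loc: "smooth_on S (loc Z)" if Z: "vector_field_on A U Z" for Z
  proof -
    have "smooth_on (snd c ` (U \<inter> fst c \<inter> fst c)) (loc Z)"
      using vector_field_on_coords[OF Z c(1)] c(1) unfolding msmooth_on_def loc_def by blast
    then show ?thesis by (simp add: S_def Int_assoc)
  qed
  have locp: "loc Z x = Z p" for Z
    using c mderiv_chart_at[OF A] by (simp add: loc_def x_def chart_inv_chart[OF A] c_def)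
  have deriv: "mderiv A (\<lambda>q. mderiv A g q (Z q)) p v
      = frechet_derivative G (at x) (frechet_derivative (loc Z) (at x) v)
        + frechet_derivative (\<lambda>u. frechet_derivative G (at u) (Z p)) (at x) v"
    if Z: "vector_field_on A U Z" for Z v
  proof -
    have "mderiv A (\<lambda>q. mderiv A g q (Z q)) p v
      = frechet_derivative (\<lambda>u. mderiv A g (chart_inv c u) (Z (chart_inv c u))) (at x) v"
      by (simp add: mderiv_def[of A "\<lambda>q. mderiv A g q (Z q)"] c_def x_def)
    also have "\<dots> = frechet_derivative (\<lambda>u. \<Sum>b\<in>Basis. (loc Z u \<bullet> b) *\<^sub>R frechet_derivative G (at u) b) (at x) v"
    proof (rule frechet_derivative_cong_open[OF S, THEN fun_cong])
      fix u assume "u \<in> S"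
      then obtain q where q: "q \<in> U" "q \<in> fst c" "u = snd c q" by (auto simp: S_def)
      have "mderiv A g (chart_inv c u) (Z (chart_inv c u)) = frechet_derivative G (at u) (loc Z u)"
        using mderiv_chart[OF A U(1) g q(1) c(1) q(2), of "Z q"] q
        by (simp add: chart_inv_chart[OF A c(1)] G_def loc_def)
      then show "mderiv A g (chart_inv c u) (Z (chart_inv c u)) = (\<Sum>b\<in>Basis. (loc Z u \<bullet> b) *\<^sub>R frechet_derivative G (at u) b)"
        using linear_Basis_expansion[OF linear_frechet_derivative[OF DG[OF \<open>u \<in> S\<close>]], of "loc Z u"] by simp
    qed
    also have "\<dots> = (\<Sum>b\<in>Basis. (loc Z x \<bullet> b) *\<^sub>R frechet_derivative (\<lambda>u. frechet_derivative G (at u) b) (at x) v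
        + (frechet_derivative (loc Z) (at x) v \<bullet> b) *\<^sub>R frechet_derivative G (at x) b)"
    proof (rule frechet_derivative_at[symmetric, THEN fun_cong])
      show "((\<lambda>u. \<Sum>b\<in>Basis. (loc Z u \<bullet> b) *\<^sub>R frechet_derivative G (at u) b) has_derivative
        (\<lambda>v. \<Sum>b\<in>Basis. (loc Z x \<bullet> b) *\<^sub>R frechet_derivative (\<lambda>u. frechet_derivative G (at u) b) (at x) v
        + (frechet_derivative (loc Z) (at x) v \<bullet> b) *\<^sub>R frechet_derivative G (at x) b)) (at x)"
        by (intro has_derivative_sum has_derivative_scaleR has_derivative_inner_left
            frechet_derivative_has_derivative smooth_on_differentiable[OF loc[OF Z] S(2)]
            smooth_on_differentiable[OF smooth_on_frechet_derivative[OF G] S(2)])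
    qed
    \<comment> \<open>Symmetry exchanges \<open>b\<close> and \<open>v\<close>: now \<open>b\<close>
      is the argument of a linear map, and the sum over \<open>Basis\<close> collapses.\<close>
    also have "\<dots> = (\<Sum>b\<in>Basis. (loc Z x \<bullet> b) *\<^sub>R frechet_derivative (\<lambda>u. frechet_derivative G (at u) v) (at x) b)
        + (\<Sum>b\<in>Basis. (frechet_derivative (loc Z) (at x) v \<bullet> b) *\<^sub>R frechet_derivative G (at x) b)"
      by (simp add: sum.distrib second_derivative_symmetric[OF G S, of _ v])
    also have "\<dots> = frechet_derivative (\<lambda>u. frechet_derivative G (at u) v) (at x) (loc Z x)
        + frechet_derivative G (at x) (frechet_derivative (loc Z) (at x) v)"
      using linear_Basis_expansion[OF linear_frechet_derivative[OF DG[OF S(2)]],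
          of "frechet_derivative (loc Z) (at x) v"]
        linear_Basis_expansion[OF linear_frechet_derivative[OF
          smooth_on_differentiable[OF smooth_on_frechet_derivative[OF G] S(2)]], of v "loc Z x"]
      by simp
    finally show ?thesis by (simp add: locp second_derivative_symmetric[OF G S, of v])
  qed
  have "lie_bracket A X Y p = frechet_derivative (loc Y) (at x) (X p) - frechet_derivative (loc X) (at x) (Y p)"
    by (simp add: lie_bracket_def Let_def tangent_coords_eq loc_def c_def x_def)
  moreover have "mderiv A g p = frechet_derivative G (at x)"
    by (auto simp: mderiv_def G_def c_def x_def)
  ultimately show ?thesis
    using deriv[OF X, of "Y p"] deriv[OF Y, of "X p"] second_derivative_symmetric[OF G S, of "X p" "Y p"]
    by (simp add: linear_diff[OF linear_frechet_derivative[OF DG[OF S(2)]]])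
qed

end

context
  fixes A :: "('a::{t2_space,second_countable_topology}, 'e::euclidean_space) chart set"
    and B :: "('b::{t2_space,second_countable_topology}, 'f::euclidean_space) chart set"
    and F :: "'a \<Rightarrow> 'b"
  assumes A: "smooth_atlas A" and B: "smooth_atlas B" and F: "smooth_map A B F"
begin

text \<open>In a target chart \<open>d\<close> the components of the image of \<open>X\<close> are
  the derivatives along \<open>X\<close> of the coordinates of \<open>F\<close>.\<close>

lemma section_along_differential:
  assumes U: "open U" and X: "vector_field_on A U X"
  shows "section_along A B F U (\<lambda>q. differential A B F q (X q))"
  unfolding section_along_eq
proof
  fix d assume d: "d \<in> B"
  let ?W = "U \<inter> F -` fst d"
  have W: "open ?W" using U open_vimage_smooth_map[OF A B F] open_chart[OF B d] by blast
  have "msmooth_on A ?W (\<lambda>q. mderiv A (\<lambda>r. snd d (F r)) q (X q))"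
    by (rule msmooth_on_mderiv[OF A W msmooth_on_subset[OF msmooth_on_chart_smooth_map[OF A B F d]]
          vector_field_on_subset[OF X]]) auto
  then show "msmooth_on A ?W (\<lambda>q. mderiv B (snd d) (F q) (differential A B F q (X q)))"
    by (rule msmooth_on_cong[OF A W])
      (simp add: mderiv_pullback[OF A B F open_chart[OF B d] msmooth_on_chart[OF B d]])
qed

end

section \<open>Metrics along maps and the horizontal projection\<close>

lemma bilinear_sum_sum:
  assumes "bilinear h"
  shows "h (\<Sum>i\<in>I. x i) (\<Sum>j\<in>J. y j) = (\<Sum>i\<in>I. \<Sum>j\<in>J. h (x i) (y j))"
proof -
  have "linear (\<lambda>x. h x w)" "linear (h v)" for v w using assms by (auto simp: bilinear_def)
  then show ?thesis by (simp add: linear_sum[of "\<lambda>x. h x _"] linear_sum[of "h _"] sum.swap[of _ J])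
qed

lemma riemannian_metricD:
  assumes "riemannian_metric A g"
  shows "bilinear (g p)" "g p v w = g p w v" "v \<noteq> 0 \<Longrightarrow> g p v v > 0"
    "open U \<Longrightarrow> vector_field_on A U X \<Longrightarrow> vector_field_on A U Y \<Longrightarrow> msmooth_on A U (\<lambda>p. g p (X p) (Y p))"
  using assms by (auto simp: riemannian_metric_def smooth_fun_on_eq)

text \<open>Riesz representation for an arbitrary inner product. A functional is stored as the
  vector of its values on \<open>Basis\<close>, so that \<open>T\<close> becomes an endomorphism; it
  is injective by definiteness, hence onto by dimension.\<close>

lemma posdef_representation:
  fixes g :: "'e::euclidean_space \<Rightarrow> 'e \<Rightarrow> real"
  assumes g: "bilinear g" "\<And>v. v \<noteq> 0 \<Longrightarrow> g v v > 0" and \<omega>: "linear \<omega>"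
  shows "\<exists>x. \<forall>w. g x w = \<omega> w"
proof -
  define T where "T = (\<lambda>x. \<Sum>b\<in>Basis. g x b *\<^sub>R b)"
  have lin1: "linear (\<lambda>x. g x w)" and lin2: "linear (g x)" for w x using g(1) by (auto simp: bilinear_def)
  have "linear T"
    using g(1) by (intro linearI) (auto simp: T_def bilinear_ladd bilinear_lmul scaleR_left_distrib
        sum.distrib scaleR_sum_right)
  moreover have "inj T"
    unfolding linear_injective_0[OF \<open>linear T\<close>]
  proof (intro allI impI)
    fix x assume "T x = 0"
    then have "g x b = 0" if "b \<in> Basis" for b
      using that inner_sum_left_Basis[of b "g x"] by (simp add: T_def)
    then have "g x x = 0" using linear_Basis_expansion[OF lin2, of x x] by simp
    then show "x = 0" using g(2) by force
  qed
  ultimately have "surj T" using linear_injective_imp_surjective by blast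
  then obtain x where "T x = (\<Sum>b\<in>Basis. \<omega> b *\<^sub>R b)" by (metis surjD)
  then have "g x b = \<omega> b" if "b \<in> Basis" for b
    using that inner_sum_left_Basis[of b "g x"] inner_sum_left_Basis[of b \<omega>] by (simp add: T_def)
  then have "g x w = \<omega> w" for w
    using linear_Basis_expansion[OF lin2, of x w] linear_Basis_expansion[OF \<omega>, of w] by simp
  then show ?thesis by blast
qed

text \<open>The adjoint \<open>a\<close> of \<open>L\<close> maps into the horizontal space, and \<open>S = L \<circ> a\<close> satisfies
  \<open>h (S n) (S n') = h n (S n')\<close>; being injective, \<open>S\<close> is onto, hence the identity. So \<open>a \<circ> L\<close> is
  the horizontal projection.\<close>

lemma horizontal_component:
  fixes g :: "'e::euclidean_space \<Rightarrow> 'e \<Rightarrow> real" and h :: "'f::euclidean_space \<Rightarrow> 'f \<Rightarrow> real"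
  assumes g: "bilinear g" "\<And>v w. g v w = g w v" "\<And>v. v \<noteq> 0 \<Longrightarrow> g v v > 0"
    and h: "bilinear h" "\<And>v w. h v w = h w v" "\<And>v. v \<noteq> 0 \<Longrightarrow> h v v > 0"
    and L: "linear L" "surj L"
    and iso: "\<And>v. (\<And>w. L w = 0 \<Longrightarrow> g v w = 0) \<Longrightarrow> h (L v) (L v) = g v v"
  shows "\<exists>x. L x = L v \<and> (\<forall>w. g x w = h (L v) (L w))"
proof -
  have "\<exists>x. \<forall>w. g x w = h n (L w)" for n
    using h(1) L(1) by (intro posdef_representation g) (auto simp: bilinear_def linear_compose[unfolded o_def])
  then obtain a where a: "\<And>n w. g (a n) w = h n (L w)" by metis
  have g0: "x = y" if "\<And>w. g x w = g y w" for x y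
    using that[of "x - y"] g(3)[of "x - y"] by (cases "x = y") (auto simp: bilinear_lsub[OF g(1)])
  have h0: "x = y" if "\<And>w. h x w = h y w" for x y
    using that[of "x - y"] h(3)[of "x - y"] by (cases "x = y") (auto simp: bilinear_lsub[OF h(1)])
  have alin: "linear a"
    by (rule linearI; rule g0) (use g(1) h(1) in \<open>auto simp: a bilinear_ladd bilinear_lmul\<close>)
  define S where "S = L \<circ> a"
  have Slin: "linear S" unfolding S_def by (rule linear_compose[OF alin L(1)])
  have iso': "h (S n) (S n) = g (a n) (a n)" for n
    unfolding S_def comp_def by (rule iso) (simp add: a bilinear_rzero[OF h(1)])
  \<comment> \<open>Polarising \<open>iso'\<close> gives only the symmetrised identity, which
    suffices because \<open>h\<close> and \<open>g\<close> are symmetric; then \<open>a\<close>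
    moves across by its defining equation.\<close>
  have S: "h (S n) (S n') = h n (S n')" for n n'
  proof -
    have "h (S n) (S n') + h (S n') (S n) = g (a n) (a n') + g (a n') (a n)"
      using iso'[of "n + n'"] iso'[of n] iso'[of n']
      by (simp add: linear_add[OF alin] linear_add[OF Slin] bilinear_ladd[OF g(1)] bilinear_radd[OF g(1)]
          bilinear_ladd[OF h(1)] bilinear_radd[OF h(1)])
    moreover have "g (a n) (a n') = h n (S n')" by (simp add: a S_def)
    ultimately show ?thesis using h(2)[of "S n" "S n'"] g(2)[of "a n" "a n'"] by linarith
  qed
  have "inj S"
    unfolding linear_injective_0[OF Slin]
  proof (intro allI impI)
    fix n assume "S n = 0"
    then have "g (a n) (a n) = 0" using iso'[of n] by (simp add: bilinear_lzero[OF h(1)])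
    then have "a n = 0" using g(3) by force
    then have "h n (L w) = 0" for w using a[of n w] by (simp add: bilinear_lzero[OF g(1)])
    then have "h n n = 0" by (metis L(2) surjD)
    then show "n = 0" using h(3) by force
  qed
  then have "surj S" using linear_injective_imp_surjective Slin by blast
  have "S n = n" for n
  proof (rule h0)
    fix w obtain n' where "w = S n'" using \<open>surj S\<close> by (metis surjD)
    then show "h (S n) w = h n w" using S by simp
  qed
  then show ?thesis using a by (intro exI[of _ "a (L v)"]) (simp add: S_def)
qed

text \<open>Gaussian elimination: subtracting from the other fields their components along one of them
  reduces the claim to fewer fields.\<close>

lemma coefficients_smooth:
  fixes A :: "('a::{t2_space,second_countable_topology}, 'e::euclidean_space) chart set"
    and E :: "'i \<Rightarrow> 'a \<Rightarrow> 'v::real_vector"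
  assumes A: "smooth_atlas A" and U: "open U"
    and g: "\<And>p. bilinear (g p)" "\<And>p v w. g p v w = g p w v" "\<And>p v. v \<noteq> 0 \<Longrightarrow> g p v v > (0::real)"
  shows "finite I \<Longrightarrow>
    (\<And>p x. p \<in> U \<Longrightarrow> (\<Sum>b\<in>I. x b *\<^sub>R E b p) = 0 \<Longrightarrow> \<forall>b\<in>I. x b = 0) \<Longrightarrow>
    (\<And>b c. b \<in> I \<Longrightarrow> c \<in> I \<Longrightarrow> msmooth_on A U (\<lambda>p. g p (E b p) (E c p))) \<Longrightarrow>
    (\<And>c. c \<in> I \<Longrightarrow> msmooth_on A U (\<lambda>p. g p (\<Sum>b\<in>I. a b p *\<^sub>R E b p) (E c p))) \<Longrightarrow>
    b \<in> I \<Longrightarrow> msmooth_on A U (a b)"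
proof (induction I arbitrary: E a b rule: finite_induct)
  case empty then show ?case by simp
next
  case (insert s I)
  note gs = bilinear_ladd[OF g(1)] bilinear_radd[OF g(1)] bilinear_lsub[OF g(1)] bilinear_rsub[OF g(1)]
    bilinear_lmul[OF g(1)] bilinear_rmul[OF g(1)]
  define G where "G = (\<lambda>p. g p (E s p) (E s p))"
  define k where "k = (\<lambda>b p. g p (E b p) (E s p) / G p)"
  \<comment> \<open>\<open>E' b\<close> is \<open>E b\<close> made orthogonal to \<open>E s\<close>.
    For \<open>b \<in> I\<close> the coefficient \<open>a b\<close> of the combination
    \<open>X\<close> stays the same and only that of \<open>E s\<close> changes, to
    \<open>a'\<close>; so the induction hypothesis applies to \<open>E'\<close> with the same
    \<open>a\<close>.\<close>
  define E' where "E' = (\<lambda>b p. E b p - k b p *\<^sub>R E s p)"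
  define X where "X = (\<lambda>p. \<Sum>b\<in>insert s I. a b p *\<^sub>R E b p)"
  define a' where "a' = (\<lambda>p. a s p + (\<Sum>b\<in>I. a b p * k b p))"
  have Es: "E s p \<noteq> 0" if "p \<in> U" for p
  proof
    assume "E s p = 0"
    then have "(\<Sum>b\<in>insert s I. (if b = s then 1 else 0) *\<^sub>R E b p) = 0" by (intro sum.neutral) auto
    from insert.prems(1)[OF that this] show False by simp
  qed
  then have G0: "G p \<noteq> 0" if "p \<in> U" for p using g(3)[of "E s p" p] that by (auto simp: G_def)
  have ks: "msmooth_on A U (k b)" if "b \<in> I" for b
    unfolding k_def G_def using insert.prems(2) that G0 by (intro msmooth_on_divide[OF A U]) (auto simp: G_def)
  have E's: "g p (E' b p) (E s p) = 0" if "p \<in> U" for b p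
    using G0[OF that] by (simp add: E'_def gs k_def G_def)
  have X: "X p = (\<Sum>b\<in>I. a b p *\<^sub>R E' b p) + a' p *\<^sub>R E s p" for p
    using insert.hyps by (simp add: X_def E'_def a'_def scaleR_left_distrib scaleR_right_diff_distrib
        sum_subtractf scaleR_sum_left)
  have EE: "g p (E' b p) (E' c p) = g p (E b p) (E c p) - k c p * g p (E b p) (E s p)" if "p \<in> U" for b c p
  proof -
    have "g p (E' b p) (E' c p) = g p (E' b p) (E c p)" 
      using E's[OF that] by (subst (2) E'_def) (simp add: gs)
    also have "\<dots> = g p (E b p) (E c p) - k b p * g p (E c p) (E s p)"
      using g(2)[of p "E s p" "E c p"] by (simp add: E'_def gs)
    finally show ?thesis by (simp add: k_def)
  qed
  have XE: "g p (\<Sum>b\<in>I. a b p *\<^sub>R E' b p) (E' c p) = g p (X p) (E c p) - k c p * g p (X p) (E s p)"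
    if "p \<in> U" for c p
  proof -
    have "g p (\<Sum>b\<in>I. a b p *\<^sub>R E' b p) (E' c p) = g p (X p) (E' c p)"
      using E's[OF that, of c] g(2)[of p "E s p" "E' c p"] by (simp add: X gs)
    then show ?thesis by (simp add: E'_def gs)
  qed
  have smX: "msmooth_on A U (\<lambda>p. g p (X p) (E c p))" if "c \<in> insert s I" for c
    using insert.prems(3)[OF that] by (simp add: X_def)
  have IH: "msmooth_on A U (a b)" if "b \<in> I" for b
  proof (rule insert.IH[of E' a])
    show "\<forall>b\<in>I. x b = 0" if p: "p \<in> U" and 0: "(\<Sum>b\<in>I. x b *\<^sub>R E' b p) = 0" for p x
    proof -
      \<comment> \<open>The coefficient at \<open>s\<close> collects the subtracted multiples of
        \<open>E s\<close>, so that a relation among the \<open>E'\<close> becomes one among the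
        original fields.\<close>
      define y where "y = (\<lambda>b. if b = s then - (\<Sum>b\<in>I. x b * k b p) else x b)"
      have "(\<Sum>b\<in>I. y b *\<^sub>R E b p) = (\<Sum>b\<in>I. x b *\<^sub>R E b p)"
        using insert.hyps by (intro sum.cong) (auto simp: y_def)
      then have "(\<Sum>b\<in>insert s I. y b *\<^sub>R E b p) = (\<Sum>b\<in>I. x b *\<^sub>R E' b p)"
        using insert.hyps by (simp add: y_def E'_def scaleR_right_diff_distrib sum_subtractf scaleR_sum_left)
      with 0 insert.prems(1)[OF p, of y] have "\<forall>b\<in>I. y b = 0" by simp
      then show ?thesis using insert.hyps by (auto simp: y_def split: if_splits)
    qed
    show "msmooth_on A U (\<lambda>p. g p (E' b p) (E' c p))" if "b \<in> I" "c \<in> I" for b c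
    proof (rule msmooth_on_cong[OF A U])
      show "msmooth_on A U (\<lambda>p. g p (E b p) (E c p) - k c p * g p (E b p) (E s p))"
        using that ks insert.prems(2) by (intro msmooth_on_diff[OF A U] msmooth_on_mult[OF A U]) auto
    qed (simp add: EE)
    show "msmooth_on A U (\<lambda>p. g p (\<Sum>b\<in>I. a b p *\<^sub>R E' b p) (E' c p))" if "c \<in> I" for c
    proof (rule msmooth_on_cong[OF A U])
      show "msmooth_on A U (\<lambda>p. g p (X p) (E c p) - k c p * g p (X p) (E s p))"
        using that ks smX by (intro msmooth_on_diff[OF A U] msmooth_on_mult[OF A U]) auto
    qed (simp add: XE)
  qed (fact that)
  have "msmooth_on A U (a s)"
  proof (rule msmooth_on_cong[OF A U])
    \<comment> \<open>Pairing \<open>X\<close> with \<open>E s\<close> removes every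
      \<open>E'\<close>, so the quotient is \<open>a' p\<close>; subtracting its correction term
      gives \<open>a s p\<close>.\<close>
    show "msmooth_on A U (\<lambda>p. g p (X p) (E s p) / G p - (\<Sum>b\<in>I. a b p * k b p))"
      using IH ks smX insert.prems(2) G0 unfolding G_def
      by (intro msmooth_on_diff[OF A U] msmooth_on_divide[OF A U] msmooth_on_sum[OF A U] msmooth_on_mult[OF A U]) auto
    fix p assume p: "p \<in> U"
    have "g p (\<Sum>b\<in>I. a b p *\<^sub>R E' b p) (E s p) = (\<Sum>b\<in>I. g p (a b p *\<^sub>R E' b p) (E s p))"
      using g(1)[of p] linear_sum[of "\<lambda>x. g p x (E s p)"] by (simp add: bilinear_def)
    also have "\<dots> = 0" by (simp add: gs E's[OF p])
    finally have "g p (X p) (E s p) = a' p * G p" by (simp add: X gs G_def)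
    then show "g p (X p) (E s p) / G p - (\<Sum>b\<in>I. a b p * k b p) = a s p"
      using G0[OF p] by (simp add: a'_def)
  qed
  then show ?case using IH insert.prems(4) by auto
qed

section \<open>Metrics in coordinate frames and along maps\<close>

context
  fixes B :: "('b::{t2_space,second_countable_topology}, 'f::euclidean_space) chart set"
    and h :: "'b \<Rightarrow> 'f \<Rightarrow> 'f \<Rightarrow> real"
  assumes B: "smooth_atlas B" and h: "riemannian_metric B h"
begin

lemma metric_coord_vec_smooth:
  "d \<in> B \<Longrightarrow> msmooth_on B (fst d) (\<lambda>y. h y (coord_vec B d y b) (coord_vec B d y c))"
  by (intro riemannian_metricD(4)[OF h] open_chart[OF B] vector_field_on_coord_vec[OF B])

lemma metric_expansion:
  assumes "d \<in> B" "y \<in> fst d"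
  shows "h y v w = (\<Sum>b\<in>Basis. \<Sum>c\<in>Basis. (mderiv B (snd d) y v \<bullet> b) * (mderiv B (snd d) y w \<bullet> c)
    * h y (coord_vec B d y b) (coord_vec B d y c))"
proof -
  note bil = riemannian_metricD(1)[OF h, of y]
  have "h y v w = h y (\<Sum>b\<in>Basis. (mderiv B (snd d) y v \<bullet> b) *\<^sub>R coord_vec B d y b)
      (\<Sum>c\<in>Basis. (mderiv B (snd d) y w \<bullet> c) *\<^sub>R coord_vec B d y c)"
    using coord_expansion[OF B assms] by metis
  then show ?thesis
    by (simp add: bilinear_sum_sum[OF bil] bilinear_lmul[OF bil] bilinear_rmul[OF bil] mult_ac)
qed

end

context
  fixes A :: "('a::{t2_space,second_countable_topology}, 'e::euclidean_space) chart set"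
    and B :: "('b::{t2_space,second_countable_topology}, 'f::euclidean_space) chart set"
    and F :: "'a \<Rightarrow> 'b" and h :: "'b \<Rightarrow> 'f \<Rightarrow> 'f \<Rightarrow> real"
  assumes A: "smooth_atlas A" and B: "smooth_atlas B" and F: "smooth_map A B F" and h: "riemannian_metric B h"
begin

text \<open>The smoothness axiom of a metric speaks of fields on the target; sections along
  \<open>F\<close> are reached by expanding them in a coordinate frame and pulling back its Gram
  matrix.\<close>

lemma metric_along_smooth:
  assumes U: "open U" and S: "section_along A B F U S" "section_along A B F U S'"
  shows "msmooth_on A U (\<lambda>q. h (F q) (S q) (S' q))"
proof (rule msmooth_on_local[OF A])
  fix p assume p: "p \<in> U"
  let ?d = "chart_at B (F p)"
  let ?W = "U \<inter> F -` fst ?d"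
  have d: "?d \<in> B" "F p \<in> fst ?d" using chart_at_mem[OF B] by auto
  have W: "open ?W" using U open_vimage_smooth_map[OF A B F] open_chart[OF B d(1)] by blast
  have "msmooth_on A ?W (\<lambda>q. \<Sum>b\<in>Basis. \<Sum>c\<in>Basis. (mderiv B (snd ?d) (F q) (S q) \<bullet> b)
      * (mderiv B (snd ?d) (F q) (S' q) \<bullet> c) * h (F q) (coord_vec B ?d (F q) b) (coord_vec B ?d (F q) c))"
  proof (intro msmooth_on_sum[OF A] msmooth_on_mult[OF A] msmooth_on_inner[OF A] W msmooth_on_const)
    show "msmooth_on A ?W (\<lambda>q. mderiv B (snd ?d) (F q) (S q))"
      "msmooth_on A ?W (\<lambda>q. mderiv B (snd ?d) (F q) (S' q))"
      using S d by (auto simp: section_along_eq)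
    show "msmooth_on A ?W (\<lambda>q. h (F q) (coord_vec B ?d (F q) b) (coord_vec B ?d (F q) c))" for b c
      by (rule msmooth_on_pullback[OF A B F W open_chart[OF B d(1)] metric_coord_vec_smooth[OF B h d(1)]]) auto
  qed
  then have "msmooth_on A ?W (\<lambda>q. h (F q) (S q) (S' q))"
    by (rule msmooth_on_cong[OF A W]) (simp add: metric_expansion[OF B h d(1), symmetric])
  then show "\<exists>V. open V \<and> p \<in> V \<and> msmooth_on A V (\<lambda>q. h (F q) (S q) (S' q))" using W p d by blast
qed

end

section \<open>Vertical and horizontal projections of a Riemannian submersion\<close>

context
  fixes A :: "('a::{t2_space,second_countable_topology}, 'e::euclidean_space) chart set"
    and B :: "('b::{t2_space,second_countable_topology}, 'f::euclidean_space) chart set"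
    and F :: "'a \<Rightarrow> 'b" and g :: "'a \<Rightarrow> 'e \<Rightarrow> 'e \<Rightarrow> real" and h :: "'b \<Rightarrow> 'f \<Rightarrow> 'f \<Rightarrow> real"
  assumes M: "riemannian_manifold A g" and N: "riemannian_manifold B h"
    and sub: "riemannian_submersion A B g h F"
begin

lemma submersion_smooth: "smooth_atlas A" "smooth_atlas B" "smooth_map A B F"
  "riemannian_metric A g" "riemannian_metric B h"
  using M N sub by (auto simp: riemannian_manifold_def riemannian_submersion_def)

text \<open>The two conditions make \<open>x\<close> orthogonal to the kernel and put
  \<open>v - x\<close> into it. Definiteness gives uniqueness, which evaluates the definite
  descriptions behind both projections.\<close>

lemma hor_proj_unique:
  assumes x: "differential A B F p x = differential A B F p v"
    "\<And>w. g p x w = h (F p) (differential A B F p v) (differential A B F p w)"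
  shows "hor_proj A B g F p v = x"
    and "ver_proj A B g F p v = v - x"
proof -
  let ?L = "differential A B F p"
  note lin = linear_differential[OF submersion_smooth(1-3), of p]
  have g: "bilinear (g p)" "\<And>v w. g p v w = g p w v" "\<And>v. v \<noteq> 0 \<Longrightarrow> g p v v > 0"
    by (rule riemannian_metricD[OF submersion_smooth(4)])+
  note h = riemannian_metricD(1)[OF submersion_smooth(5), of "F p"]
  have xh: "g p x w = 0" if "?L w = 0" for w using that x(2) by (simp add: bilinear_rzero[OF h])
  have vx: "?L (v - x) = 0" using x(1) by (simp add: linear_diff[OF lin])
  have uniq: "y = z" if "?L (y - z) = 0" "\<And>w. ?L w = 0 \<Longrightarrow> g p (y - z) w = 0" for y z
    using that(2)[OF that(1)] g(3)[of "y - z"] by force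
  show "hor_proj A B g F p v = x"
    unfolding hor_proj_def orth_proj_def
  proof (rule the_equality)
    show "x \<in> horizontal A B g F p \<and> (\<forall>u\<in>horizontal A B g F p. g p (v - x) u = 0)"
      using xh vx g(2) by (auto simp: horizontal_def vertical_def)
    fix y assume y: "y \<in> horizontal A B g F p \<and> (\<forall>u\<in>horizontal A B g F p. g p (v - y) u = 0)"
    have yx: "y - x \<in> horizontal A B g F p"
      using y xh by (auto simp: horizontal_def vertical_def bilinear_lsub[OF g(1)])
    have "g p (y - x) (y - x) = g p (v - x) (y - x) - g p (v - y) (y - x)"
      by (simp add: bilinear_lsub[OF g(1)])
    also have "\<dots> = 0"
      using y yx vx g(2)[of "v - x" "y - x"] by (auto simp: horizontal_def vertical_def)
    finally show "y = x" using g(3)[of "y - x"] by force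
  qed
  show "ver_proj A B g F p v = v - x"
    unfolding ver_proj_def orth_proj_def
  proof (rule the_equality)
    show "v - x \<in> vertical A B F p \<and> (\<forall>u\<in>vertical A B F p. g p (v - (v - x)) u = 0)"
      using xh vx by (auto simp: vertical_def)
    fix y assume y: "y \<in> vertical A B F p \<and> (\<forall>u\<in>vertical A B F p. g p (v - y) u = 0)"
    show "y = v - x"
    proof (rule uniq)
      show "?L (y - (v - x)) = 0" using y vx by (simp add: vertical_def linear_diff[OF lin])
      fix w assume w: "?L w = 0"
      have "g p (y - (v - x)) w = g p x w - g p (v - y) w" by (simp add: bilinear_lsub[OF g(1)])
      then show "g p (y - (v - x)) w = 0" using w y xh by (simp add: vertical_def)
    qed
  qed
qed

text \<open>The second formula says that the horizontal projection is the differential followed by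
  its adjoint; it expresses the projection through data that vary smoothly.\<close>

lemma hor_proj_props:
  "differential A B F p (hor_proj A B g F p v) = differential A B F p v"
  "g p (hor_proj A B g F p v) w = h (F p) (differential A B F p v) (differential A B F p w)"
  "ver_proj A B g F p v = v - hor_proj A B g F p v"
proof -
  let ?L = "differential A B F p"
  have "\<exists>x. ?L x = ?L v \<and> (\<forall>w. g p x w = h (F p) (?L v) (?L w))"
  proof (rule horizontal_component)
    show "linear ?L" by (rule linear_differential[OF submersion_smooth(1-3)])
    show "surj ?L" using sub by (auto simp: riemannian_submersion_def)
    fix v assume "\<And>w. ?L w = 0 \<Longrightarrow> g p v w = 0"
    then have "v \<in> horizontal A B g F p" by (simp add: horizontal_def vertical_def)
    then show "h (F p) (?L v) (?L v) = g p v v" using sub by (simp add: riemannian_submersion_def)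
  qed (use riemannian_metricD(1-3)[OF submersion_smooth(4)] riemannian_metricD(1-3)[OF submersion_smooth(5)] in auto)
  then obtain x where x: "?L x = ?L v" "\<And>w. g p x w = h (F p) (?L v) (?L w)" by blast
  show "?L (hor_proj A B g F p v) = ?L v"
    "g p (hor_proj A B g F p v) w = h (F p) (?L v) (?L w)"
    "ver_proj A B g F p v = v - hor_proj A B g F p v"
    using x hor_proj_unique[OF x] by auto
qed

lemma hor_proj_mem: "hor_proj A B g F p v \<in> horizontal A B g F p"
  using bilinear_rzero[OF riemannian_metricD(1)[OF submersion_smooth(5)]]
  by (simp add: horizontal_def vertical_def hor_proj_props(2))

lemma ver_proj_mem: "ver_proj A B g F p v \<in> vertical A B F p"
  using hor_proj_props(1) linear_diff[OF linear_differential[OF submersion_smooth(1-3)]]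
  by (simp add: vertical_def hor_proj_props(3))

lemma hor_proj_vertical: "v \<in> vertical A B F p \<Longrightarrow> hor_proj A B g F p v = 0"
  using bilinear_lzero[OF riemannian_metricD(1)[OF submersion_smooth(5)]]
    bilinear_lzero[OF riemannian_metricD(1)[OF submersion_smooth(4)]]
    linear_0[OF linear_differential[OF submersion_smooth(1-3)]]
  by (intro hor_proj_unique) (simp_all add: vertical_def)

lemma ver_proj_vertical: "v \<in> vertical A B F p \<Longrightarrow> ver_proj A B g F p v = v"
  by (simp add: hor_proj_vertical hor_proj_props(3))

lemma hor_proj_horizontal:
  assumes "v \<in> horizontal A B g F p" shows "hor_proj A B g F p v = v"
proof -
  have g: "bilinear (g p)" "\<And>v w. g p v w = g p w v" "\<And>v. v \<noteq> 0 \<Longrightarrow> g p v v > 0"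
    by (rule riemannian_metricD[OF submersion_smooth(4)])+
  let ?w = "ver_proj A B g F p v"
  have "g p (hor_proj A B g F p v) ?w = 0" "g p v ?w = 0"
    using assms hor_proj_mem ver_proj_mem by (auto simp: horizontal_def)
  then have "g p ?w ?w = 0" by (simp add: hor_proj_props(3) bilinear_lsub[OF g(1)])
  then have "?w = 0" using g(3) by force
  then show ?thesis by (simp add: hor_proj_props(3))
qed

lemma ver_proj_horizontal: "v \<in> horizontal A B g F p \<Longrightarrow> ver_proj A B g F p v = 0"
  by (simp add: hor_proj_horizontal hor_proj_props(3))

text \<open>The vertical part of \<open>w\<close> contributes nothing on either side, so the
  isometry on horizontal vectors extends to an arbitrary second argument.\<close>

lemma metric_horizontal:
  "v \<in> horizontal A B g F p \<Longrightarrow> g p v w = h (F p) (differential A B F p v) (differential A B F p w)"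
  by (metis hor_proj_props(2) hor_proj_horizontal)

text \<open>The products of the projected field with a coordinate frame equal products of images
  under the differential, which are smooth; \<open>coefficients_smooth\<close> then gives smooth
  components.\<close>

lemma vector_field_hor_proj:
  assumes U: "open U" and X: "vector_field_on A U X"
  shows "vector_field_on A U (\<lambda>q. hor_proj A B g F q (X q))"
  unfolding vector_field_on_def
proof (rule section_along_local[OF submersion_smooth(1,1) smooth_map_id[OF submersion_smooth(1)]])
  fix p assume p: "p \<in> U"
  note AB = submersion_smooth(1-3)
  let ?c = "chart_at A p"
  let ?W = "U \<inter> fst ?c"
  let ?H = "\<lambda>q. hor_proj A B g F q (X q)"
  let ?E = "\<lambda>b q. coord_vec A ?c q b"
  let ?a = "\<lambda>b q. mderiv A (snd ?c) q (?H q) \<bullet> b"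
  have c: "?c \<in> A" "p \<in> fst ?c" using chart_at_mem[OF AB(1)] by auto
  have W: "open ?W" using U open_chart[OF AB(1) c(1)] by blast
  have E: "vector_field_on A ?W (?E b)" for b
    by (rule vector_field_on_subset[OF vector_field_on_coord_vec[OF AB(1) c(1)]]) auto
  have g: "\<And>p. bilinear (g p)" "\<And>p v w. g p v w = g p w v" "\<And>p v. v \<noteq> 0 \<Longrightarrow> g p v v > 0"
    by (rule riemannian_metricD[OF submersion_smooth(4)])+
  have a: "msmooth_on A ?W (?a b)" if "b \<in> Basis" for b
  proof (rule coefficients_smooth[OF AB(1) W g finite_Basis _ _ _ that])
    fix q x assume q: "q \<in> ?W" and 0: "(\<Sum>b\<in>Basis. x b *\<^sub>R ?E b q) = 0"
    let ?x = "\<Sum>b\<in>Basis. x b *\<^sub>R b"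
    have lin: "linear (coord_vec A ?c q)" using q by (intro linear_coord_vec[OF AB(1) c(1)]) auto
    have "coord_vec A ?c q ?x = 0" using 0 by (simp add: linear_sum[OF lin] linear_scale[OF lin])
    then have "?x = 0"
      using mderiv_coord_vec[OF AB(1) c(1), of q ?x] mderiv_coord_vec[OF AB(1) c(1), of q 0] q linear_0[OF lin]
      by simp
    then show "\<forall>b\<in>Basis. x b = 0" using inner_sum_left_Basis[of _ x] by simp
  next
    show "msmooth_on A ?W (\<lambda>q. g q (?E b q) (?E c q))" for b c
      by (intro riemannian_metricD(4)[OF submersion_smooth(4)] W E)
    fix e :: 'e
    have "msmooth_on A ?W (\<lambda>q. h (F q) (differential A B F q (X q)) (differential A B F q (?E e q)))"
      by (intro metric_along_smooth[OF AB submersion_smooth(5) W] section_along_differential[OF AB W] E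
          vector_field_on_subset[OF X]) auto
    then show "msmooth_on A ?W (\<lambda>q. g q (\<Sum>b\<in>Basis. ?a b q *\<^sub>R ?E b q) (?E e q))"
      by (rule msmooth_on_cong[OF AB(1) W])
        (simp add: coord_expansion[OF AB(1) c(1), symmetric] hor_proj_props(2))
  qed
  have "msmooth_on A ?W (\<lambda>q. \<Sum>b\<in>Basis. ?a b q *\<^sub>R b)"
    by (intro msmooth_on_sum[OF AB(1)] msmooth_on_scaleR[OF AB(1)] W a msmooth_on_const)
  then have "section_along A A id ?W ?H"
    by (intro section_along_coords[OF AB(1,1) smooth_map_id[OF AB(1)] c(1) W])
      (auto simp: euclidean_representation)
  then show "\<exists>V. open V \<and> p \<in> V \<and> section_along A A id V ?H" using W p c by blast
qed

lemma vector_field_ver_proj: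
  assumes U: "open U" and X: "vector_field_on A U X"
  shows "vector_field_on A U (\<lambda>q. ver_proj A B g F q (X q))"
proof -
  note AA = submersion_smooth(1,1) smooth_map_id[OF submersion_smooth(1)]
  have "section_along A A id U (\<lambda>q. X q + (-1) *\<^sub>R hor_proj A B g F q (X q))"
    using X vector_field_hor_proj[OF U X] unfolding vector_field_on_def
    by (intro section_along_add[OF AA U] section_along_scaleR[OF AA U] msmooth_on_const)
  then show ?thesis by (simp add: vector_field_on_def hor_proj_props(3))
qed

end

section \<open>Connections along maps and the second fundamental form\<close>

lemma connection_alongD:
  assumes "connection_along A B F D" "open U" "p \<in> U" "section_along A B F U S"
  shows "linear (\<lambda>v. D p v S)"
    and "section_along A B F U S' \<Longrightarrow> D p v (\<lambda>q. S q + S' q) = D p v S + D p v S'"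
    and "msmooth_on A U f \<Longrightarrow> D p v (\<lambda>q. f q *\<^sub>R S q) = mderiv A f p v *\<^sub>R S p + f p *\<^sub>R D p v S"
    and "section_along A B F U S' \<Longrightarrow> (\<And>q. q \<in> U \<Longrightarrow> S q = S' q) \<Longrightarrow> D p v S = D p v S'"
proof -
  note C = assms(1)[unfolded connection_along_def smooth_fun_on_eq vec_deriv_eq]
  show "linear (\<lambda>v. D p v S)"
    by (rule C[THEN conjunct1, rule_format, of U p S]) (use assms in auto)
  show "D p v (\<lambda>q. S q + S' q) = D p v S + D p v S'" if "section_along A B F U S'"
    by (rule C[THEN conjunct2, THEN conjunct1, rule_format, of U p S S' v]) (use assms that in auto)
  show "D p v (\<lambda>q. f q *\<^sub>R S q) = mderiv A f p v *\<^sub>R S p + f p *\<^sub>R D p v S" if "msmooth_on A U f"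
    by (rule C[THEN conjunct2, THEN conjunct2, THEN conjunct1, rule_format, of U p f S v]) (use assms that in auto)
  show "D p v S = D p v S'" if "section_along A B F U S'" "\<And>q. q \<in> U \<Longrightarrow> S q = S' q"
    by (rule C[THEN conjunct2, THEN conjunct2, THEN conjunct2, THEN conjunct1, rule_format, of U p S S' v])
      (use assms that in auto)
qed

lemma levi_civitaD:
  assumes "levi_civita A g D"
  shows "connection_along A A id D"
    and "open U \<Longrightarrow> p \<in> U \<Longrightarrow> vector_field_on A U X \<Longrightarrow> vector_field_on A U Y \<Longrightarrow>
      D p (X p) Y - D p (Y p) X = lie_bracket A X Y p"
    and "open U \<Longrightarrow> p \<in> U \<Longrightarrow> vector_field_on A U X \<Longrightarrow> vector_field_on A U Y \<Longrightarrow>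
      mderiv A (\<lambda>q. g q (X q) (Y q)) p v = g p (D p v X) (Y p) + g p (X p) (D p v Y)"
proof -
  note C = assms[unfolded levi_civita_def affine_connection_def vec_deriv_eq]
  show "connection_along A A id D" by (rule C[THEN conjunct1])
  assume a: "open U" "p \<in> U" "vector_field_on A U X" "vector_field_on A U Y"
  show "D p (X p) Y - D p (Y p) X = lie_bracket A X Y p"
    by (rule C[THEN conjunct2, THEN conjunct1, rule_format, of U p X Y]) (use a in auto)
  show "mderiv A (\<lambda>q. g q (X q) (Y q)) p v = g p (D p v X) (Y p) + g p (X p) (D p v Y)"
    by (rule C[THEN conjunct2, THEN conjunct2, rule_format, of U p X Y v]) (use a in auto)
qed

text \<open>Coordinate fields have constant components in their own chart, so both iterated
  derivatives in the commutator formula vanish.\<close>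

lemma coord_vec_lie_bracket:
  fixes B :: "('b::{t2_space,second_countable_topology}, 'f::euclidean_space) chart set"
  assumes B: "smooth_atlas B" and d: "d \<in> B" "y \<in> fst d"
  shows "lie_bracket B (\<lambda>y. coord_vec B d y b) (\<lambda>y. coord_vec B d y c) y = 0"
proof -
  let ?E = "\<lambda>b y. coord_vec B d y b"
  have "mderiv B (\<lambda>y. mderiv B (snd d) y (?E b y)) y w = 0" for b w
    using mderiv_cong[OF B open_chart[OF B d(1)] d(2), of "\<lambda>y. mderiv B (snd d) y (?E b y)" "\<lambda>y. b"]
    by (simp add: mderiv_coord_vec[OF B d(1)] mderiv_const[OF B])
  then have "mderiv B (snd d) y (lie_bracket B (?E b) (?E c) y) = 0"
    using mderiv_lie_bracket[OF B open_chart[OF B d(1)] d(2) msmooth_on_chart[OF B d(1)]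
        vector_field_on_coord_vec[OF B d(1)] vector_field_on_coord_vec[OF B d(1)]] by simp
  then show ?thesis
    using coord_vec_mderiv[OF B d, of "lie_bracket B (?E b) (?E c) y"] linear_0[OF linear_coord_vec[OF B d]] by simp
qed

context
  fixes A :: "('a::{t2_space,second_countable_topology}, 'e::euclidean_space) chart set"
    and B :: "('b::{t2_space,second_countable_topology}, 'f::euclidean_space) chart set"
    and F :: "'a \<Rightarrow> 'b" and D :: "'a \<Rightarrow> 'e \<Rightarrow> ('a \<Rightarrow> 'f) \<Rightarrow> 'f"
  assumes A: "smooth_atlas A" and B: "smooth_atlas B" and F: "smooth_map A B F"
    and D: "connection_along A B F D"
begin

lemma connection_zero: "D p v (\<lambda>q. 0) = 0"
proof -
  note z = section_along_zero[OF A B F, of UNIV]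
  have "D p v (\<lambda>q. 0 + 0) = D p v (\<lambda>q. 0) + D p v (\<lambda>q. 0)"
    by (rule connection_alongD(2)[OF D open_UNIV UNIV_I z z])
  then show ?thesis by simp
qed

lemma connection_sum:
  assumes "finite I" "open U" "p \<in> U" "\<And>i. i \<in> I \<Longrightarrow> section_along A B F U (S i)"
  shows "D p v (\<lambda>q. \<Sum>i\<in>I. S i q) = (\<Sum>i\<in>I. D p v (S i))"
  using assms(1,4)
proof (induction I rule: finite_induct)
  case empty then show ?case by (simp add: connection_zero)
next
  case (insert i I)
  have "section_along A B F U (\<lambda>q. \<Sum>i\<in>I. S i q)"
    by (rule section_along_sum[OF A B F assms(2)]) (use insert.prems in auto)
  with insert show ?case
    using connection_alongD(2)[OF D assms(2,3), of "S i" "\<lambda>q. \<Sum>i\<in>I. S i q"] by simp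
qed

lemma connection_combination:
  assumes "finite I" and U: "open U" "p \<in> U"
    and S: "\<And>i. i \<in> I \<Longrightarrow> section_along A B F U (S i)" and f: "\<And>i. i \<in> I \<Longrightarrow> msmooth_on A U (f i)"
  shows "D p v (\<lambda>q. \<Sum>i\<in>I. f i q *\<^sub>R S i q) = (\<Sum>i\<in>I. mderiv A (f i) p v *\<^sub>R S i p + f i p *\<^sub>R D p v (S i))"
  using connection_sum[OF assms(1) U, of "\<lambda>i q. f i q *\<^sub>R S i q" v]
    section_along_scaleR[OF A B F U(1) f S] connection_alongD(3)[OF D U S f, of _ _ v]
  by simp

text \<open>Leibniz rule over a coordinate frame. The expansion of \<open>S\<close> holds only over
  the chart domain, and the germ clause of \<open>connection_along\<close> carries it through
  \<open>D\<close>.\<close>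

lemma connection_expansion:
  assumes U: "open U" "p \<in> U" and S: "section_along A B F U S" and d: "d \<in> B" "F p \<in> fst d"
  defines "s \<equiv> \<lambda>q. mderiv B (snd d) (F q) (S q)"
  shows "D p v S = (\<Sum>b\<in>Basis. (mderiv A s p v \<bullet> b) *\<^sub>R coord_vec B d (F p) b
    + (s p \<bullet> b) *\<^sub>R D p v ((\<lambda>y. coord_vec B d y b) \<circ> F))"
proof -
  define E where "E = (\<lambda>b y. coord_vec B d y b)"
  let ?W = "U \<inter> F -` fst d"
  have W: "open ?W" "p \<in> ?W" using U d open_vimage_smooth_map[OF A B F] open_chart[OF B d(1)] by auto
  have s: "msmooth_on A ?W s" using S d(1) by (simp add: section_along_eq s_def)
  have sb: "msmooth_on A ?W (\<lambda>q. s q \<bullet> b)" for b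
    by (rule msmooth_on_inner[OF A W(1) s msmooth_on_const])
  have E: "section_along A B F ?W (E b \<circ> F)" for b
    unfolding E_def
    by (rule section_along_field[OF A B F W(1) open_chart[OF B d(1)] vector_field_on_coord_vec[OF B d(1)]]) auto
  have eq: "S q = (\<Sum>b\<in>Basis. (s q \<bullet> b) *\<^sub>R (E b \<circ> F) q)" if "q \<in> ?W" for q
    using that coord_expansion[OF B d(1), of "F q" "S q"] by (simp add: s_def E_def)
  have "D p v S = D p v (\<lambda>q. \<Sum>b\<in>Basis. (s q \<bullet> b) *\<^sub>R (E b \<circ> F) q)"
    by (rule connection_alongD(4)[OF D W section_along_subset[OF S]
          section_along_sum[OF A B F W(1) section_along_scaleR[OF A B F W(1) sb E]]]) (use eq in auto)
  also have "\<dots> = (\<Sum>b\<in>Basis. (mderiv A s p v \<bullet> b) *\<^sub>R E b (F p) + (s p \<bullet> b) *\<^sub>R D p v (E b \<circ> F))"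
    using connection_combination[OF finite_Basis W E sb, of v] by (simp add: mderiv_inner_const[OF A s W(2)])
  finally show ?thesis by (simp add: E_def)
qed

end

section \<open>The pullback connection: metric compatibility and vanishing torsion\<close>

context
  fixes A :: "('a::{t2_space,second_countable_topology}, 'e::euclidean_space) chart set"
    and B :: "('b::{t2_space,second_countable_topology}, 'f::euclidean_space) chart set"
    and F :: "'a \<Rightarrow> 'b" and h :: "'b \<Rightarrow> 'f \<Rightarrow> 'f \<Rightarrow> real"
    and DN :: "'b \<Rightarrow> 'f \<Rightarrow> ('b \<Rightarrow> 'f) \<Rightarrow> 'f" and DF :: "'a \<Rightarrow> 'e \<Rightarrow> ('a \<Rightarrow> 'f) \<Rightarrow> 'f"
  assumes A: "smooth_atlas A" and B: "smooth_atlas B" and F: "smooth_map A B F"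
    and h: "riemannian_metric B h" and DN: "levi_civita B h DN"
    and DF: "pullback_connection A B F DN DF"
begin

lemma pullback_connection_along: "connection_along A B F DF"
  using DF by (simp add: pullback_connection_def)

lemma pullback_expansion:
  assumes U: "open U" "p \<in> U" and S: "section_along A B F U S" and d: "d \<in> B" "F p \<in> fst d"
  defines "s \<equiv> \<lambda>q. mderiv B (snd d) (F q) (S q)"
  shows "DF p v S = (\<Sum>b\<in>Basis. (mderiv A s p v \<bullet> b) *\<^sub>R coord_vec B d (F p) b
    + (s p \<bullet> b) *\<^sub>R DN (F p) (differential A B F p v) (\<lambda>y. coord_vec B d y b))"
proof -
  have "DF p v ((\<lambda>y. coord_vec B d y b) \<circ> F) = DN (F p) (differential A B F p v) (\<lambda>y. coord_vec B d y b)" for b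
    using DF d open_chart[OF B d(1)] vector_field_on_coord_vec[OF B d(1)]
    unfolding pullback_connection_def by blast
  then show ?thesis
    using connection_expansion[OF A B F pullback_connection_along U S d, of v] by (simp add: s_def)
qed

text \<open>For frame sections this is compatibility of \<open>DN\<close> with \<open>h\<close>
  together with the chain rule (\<open>dG\<close>); expanding both sections in the frame and
  applying the product rule extends it to all sections.\<close>

lemma pullback_metric:
  assumes U: "open U" "p \<in> U" and S: "section_along A B F U S" and S': "section_along A B F U S'"
  shows "mderiv A (\<lambda>q. h (F q) (S q) (S' q)) p v = h (F p) (DF p v S) (S' p) + h (F p) (S p) (DF p v S')"
proof -
  define d where "d = chart_at B (F p)"
  define E where "E = (\<lambda>b y. coord_vec B d y b)"
  define s where "s = (\<lambda>q. mderiv B (snd d) (F q) (S q))"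
  define s' where "s' = (\<lambda>q. mderiv B (snd d) (F q) (S' q))"
  define N where "N = (\<lambda>b. DN (F p) (differential A B F p v) (E b))"
  define G where "G = (\<lambda>b c y. h y (E b y) (E c y))"
  let ?W = "U \<inter> F -` fst d"
  have d: "d \<in> B" "F p \<in> fst d" using chart_at_mem[OF B] by (auto simp: d_def)
  have W: "open ?W" "p \<in> ?W" using U d open_vimage_smooth_map[OF A B F] open_chart[OF B d(1)] by auto
  have sm: "msmooth_on A ?W s" "msmooth_on A ?W s'"
    using S S' d(1) by (auto simp: section_along_eq s_def s'_def)
  have G: "msmooth_on B (fst d) (G b c)" for b c
    unfolding G_def E_def by (rule metric_coord_vec_smooth[OF B h d(1)])
  have GF: "msmooth_on A ?W (\<lambda>q. G b c (F q))" for b c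
    by (rule msmooth_on_pullback[OF A B F W(1) open_chart[OF B d(1)] G]) auto
  have dG: "mderiv A (\<lambda>q. G b c (F q)) p v = h (F p) (N b) (E c (F p)) + h (F p) (E b (F p)) (N c)" for b c
    unfolding mderiv_pullback[OF A B F open_chart[OF B d(1)] G d(2)] N_def
    unfolding G_def E_def
    by (rule levi_civitaD(3)[OF DN open_chart[OF B d(1)] d(2)]; rule vector_field_on_coord_vec[OF B d(1)])
  note bil = riemannian_metricD(1)[OF h, of "F p"]
  note bl = bilinear_ladd[OF bil] bilinear_radd[OF bil] bilinear_lmul[OF bil] bilinear_rmul[OF bil]
  have sb: "msmooth_on A ?W (\<lambda>q. s q \<bullet> b)" "msmooth_on A ?W (\<lambda>q. s' q \<bullet> b)" for b
    by (intro msmooth_on_inner[OF A W(1)] sm msmooth_on_const)+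
  have tm: "msmooth_on A ?W (\<lambda>q. (s q \<bullet> b) * (s' q \<bullet> c) * G b c (F q))" for b c
    by (intro msmooth_on_mult[OF A W(1)] sb GF)
  have "mderiv A (\<lambda>q. h (F q) (S q) (S' q)) p v
    = mderiv A (\<lambda>q. \<Sum>b\<in>Basis. \<Sum>c\<in>Basis. (s q \<bullet> b) * (s' q \<bullet> c) * G b c (F q)) p v"
    by (rule mderiv_cong[OF A W]) (simp add: metric_expansion[OF B h d(1)] s_def s'_def G_def E_def)
  also have "\<dots> = (\<Sum>b\<in>Basis. \<Sum>c\<in>Basis. mderiv A (\<lambda>q. (s q \<bullet> b) * (s' q \<bullet> c) * G b c (F q)) p v)"
    by (simp add: mderiv_sum[OF A finite_Basis W(1) msmooth_on_sum[OF A W(1) tm] W(2)]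
        mderiv_sum[OF A finite_Basis W(1) tm W(2)])
  also have "\<dots> = (\<Sum>b\<in>Basis. \<Sum>c\<in>Basis.
      ((mderiv A s p v \<bullet> b) * (s' p \<bullet> c) * G b c (F p) + (s p \<bullet> b) * (s' p \<bullet> c) * h (F p) (N b) (E c (F p)))
      + ((s p \<bullet> b) * (mderiv A s' p v \<bullet> c) * G b c (F p) + (s p \<bullet> b) * (s' p \<bullet> c) * h (F p) (E b (F p)) (N c)))"
    unfolding mderiv_mult[OF A msmooth_on_mult[OF A W(1) sb(1) sb(2)] GF W(2)]
      mderiv_mult[OF A sb(1) sb(2) W(2)] mderiv_inner_const[OF A sm(1) W(2)]
      mderiv_inner_const[OF A sm(2) W(2)] dG
    by (intro sum.cong refl) (simp add: algebra_simps)
  also have "\<dots> = h (F p) (\<Sum>b\<in>Basis. (mderiv A s p v \<bullet> b) *\<^sub>R E b (F p) + (s p \<bullet> b) *\<^sub>R N b)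
        (\<Sum>c\<in>Basis. (s' p \<bullet> c) *\<^sub>R E c (F p))
      + h (F p) (\<Sum>b\<in>Basis. (s p \<bullet> b) *\<^sub>R E b (F p))
        (\<Sum>c\<in>Basis. (mderiv A s' p v \<bullet> c) *\<^sub>R E c (F p) + (s' p \<bullet> c) *\<^sub>R N c)"
    unfolding bilinear_sum_sum[OF bil] sum.distrib[symmetric]
    by (intro sum.cong refl) (simp add: bl G_def algebra_simps)
  also have "\<dots> = h (F p) (DF p v S) (S' p) + h (F p) (S p) (DF p v S')"
    using pullback_expansion[OF U S d, of v] pullback_expansion[OF U S' d, of v]
      coord_expansion[OF B d, of "S p"] coord_expansion[OF B d, of "S' p"]
    by (simp add: s_def s'_def E_def N_def)
  finally show ?thesis .
qed

lemma pullback_torsion_free: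
  assumes U: "open U" "p \<in> U" and X: "vector_field_on A U X" and Y: "vector_field_on A U Y"
  shows "DF p (X p) (\<lambda>q. differential A B F q (Y q)) - DF p (Y p) (\<lambda>q. differential A B F q (X q))
    = differential A B F p (lie_bracket A X Y p)"
proof -
  define d where "d = chart_at B (F p)"
  define E where "E = (\<lambda>b y. coord_vec B d y b)"
  define f where "f = (\<lambda>q. snd d (F q))"
  define N where "N = (\<lambda>b c. DN (F p) (E c (F p)) (E b))"
  let ?L = "differential A B F"
  let ?W = "U \<inter> F -` fst d"
  have d: "d \<in> B" "F p \<in> fst d" using chart_at_mem[OF B] by (auto simp: d_def)
  have W: "open ?W" "p \<in> ?W" using U d open_vimage_smooth_map[OF A B F] open_chart[OF B d(1)] by auto
  have f: "msmooth_on A ?W f"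
    unfolding f_def using msmooth_on_chart_smooth_map[OF A B F d(1)] by (rule msmooth_on_subset) auto
  have XW: "vector_field_on A ?W X" and YW: "vector_field_on A ?W Y"
    using X Y by (auto intro: vector_field_on_subset)
  have coords: "mderiv B (snd d) (F q) (?L q v) = mderiv A f q v" if "q \<in> ?W" for q v
    using mderiv_pullback[OF A B F open_chart[OF B d(1)] msmooth_on_chart[OF B d(1)], of q] that
    by (simp add: f_def)
  have E: "vector_field_on B (fst d) (E b)" for b
    unfolding E_def by (rule vector_field_on_coord_vec[OF B d(1)])
  have Nlin: "linear (\<lambda>w. DN (F p) w (E b))" for b
    using connection_alongD(1)[OF levi_civitaD(1)[OF DN] open_chart[OF B d(1)] d(2)] E
    by (simp add: vector_field_on_def)
  \<comment> \<open>Coordinate fields commute, so vanishing torsion of \<open>DN\<close> makes the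
    Christoffel vectors \<open>N b c\<close> symmetric.\<close>
  have Nsym: "N b c = N c b" for b c
    using levi_civitaD(2)[OF DN open_chart[OF B d(1)] d(2) E E, of b c]
      coord_vec_lie_bracket[OF B d, of b c] by (simp add: N_def E_def)
  \<comment> \<open>The first summand is an iterated derivative of \<open>F\<close> in coordinates,
    the second the Christoffel term. In the difference for \<open>X\<close> and \<open>Y\<close> the
    Christoffel terms cancel and the first ones form a commutator.\<close>
  have D: "DF p v (\<lambda>q. ?L q (Z q)) = coord_vec B d (F p) (mderiv A (\<lambda>q. mderiv A f q (Z q)) p v)
      + (\<Sum>b\<in>Basis. \<Sum>c\<in>Basis. (mderiv A f p (Z p) \<bullet> b) *\<^sub>R (mderiv A f p v \<bullet> c) *\<^sub>R N b c)"
    if Z: "vector_field_on A U Z" for Z v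
  proof -
    have Lv: "?L p v = (\<Sum>c\<in>Basis. (mderiv A f p v \<bullet> c) *\<^sub>R E c (F p))"
      using coord_expansion[OF B d, of "?L p v"] coords[OF W(2)] by (simp add: E_def)
    have DN': "DN (F p) (?L p v) (E b) = (\<Sum>c\<in>Basis. (mderiv A f p v \<bullet> c) *\<^sub>R N b c)" for b
      unfolding Lv by (simp add: linear_sum[OF Nlin] linear_scale[OF Nlin] N_def)
    have dz: "mderiv A (\<lambda>q. mderiv B (snd d) (F q) (?L q (Z q))) p v = mderiv A (\<lambda>q. mderiv A f q (Z q)) p v"
      by (rule mderiv_cong[OF A W]) (simp add: coords)
    have "DF p v (\<lambda>q. ?L q (Z q)) = (\<Sum>b\<in>Basis. (mderiv A (\<lambda>q. mderiv A f q (Z q)) p v \<bullet> b) *\<^sub>R E b (F p)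
        + (mderiv A f p (Z p) \<bullet> b) *\<^sub>R DN (F p) (?L p v) (E b))"
      using pullback_expansion[OF U section_along_differential[OF A B F U(1) Z] d, of v]
      by (simp add: dz coords[OF W(2)] E_def)
    also have "\<dots> = (\<Sum>b\<in>Basis. (mderiv A (\<lambda>q. mderiv A f q (Z q)) p v \<bullet> b) *\<^sub>R E b (F p))
       + (\<Sum>b\<in>Basis. \<Sum>c\<in>Basis. (mderiv A f p (Z p) \<bullet> b) *\<^sub>R (mderiv A f p v \<bullet> c) *\<^sub>R N b c)"
      by (simp add: sum.distrib DN' scaleR_sum_right)
    also have "(\<Sum>b\<in>Basis. (mderiv A (\<lambda>q. mderiv A f q (Z q)) p v \<bullet> b) *\<^sub>R E b (F p))
       = coord_vec B d (F p) (mderiv A (\<lambda>q. mderiv A f q (Z q)) p v)"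
      unfolding E_def by (rule linear_Basis_expansion[OF linear_coord_vec[OF B d], symmetric])
    finally show ?thesis .
  qed
  have "(\<Sum>b\<in>Basis. \<Sum>c\<in>Basis. (mderiv A f p (X p) \<bullet> b) *\<^sub>R (mderiv A f p (Y p) \<bullet> c) *\<^sub>R N b c)
    = (\<Sum>b\<in>Basis. \<Sum>c\<in>Basis. (mderiv A f p (Y p) \<bullet> b) *\<^sub>R (mderiv A f p (X p) \<bullet> c) *\<^sub>R N b c)"
    by (subst sum.swap) (simp add: Nsym mult.commute)
  then have "DF p (X p) (\<lambda>q. ?L q (Y q)) - DF p (Y p) (\<lambda>q. ?L q (X q))
    = coord_vec B d (F p) (mderiv A (\<lambda>q. mderiv A f q (Y q)) p (X p))
      - coord_vec B d (F p) (mderiv A (\<lambda>q. mderiv A f q (X q)) p (Y p))"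
    by (simp add: D[OF X] D[OF Y])
  also have "\<dots> = coord_vec B d (F p) (mderiv A f p (lie_bracket A X Y p))"
    unfolding mderiv_lie_bracket[OF A W f XW YW]
    by (rule linear_diff[OF linear_coord_vec[OF B d], symmetric])
  also have "\<dots> = ?L p (lie_bracket A X Y p)"
    unfolding coords[OF W(2), symmetric] by (rule coord_vec_mderiv[OF B d])
  finally show ?thesis .
qed

end

section \<open>The second fundamental form of a Riemannian submersion\<close>

context
  fixes A :: "('a::{t2_space,second_countable_topology}, 'e::euclidean_space) chart set"
    and B :: "('b::{t2_space,second_countable_topology}, 'f::euclidean_space) chart set"
    and F :: "'a \<Rightarrow> 'b" and g :: "'a \<Rightarrow> 'e \<Rightarrow> 'e \<Rightarrow> real" and h :: "'b \<Rightarrow> 'f \<Rightarrow> 'f \<Rightarrow> real"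
    and DM :: "'a \<Rightarrow> 'e \<Rightarrow> ('a \<Rightarrow> 'e) \<Rightarrow> 'e"
    and DN :: "'b \<Rightarrow> 'f \<Rightarrow> ('b \<Rightarrow> 'f) \<Rightarrow> 'f" and DF :: "'a \<Rightarrow> 'e \<Rightarrow> ('a \<Rightarrow> 'f) \<Rightarrow> 'f"
  assumes M: "riemannian_manifold A g" and N: "riemannian_manifold B h"
    and sub: "riemannian_submersion A B g h F"
    and DM: "levi_civita A g DM" and DN: "levi_civita B h DN"
    and DF: "pullback_connection A B F DN DF"
begin

lemmas AB = submersion_smooth(1-3)[OF M N sub]
lemmas gh = submersion_smooth(4,5)[OF M N sub]

lemma second_fundamental_form_sym:
  assumes U: "open U" "p \<in> U" and X: "vector_field_on A U X" and Y: "vector_field_on A U Y"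
  shows "second_fundamental_form A B DM DF F X Y p = second_fundamental_form A B DM DF F Y X p"
  using pullback_torsion_free[OF AB gh(2) DN DF U X Y] levi_civitaD(2)[OF DM U X Y, symmetric]
  by (simp add: second_fundamental_form_def linear_diff[OF linear_differential[OF AB]] algebra_simps)

lemma second_fundamental_form_vertical:
  assumes "\<And>q. V q \<in> vertical A B F q"
  shows "second_fundamental_form A B DM DF F X V p = - differential A B F p (DM p (X p) V)"
proof -
  have "(\<lambda>q. differential A B F q (V q)) = (\<lambda>q. 0)" using assms by (simp add: vertical_def)
  then show ?thesis
    using connection_zero[OF AB pullback_connection_along[OF AB gh(2) DN DF]]
    by (simp add: second_fundamental_form_def)
qed

lemma second_fundamental_form_add:
  assumes U: "open U" "p \<in> U" and Y: "vector_field_on A U Y" and Z: "vector_field_on A U Z"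
  shows "second_fundamental_form A B DM DF F X (\<lambda>q. Y q + Z q) p
    = second_fundamental_form A B DM DF F X Y p + second_fundamental_form A B DM DF F X Z p"
proof -
  have "DM p (X p) (\<lambda>q. Y q + Z q) = DM p (X p) Y + DM p (X p) Z"
    using Y Z unfolding vector_field_on_def by (rule connection_alongD(2)[OF levi_civitaD(1)[OF DM] U])
  moreover have "DF p (X p) (\<lambda>q. differential A B F q (Y q) + differential A B F q (Z q))
    = DF p (X p) (\<lambda>q. differential A B F q (Y q)) + DF p (X p) (\<lambda>q. differential A B F q (Z q))"
    by (rule connection_alongD(2)[OF pullback_connection_along[OF AB gh(2) DN DF] U])
      (intro section_along_differential[OF AB U(1)] Y Z)+
  ultimately show ?thesis
    by (simp add: second_fundamental_form_def linear_add[OF linear_differential[OF AB]])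
qed

lemma second_fundamental_form_horizontal:
  assumes U: "open U" "p \<in> U" and X: "vector_field_on A U X" and Y: "vector_field_on A U Y"
    and hor: "\<And>q. q \<in> U \<Longrightarrow> X q \<in> horizontal A B g F q" "\<And>q. q \<in> U \<Longrightarrow> Y q \<in> horizontal A B g F q"
  shows "second_fundamental_form A B DM DF F X Y p = 0"
proof -
  let ?L = "differential A B F"
  let ?sff = "second_fundamental_form A B DM DF F"
  define c where "c = chart_at A p"
  \<comment> \<open>On a chart domain around \<open>p\<close> the coordinate fields supply
    horizontal fields with any prescribed image at \<open>p\<close>.\<close>
  define W where "W = U \<inter> fst c"
  have c: "c \<in> A" "p \<in> fst c" using chart_at_mem[OF AB(1)] by (auto simp: c_def)
  have W: "open W" "p \<in> W" using U c open_chart[OF AB(1) c(1)] by (auto simp: W_def)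
  define \<H> where "\<H> = {X. vector_field_on A W X \<and> (\<forall>q\<in>W. X q \<in> horizontal A B g F q)}"
  define C where "C = (\<lambda>X Y Z. h (F p) (?sff X Y p) (?L p (Z p)))"
  note h = riemannian_metricD(1-3)[OF gh(2), where p = "F p"]
  note gp = riemannian_metricD(1-3)[OF gh(1), where p = p]
  have sym: "C X Y Z = C Y X Z" if "X \<in> \<H>" "Y \<in> \<H>" for X Y Z
    using second_fundamental_form_sym[OF W, of X Y] that by (simp add: C_def \<H>_def)
  have skew: "C X Y Z = - C X Z Y" if "X \<in> \<H>" "Y \<in> \<H>" "Z \<in> \<H>" for X Y Z
  proof -
    have YZ: "vector_field_on A W Y" "vector_field_on A W Z" using that by (auto simp: \<H>_def)
    have hor: "Z q \<in> horizontal A B g F q" if "q \<in> W" "Z \<in> \<H>" for Z q using that by (auto simp: \<H>_def)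
    have iso: "g p v (Z p) = h (F p) (?L p v) (?L p (Z p))" if "Z \<in> \<H>" for v Z
      using metric_horizontal[OF M N sub hor[OF W(2) that], of v] gp(2)[of v "Z p"]
        h(2)[of "?L p v" "?L p (Z p)"] by simp
    \<comment> \<open>For horizontal fields the product of the images equals the product upstairs;
      the two compatibility formulas for its derivative are compared.\<close>
    have "h (F p) (DF p (X p) (\<lambda>q. ?L q (Y q))) (?L p (Z p)) + h (F p) (?L p (Y p)) (DF p (X p) (\<lambda>q. ?L q (Z q)))
       = mderiv A (\<lambda>q. h (F q) (?L q (Y q)) (?L q (Z q))) p (X p)"
      by (rule pullback_metric[OF AB gh(2) DN DF W section_along_differential[OF AB W(1) YZ(1)]
            section_along_differential[OF AB W(1) YZ(2)], symmetric])
    also have "\<dots> = mderiv A (\<lambda>q. g q (Y q) (Z q)) p (X p)"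
      by (rule mderiv_cong[OF AB(1) W]) (rule metric_horizontal[OF M N sub hor, symmetric]; use that in simp)
    also have "\<dots> = g p (DM p (X p) Y) (Z p) + g p (Y p) (DM p (X p) Z)"
      by (rule levi_civitaD(3)[OF DM W YZ])
    also have "\<dots> = h (F p) (?L p (DM p (X p) Y)) (?L p (Z p)) + h (F p) (?L p (Y p)) (?L p (DM p (X p) Z))"
      using iso[OF that(3)] iso[OF that(2), of "DM p (X p) Z"] gp(2)[of "Y p" "DM p (X p) Z"]
        h(2)[of "?L p (Y p)" "?L p (DM p (X p) Z)"] by simp
    finally show ?thesis
      using h(2)[of "?L p (Y p)" "DF p (X p) (\<lambda>q. ?L q (Z q))"] h(2)[of "?L p (Y p)" "?L p (DM p (X p) Z)"]
      by (simp add: C_def second_fundamental_form_def bilinear_lsub[OF h(1)])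
  qed
  \<comment> \<open>Applying the two rules alternately, three times each, returns to
    \<open>C X Y Z\<close> with a minus sign; the same pattern underlies uniqueness of the
    Levi-Civita connection.\<close>
  have zero: "C X Y Z = 0" if "X \<in> \<H>" "Y \<in> \<H>" "Z \<in> \<H>" for X Y Z
    using sym[of X Y Z] skew[of Y X Z] sym[of Y Z X] skew[of Z Y X] sym[of Z X Y] skew[of X Z Y] that by linarith
  \<comment> \<open>A horizontal field is built whose image at \<open>p\<close> is the value of the
    form itself, so that testing against it yields a squared norm.\<close>
  obtain v where v: "?L p v = ?sff X Y p"
    using sub by (metis riemannian_submersion_def surjD)
  define Z where "Z = (\<lambda>q. hor_proj A B g F q (coord_vec A c q (mderiv A (snd c) p v)))"
  have "vector_field_on A W Z"
    unfolding Z_def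
    by (rule vector_field_hor_proj[OF M N sub W(1) vector_field_on_subset[OF vector_field_on_coord_vec[OF AB(1) c(1)]]])
      (simp add: W_def)
  then have "Z \<in> \<H>" by (simp add: \<H>_def Z_def hor_proj_mem[OF M N sub])
  moreover have "X \<in> \<H>" "Y \<in> \<H>" using X Y hor by (auto simp: \<H>_def W_def intro: vector_field_on_subset)
  moreover have "?L p (Z p) = ?sff X Y p"
    using v by (simp add: Z_def hor_proj_props(1)[OF M N sub] coord_vec_mderiv[OF AB(1) c])
  ultimately have "h (F p) (?sff X Y p) (?sff X Y p) = 0" using zero[of X Y Z] by (simp add: C_def)
  then show ?thesis using h(3) by force
qed

end

section \<open>The structure equation of cosymplectic manifolds\<close>

text \<open>The pointwise linear algebra behind Blair's formula for \<open>\<nabla>\<phi>\<close>, with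
  \<open>P x y z = g (y, (\<nabla>\<^sub>x \<phi>) z)\<close> and \<open>H x y = g (\<nabla>\<^sub>x \<xi>, y)\<close>.\<close>

lemma cosymplectic_algebra:
  fixes P :: "'v::real_vector \<Rightarrow> 'v \<Rightarrow> 'v \<Rightarrow> real" and H :: "'v \<Rightarrow> 'v \<Rightarrow> real"
  assumes skew: "\<And>x y z. P x y z = - P x z y"
    and closed: "\<And>x y z. P x y z + P y z x + P z x y = 0"
    and normal: "\<And>x y z. P (\<phi> x) z y - P (\<phi> y) z x - P y (\<phi> z) x + P x (\<phi> z) y = 0"
    and square: "\<And>x y z. P x z (\<phi> y) - P x (\<phi> z) y = H x y * \<eta> z + \<eta> y * H x z"
    and P_xi: "\<And>x y. P x y \<xi> = H x (\<phi> y)"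
    and H_sym: "\<And>x y. H x y = H y x"
    and lin: "\<And>x y. linear (\<lambda>z. P x z y)"
    and \<phi>: "\<And>x. \<phi> (\<phi> x) = - x + \<eta> x *\<^sub>R \<xi>" "\<And>x. \<eta> (\<phi> x) = 0"
  shows "P x y z = 0"
proof -
  have sq: "P a (\<phi> (\<phi> b)) c = - P a b c + \<eta> b * P a \<xi> c" for a b c
    by (simp add: \<phi> linear_add[OF lin] linear_diff[OF lin] linear_neg[OF lin] linear_scale[OF lin])
  have xi: "P a \<xi> b = - H a (\<phi> b)" for a b using skew[of a \<xi> b] P_xi[of a b] by simp
  have e1: "P x (\<phi> y) (\<phi> z) = - P x y z - \<eta> y * H x (\<phi> z) + \<eta> z * H x (\<phi> y)"
    using square[of x "\<phi> y" z] sq[of x y z] xi[of x z] \<phi>(2)[of y] by (simp add: mult.commute)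
  have e2: "P (\<phi> y) (\<phi> x) z = - P (\<phi> y) (\<phi> z) x - H (\<phi> y) z * \<eta> x - \<eta> z * H (\<phi> y) x"
    using square[of "\<phi> y" x z] skew[of "\<phi> y" x "\<phi> z"] by simp
  have e3: "P (\<phi> z) (\<phi> x) y = P (\<phi> z) x (\<phi> y) - H (\<phi> z) y * \<eta> x - \<eta> y * H (\<phi> z) x"
    using square[of "\<phi> z" x y] by simp
  \<comment> \<open>Normality for the vectors \<open>y\<close> and \<open>z\<close>, tested against
    \<open>\<phi> x\<close>; the double \<phi> that arises is removed by \<open>sq\<close>.\<close>
  have "P (\<phi> y) (\<phi> x) z - P (\<phi> z) (\<phi> x) y
      + P z x y + \<eta> x * H z (\<phi> y) - P y x z - \<eta> x * H y (\<phi> z) = 0"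
    using normal[of y "\<phi> x" z] sq[of z x y] sq[of y x z] xi[of z y] xi[of y z] by simp
  \<comment> \<open>Insert \<open>e1\<close> into the cyclic identity for \<open>x\<close>,
    \<open>\<phi> y\<close>, \<open>\<phi> z\<close> and add the preceding identity rewritten by
    \<open>e2\<close> and \<open>e3\<close>. The \<open>H\<close> terms cancel by symmetry and
    \<open>P y z x + P z x y = P x y z\<close> remains; with the cyclic identity for
    \<open>x\<close>, \<open>y\<close>, \<open>z\<close> this gives
    \<open>2 * P x y z = 0\<close>.\<close>
  then show ?thesis
    using e1 e2 e3 closed[of x y z] closed[of x "\<phi> y" "\<phi> z"] skew[of y x z]
      H_sym[of "\<phi> y" z] H_sym[of "\<phi> z" y] H_sym[of "\<phi> y" x] H_sym[of "\<phi> z" x]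
    by (simp add: algebra_simps)
qed

section \<open>The covariant derivative of \<phi>\<close>

context
  fixes A :: "('a::{t2_space,second_countable_topology}, 'e::euclidean_space) chart set"
    and \<phi> :: "'a \<Rightarrow> 'e \<Rightarrow> 'e" and \<xi> :: "'a \<Rightarrow> 'e" and \<eta> :: "'a \<Rightarrow> 'e \<Rightarrow> real"
    and g :: "'a \<Rightarrow> 'e \<Rightarrow> 'e \<Rightarrow> real" and D :: "'a \<Rightarrow> 'e \<Rightarrow> ('a \<Rightarrow> 'e) \<Rightarrow> 'e"
  assumes M: "cosymplectic_manifold A \<phi> \<xi> \<eta> g" and LC: "levi_civita A g D"
begin

lemma cosymplecticD:
  "smooth_atlas A" "riemannian_metric A g" "linear (\<phi> p)"
  "open U \<Longrightarrow> vector_field_on A U X \<Longrightarrow> vector_field_on A U (\<lambda>p. \<phi> p (X p))"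
  "vector_field_on A UNIV \<xi>"
  "\<phi> p (\<phi> p v) = - v + \<eta> p v *\<^sub>R \<xi> p" "\<phi> p (\<xi> p) = 0" "\<eta> p (\<phi> p v) = 0" "\<eta> p (\<xi> p) = 1"
  "g p (\<phi> p v) (\<phi> p w) = g p v w - \<eta> p v * \<eta> p w" "\<eta> p v = g p v (\<xi> p)"
  "normal_structure A \<phi> \<xi> \<eta>" "closed1 A \<eta>" "closed2 A (\<lambda>p v w. g p v (\<phi> p w))"
  using M unfolding cosymplectic_manifold_def almost_contact_metric_def riemannian_manifold_def by auto

text \<open>Metric compatibility is applied to \<open>\<phi> p v\<close> and \<open>w\<close>:
  \<eta> kills images of \<phi>, and \<phi> twice gives \<open>- v\<close> up to a multiple of
  \<xi>, which is orthogonal to those images.\<close>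

lemma phi_skew: "g p (\<phi> p v) w = - g p v (\<phi> p w)"
proof -
  note bil = riemannian_metricD(1)[OF cosymplecticD(2), of p]
  have "g p (\<phi> p v) w = g p (\<phi> p (\<phi> p v)) (\<phi> p w)" by (simp add: cosymplecticD(8,10))
  also have "\<dots> = - g p v (\<phi> p w) + \<eta> p v * g p (\<xi> p) (\<phi> p w)"
    unfolding cosymplecticD(6) by (simp add: bilinear_ladd[OF bil] bilinear_lsub[OF bil] bilinear_lneg[OF bil] bilinear_lmul[OF bil])
  also have "g p (\<xi> p) (\<phi> p w) = 0"
    using cosymplecticD(8)[of p w] cosymplecticD(11)[of p "\<phi> p w"]
      riemannian_metricD(2)[OF cosymplecticD(2), of p "\<xi> p" "\<phi> p w"] by simp
  finally show ?thesis by simp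
qed

lemma connection_manifold_add:
  assumes "open U" "p \<in> U" "vector_field_on A U X" "vector_field_on A U Y"
  shows "D p v (\<lambda>q. X q + Y q) = D p v X + D p v Y"
  using connection_alongD(2)[OF levi_civitaD(1)[OF LC]] assms unfolding vector_field_on_def by blast

lemma connection_manifold_scaleR:
  assumes "open U" "p \<in> U" "msmooth_on A U f" "vector_field_on A U X"
  shows "D p v (\<lambda>q. f q *\<^sub>R X q) = mderiv A f p v *\<^sub>R X p + f p *\<^sub>R D p v X"
  using connection_alongD(3)[OF levi_civitaD(1)[OF LC]] assms unfolding vector_field_on_def by blast

lemma connection_linear:
  assumes "open U" "p \<in> U" "vector_field_on A U X" shows "linear (\<lambda>v. D p v X)"
  using connection_alongD(1)[OF levi_civitaD(1)[OF LC] assms(1,2)] assms(3) by (simp add: vector_field_on_def)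

text \<open>The tensor \<nabla>\<phi> in direction \<open>u\<close>, applied to \<open>Z\<close>. It
  takes a field because \<open>D\<close> does; \<open>dphi_ext\<close> shows that only the value
  \<open>Z p\<close> matters.\<close>

definition dphi :: "'a \<Rightarrow> 'e \<Rightarrow> ('a \<Rightarrow> 'e) \<Rightarrow> 'e" where
  "dphi p u Z = D p u (\<lambda>q. \<phi> q (Z q)) - \<phi> p (D p u Z)"

text \<open>The local field with constant components \<open>v\<close> in the chart chosen at
  \<open>p\<close>; it carries identities between fields over to tangent vectors at
  \<open>p\<close>.\<close>

definition const_ext :: "'a \<Rightarrow> 'e \<Rightarrow> 'a \<Rightarrow> 'e" where
  "const_ext p v q = coord_vec A (chart_at A p) q v"

lemma const_ext_field: "vector_field_on A (fst (chart_at A p)) (const_ext p v)"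
  unfolding const_ext_def by (rule vector_field_on_coord_vec[OF cosymplecticD(1) chart_at_mem(1)[OF cosymplecticD(1)]])

lemma const_ext_at: "const_ext p v p = v"
  using coord_vec_mderiv[OF cosymplecticD(1) chart_at_mem[OF cosymplecticD(1)], of p v]
  by (simp add: const_ext_def mderiv_chart_at[OF cosymplecticD(1)])

text \<open>The derivatives of the coefficients of \<open>Z\<close> enter both terms of
  \<open>dphi\<close> in the same way and cancel because \<phi> is linear at each point.\<close>

lemma dphi_tensorial:
  assumes U: "open U" "p \<in> U" and Z: "vector_field_on A U Z"
  shows "dphi p u Z = (\<Sum>b\<in>Basis. (Z p \<bullet> b) *\<^sub>R dphi p u (const_ext p b))"
proof -
  note A = cosymplecticD(1)
  note AA = A A smooth_map_id[OF A]
  note C = levi_civitaD(1)[OF LC]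
  define c where "c = chart_at A p"
  define z where "z = (\<lambda>q. mderiv A (snd c) q (Z q))"
  let ?W = "U \<inter> fst c"
  have c: "c \<in> A" "p \<in> fst c" using chart_at_mem[OF A] by (auto simp: c_def)
  have W: "open ?W" "p \<in> ?W" using U c open_chart[OF A c(1)] by auto
  have E: "vector_field_on A ?W (const_ext p b)" for b
    by (rule vector_field_on_subset[OF const_ext_field]) (simp add: c_def)
  have \<phi>E: "vector_field_on A ?W (\<lambda>q. \<phi> q (const_ext p b q))" for b by (rule cosymplecticD(4)[OF W(1) E])
  have ZW: "vector_field_on A ?W Z" and \<phi>Z: "vector_field_on A ?W (\<lambda>q. \<phi> q (Z q))"
    using vector_field_on_subset[OF Z] cosymplecticD(4)[OF W(1)] by auto
  have z: "msmooth_on A ?W (\<lambda>q. z q \<bullet> b)" for b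
    unfolding z_def by (intro msmooth_on_inner[OF A W(1)] vector_field_on_coords[OF A Z c(1)] msmooth_on_const)
  have eq: "Z q = (\<Sum>b\<in>Basis. (z q \<bullet> b) *\<^sub>R const_ext p b q)" if "q \<in> ?W" for q
    using that coord_expansion[OF A c(1), of q "Z q"] by (simp add: const_ext_def z_def c_def)
  have \<phi>eq: "\<phi> q (Z q) = (\<Sum>b\<in>Basis. (z q \<bullet> b) *\<^sub>R \<phi> q (const_ext p b q))" if "q \<in> ?W" for q
    by (subst eq[OF that]) (simp add: linear_sum[OF cosymplecticD(3)] linear_scale[OF cosymplecticD(3)])
  have comb: "D p u Y = (\<Sum>b\<in>Basis. mderiv A (\<lambda>q. z q \<bullet> b) p u *\<^sub>R S b p + (z p \<bullet> b) *\<^sub>R D p u (S b))"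
    if Y: "vector_field_on A ?W Y" and S: "\<And>b. vector_field_on A ?W (S b)"
      and eq: "\<And>q. q \<in> ?W \<Longrightarrow> Y q = (\<Sum>b\<in>Basis. (z q \<bullet> b) *\<^sub>R S b q)" for Y S
  proof -
    have T: "section_along A A id ?W (S b)" for b using S by (simp add: vector_field_on_def)
    have "D p u Y = D p u (\<lambda>q. \<Sum>b\<in>Basis. (z q \<bullet> b) *\<^sub>R S b q)"
      by (rule connection_alongD(4)[OF C W Y[unfolded vector_field_on_def]
            section_along_sum[OF AA W(1) section_along_scaleR[OF AA W(1) z T]]]) (rule eq)
    also have "\<dots> = (\<Sum>b\<in>Basis. mderiv A (\<lambda>q. z q \<bullet> b) p u *\<^sub>R S b p + (z p \<bullet> b) *\<^sub>R D p u (S b))"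
      by (rule connection_combination[OF AA C finite_Basis W T z])
    finally show ?thesis .
  qed
  have zp: "z p = Z p" by (simp add: z_def c_def mderiv_chart_at[OF A])
  have "dphi p u Z = (\<Sum>b\<in>Basis. mderiv A (\<lambda>q. z q \<bullet> b) p u *\<^sub>R \<phi> p (const_ext p b p)
        + (z p \<bullet> b) *\<^sub>R D p u (\<lambda>q. \<phi> q (const_ext p b q)))
      - \<phi> p (\<Sum>b\<in>Basis. mderiv A (\<lambda>q. z q \<bullet> b) p u *\<^sub>R const_ext p b p + (z p \<bullet> b) *\<^sub>R D p u (const_ext p b))"
    unfolding dphi_def by (rule arg_cong2[where f = minus, OF comb[OF \<phi>Z \<phi>E \<phi>eq] arg_cong[where f = "\<phi> p", OF comb[OF ZW E eq]]])
  also have "\<dots> = (\<Sum>b\<in>Basis. (z p \<bullet> b) *\<^sub>R dphi p u (const_ext p b))"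
    by (simp add: linear_sum[OF cosymplecticD(3)] linear_scale[OF cosymplecticD(3)]
        linear_add[OF cosymplecticD(3)] sum_subtractf[symmetric] dphi_def scaleR_right_diff_distrib)
  finally show ?thesis by (simp add: zp)
qed

lemma dphi_ext:
  assumes "open U" "p \<in> U" "vector_field_on A U Z"
  shows "dphi p u Z = dphi p u (const_ext p (Z p))"
proof -
  note c = chart_at_mem[OF cosymplecticD(1), of p]
  show ?thesis
    using dphi_tensorial[OF assms, of u]
      dphi_tensorial[OF open_chart[OF cosymplecticD(1) c(1)] c(2) const_ext_field, of u "Z p"]
    by (simp add: const_ext_at)
qed

text \<open>Covariant derivative of \<open>phi_skew\<close>.\<close>

lemma dphi_skew:
  assumes U: "open U" "p \<in> U" and Y: "vector_field_on A U Y" and Z: "vector_field_on A U Z"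
  shows "g p (Y p) (dphi p u Z) = - g p (Z p) (dphi p u Y)"
proof -
  note A = cosymplecticD(1)
  note g = riemannian_metricD[OF cosymplecticD(2)]
  note \<phi>Y = cosymplecticD(4)[OF U(1) Y] and \<phi>Z = cosymplecticD(4)[OF U(1) Z]
  have "mderiv A (\<lambda>q. g q (\<phi> q (Y q)) (Z q) + g q (Y q) (\<phi> q (Z q))) p u = 0"
    by (simp add: phi_skew mderiv_const[OF A])
  then have "mderiv A (\<lambda>q. g q (\<phi> q (Y q)) (Z q)) p u + mderiv A (\<lambda>q. g q (Y q) (\<phi> q (Z q))) p u = 0"
    using mderiv_add[OF A g(4)[OF U(1) \<phi>Y Z] g(4)[OF U(1) Y \<phi>Z] U(2)] by simp
  then show ?thesis
    using levi_civitaD(3)[OF LC U \<phi>Y Z, of u] levi_civitaD(3)[OF LC U Y \<phi>Z, of u]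
      phi_skew[of p "Y p" "D p u Z"] phi_skew[of p "D p u Y" "Z p"]
      g(2)[of p "Z p" "D p u (\<lambda>q. \<phi> q (Y q))"] g(2)[of p "Z p" "\<phi> p (D p u Y)"]
    by (simp add: dphi_def bilinear_rsub[OF g(1)])
qed

text \<open>This is d\<Phi> = 0 with brackets written as differences of covariant derivatives: the
  terms containing a derivative of \<open>X\<close>, \<open>Y\<close> or \<open>Z\<close> cancel,
  and only \<nabla>\<phi> survives.\<close>

lemma dphi_closed:
  assumes U: "open U" "p \<in> U" and X: "vector_field_on A U X" and Y: "vector_field_on A U Y"
    and Z: "vector_field_on A U Z"
  shows "g p (Y p) (dphi p (X p) Z) + g p (Z p) (dphi p (Y p) X) + g p (X p) (dphi p (Z p) Y) = 0"
proof -
  note g = riemannian_metricD[OF cosymplecticD(2)]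
  let ?\<Phi> = "\<lambda>v w. g p v (\<phi> p w)"
  have deriv: "mderiv A (\<lambda>q. g q (S q) (\<phi> q (T q))) p u
      = ?\<Phi> (D p u S) (T p) + g p (S p) (dphi p u T) - ?\<Phi> (D p u T) (S p)"
    if S: "vector_field_on A U S" and T: "vector_field_on A U T" for S T u
    using levi_civitaD(3)[OF LC U S cosymplecticD(4)[OF U(1) T], of u]
      phi_skew[of p "S p" "D p u T"] g(2)[of p "\<phi> p (S p)" "D p u T"]
    by (simp add: dphi_def bilinear_rsub[OF g(1)])
  have bracket: "?\<Phi> (lie_bracket A S T p) w = ?\<Phi> (D p (S p) T) w - ?\<Phi> (D p (T p) S) w"
    if "vector_field_on A U S" "vector_field_on A U T" for S T w
    by (simp add: levi_civitaD(2)[OF LC U that, symmetric] bilinear_lsub[OF g(1)])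
  have "ext_deriv2 A (\<lambda>p v w. g p v (\<phi> p w)) X Y Z p = 0"
    using cosymplecticD(14) U X Y Z unfolding closed2_def by blast
  then show ?thesis
    by (simp add: ext_deriv2_def vec_deriv_eq deriv X Y Z bracket)
qed

text \<open>This is d\<eta> = 0 for the form dual to \<xi>: the derivatives of \<open>X\<close> and
  \<open>Y\<close> cancel against the bracket.\<close>

lemma dxi_symmetric:
  assumes U: "open U" "p \<in> U" and X: "vector_field_on A U X" and Y: "vector_field_on A U Y"
  shows "g p (D p (X p) \<xi>) (Y p) = g p (D p (Y p) \<xi>) (X p)"
proof -
  note g = riemannian_metricD[OF cosymplecticD(2)]
  have \<xi>: "vector_field_on A U \<xi>" by (rule vector_field_on_subset[OF cosymplecticD(5)]) simp
  have "ext_deriv1 A \<eta> X Y p = 0" using cosymplecticD(13) U X Y unfolding closed1_def by blast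
  then have "mderiv A (\<lambda>q. g q (Y q) (\<xi> q)) p (X p) - mderiv A (\<lambda>q. g q (X q) (\<xi> q)) p (Y p)
      - g p (lie_bracket A X Y p) (\<xi> p) = 0"
    by (simp add: ext_deriv1_def vec_deriv_eq cosymplecticD(11))
  then show ?thesis
    using g(2)[of p "Y p" "D p (X p) \<xi>"] g(2)[of p "X p" "D p (Y p) \<xi>"]
    by (simp add: levi_civitaD(3)[OF LC U Y \<xi>] levi_civitaD(3)[OF LC U X \<xi>]
        levi_civitaD(2)[OF LC U X Y, symmetric] bilinear_lsub[OF g(1)])
qed

text \<open>Since d\<eta> = 0, normality says that the Nijenhuis tensor vanishes; its brackets are
  then written as covariant derivatives.\<close>

lemma dphi_normal:
  assumes U: "open U" "p \<in> U" and X: "vector_field_on A U X" and Y: "vector_field_on A U Y"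
  shows "dphi p (\<phi> p (X p)) Y - dphi p (\<phi> p (Y p)) X + \<phi> p (dphi p (Y p) X) - \<phi> p (dphi p (X p) Y) = 0"
proof -
  note \<phi>X = cosymplecticD(4)[OF U(1) X] and \<phi>Y = cosymplecticD(4)[OF U(1) Y]
  note lin = linear_diff[OF cosymplecticD(3)]
  have "ext_deriv1 A \<eta> X Y p = 0" using cosymplecticD(13) U X Y unfolding closed1_def by blast
  moreover have "nijenhuis A \<phi> X Y p + (2 * ext_deriv1 A \<eta> X Y p) *\<^sub>R \<xi> p = 0"
    using cosymplecticD(12) U X Y unfolding normal_structure_def by blast
  ultimately have "nijenhuis A \<phi> X Y p = 0" by simp
  then show ?thesis
    unfolding nijenhuis_def levi_civitaD(2)[OF LC U X Y, symmetric] levi_civitaD(2)[OF LC U \<phi>X \<phi>Y, symmetric]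
      levi_civitaD(2)[OF LC U \<phi>X Y, symmetric] levi_civitaD(2)[OF LC U X \<phi>Y, symmetric]
    by (simp add: dphi_def lin algebra_simps)
qed

text \<open>Covariant derivative of \<phi>^2 = -I + \<eta> \<otimes> \<xi>, with the derivative of
  \<eta> expressed by that of \<xi>.\<close>

lemma dphi_square:
  assumes U: "open U" "p \<in> U" and Y: "vector_field_on A U Y"
  shows "dphi p u (\<lambda>q. \<phi> q (Y q)) + \<phi> p (dphi p u Y) = g p (Y p) (D p u \<xi>) *\<^sub>R \<xi> p + \<eta> p (Y p) *\<^sub>R D p u \<xi>"
proof -
  note g = riemannian_metricD[OF cosymplecticD(2)]
  have \<xi>: "vector_field_on A U \<xi>" by (rule vector_field_on_subset[OF cosymplecticD(5)]) simp
  have \<eta>: "msmooth_on A U (\<lambda>q. g q (Y q) (\<xi> q))" by (rule g(4)[OF U(1) Y \<xi>])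
  note AA = cosymplecticD(1) cosymplecticD(1) smooth_map_id[OF cosymplecticD(1)]
  have f1: "vector_field_on A U (\<lambda>q. (-1) *\<^sub>R Y q)" "vector_field_on A U (\<lambda>q. g q (Y q) (\<xi> q) *\<^sub>R \<xi> q)"
    using section_along_scaleR[OF AA U(1) msmooth_on_const] section_along_scaleR[OF AA U(1) \<eta>] Y \<xi>
    unfolding vector_field_on_def by blast+
  have "(\<lambda>q. \<phi> q (\<phi> q (Y q))) = (\<lambda>q. (-1) *\<^sub>R Y q + g q (Y q) (\<xi> q) *\<^sub>R \<xi> q)"
    by (simp add: cosymplecticD(6,11))
  then have "D p u (\<lambda>q. \<phi> q (\<phi> q (Y q))) = - D p u Y
      + (g p (D p u Y) (\<xi> p) + g p (Y p) (D p u \<xi>)) *\<^sub>R \<xi> p + \<eta> p (Y p) *\<^sub>R D p u \<xi>"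
    using connection_manifold_add[OF U f1] connection_manifold_scaleR[OF U \<eta> \<xi>]
      connection_manifold_scaleR[OF U msmooth_on_const Y, of _ "-1"] levi_civitaD(3)[OF LC U Y \<xi>, of u]
    by (simp add: mderiv_const[OF cosymplecticD(1)] cosymplecticD(11))
  then show ?thesis
    by (simp add: dphi_def linear_diff[OF cosymplecticD(3)] cosymplecticD(6,11) algebra_simps)
qed

lemma dphi_zero:
  assumes U: "open U" "p \<in> U" and Z: "vector_field_on A U Z"
  shows "dphi p u Z = 0"
proof -
  note A = cosymplecticD(1)
  note g = riemannian_metricD[OF cosymplecticD(2)]
  let ?U = "fst (chart_at A p)"
  have V: "open ?U" "p \<in> ?U" using open_chart[OF A] chart_at_mem[OF A] by auto
  define P where "P = (\<lambda>x y z. g p y (dphi p x (const_ext p z)))"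
  define H where "H = (\<lambda>x y. g p (D p x \<xi>) y)"
  note \<phi>const_ext = cosymplecticD(4)[OF V(1) const_ext_field]
  have dphi_phi: "dphi p x (\<lambda>q. \<phi> q (const_ext p y q)) = dphi p x (const_ext p (\<phi> p y))" for x y
    using dphi_ext[OF V \<phi>const_ext, of x y] by (simp add: const_ext_at)
  \<comment> \<open>\<phi> annihilates \<xi> as a field, so only the second term of
    \<open>dphi\<close> is left.\<close>
  have dphi_xi: "dphi p x (const_ext p (\<xi> p)) = - \<phi> p (D p x \<xi>)" for x
    using dphi_ext[OF open_UNIV UNIV_I cosymplecticD(5), of p x]
      connection_zero[OF A A smooth_map_id[OF A] levi_civitaD(1)[OF LC]]
    by (simp add: dphi_def cosymplecticD(7))
  have "P x y z = 0" for x y z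
  proof (rule cosymplectic_algebra[where \<phi> = "\<phi> p" and \<eta> = "\<eta> p" and \<xi> = "\<xi> p" and H = H])
    fix x y z
    show "P x y z = - P x z y"
      using dphi_skew[OF V const_ext_field[of p y] const_ext_field[of p z], of x] by (simp add: P_def const_ext_at)
    show "P x y z + P y z x + P z x y = 0"
      using dphi_closed[OF V const_ext_field[of p x] const_ext_field[of p y] const_ext_field[of p z]] by (simp add: P_def const_ext_at)
    show "P (\<phi> p x) z y - P (\<phi> p y) z x - P y (\<phi> p z) x + P x (\<phi> p z) y = 0"
    proof -
      have "g p z (dphi p (\<phi> p x) (const_ext p y) - dphi p (\<phi> p y) (const_ext p x)
          + \<phi> p (dphi p y (const_ext p x)) - \<phi> p (dphi p x (const_ext p y))) = 0"
        using dphi_normal[OF V const_ext_field[of p x] const_ext_field[of p y]] by (simp add: const_ext_at bilinear_rzero[OF g(1)])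
      then show ?thesis
        by (simp add: P_def phi_skew bilinear_rsub[OF g(1)] bilinear_radd[OF g(1)])
    qed
    show "P x z (\<phi> p y) - P x (\<phi> p z) y = H x y * \<eta> p z + \<eta> p y * H x z"
    proof -
      have "g p z (dphi p x (const_ext p (\<phi> p y)) + \<phi> p (dphi p x (const_ext p y)))
          = g p z (g p y (D p x \<xi>) *\<^sub>R \<xi> p + \<eta> p y *\<^sub>R D p x \<xi>)"
        using dphi_square[OF V const_ext_field[of p y], of x] by (simp add: const_ext_at dphi_phi)
      then show ?thesis
        using g(2)[of p y "D p x \<xi>"] g(2)[of p z "D p x \<xi>"]
        by (simp add: P_def H_def phi_skew bilinear_radd[OF g(1)] bilinear_rmul[OF g(1)] cosymplecticD(11)[of p z])
    qed
    show "P x y (\<xi> p) = H x (\<phi> p y)"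
      using phi_skew[of p y "D p x \<xi>"] g(2)[of p "\<phi> p y" "D p x \<xi>"]
      by (simp add: P_def H_def dphi_xi bilinear_rneg[OF g(1)])
    show "H x y = H y x"
      using dxi_symmetric[OF V const_ext_field[of p x] const_ext_field[of p y]] by (simp add: H_def const_ext_at)
    show "linear (\<lambda>z. P x z y)" using g(1) by (simp add: P_def bilinear_def)
  qed (simp_all add: cosymplecticD(6,8))
  \<comment> \<open>Taking the value of \<nabla>\<phi> itself as the test vector gives its squared
    norm.\<close>
  from this[where x = u and y = "dphi p u Z" and z = "Z p"] dphi_ext[OF assms, of u]
  have "g p (dphi p u Z) (dphi p u Z) = 0" by (simp add: P_def)
  then show ?thesis using g(3)[of "dphi p u Z" p] by force
qed

lemma nabla_phi:
  "open U \<Longrightarrow> p \<in> U \<Longrightarrow> vector_field_on A U Z \<Longrightarrow> D p u (\<lambda>q. \<phi> q (Z q)) = \<phi> p (D p u Z)"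
  using dphi_zero by (simp add: dphi_def)

text \<open>By \<open>nabla_phi\<close>, \<phi> annihilates \<nabla>\<xi>, which is therefore a
  multiple of \<xi>; as \<xi> has constant length, it is also orthogonal to \<xi>.\<close>

lemma nabla_xi: "D p u \<xi> = 0"
proof -
  note g = riemannian_metricD[OF cosymplecticD(2)]
  note \<xi> = cosymplecticD(5)
  have "\<phi> p (D p u \<xi>) = 0"
    using nabla_phi[OF open_UNIV UNIV_I \<xi>, of p u]
      connection_zero[OF cosymplecticD(1,1) smooth_map_id[OF cosymplecticD(1)] levi_civitaD(1)[OF LC]]
    by (simp add: cosymplecticD(7))
  then have 1: "D p u \<xi> = \<eta> p (D p u \<xi>) *\<^sub>R \<xi> p"
    using cosymplecticD(6)[of p "D p u \<xi>"] linear_0[OF cosymplecticD(3)] by simp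
  have "mderiv A (\<lambda>q. g q (\<xi> q) (\<xi> q)) p u = 0"
    using cosymplecticD(9) by (simp add: cosymplecticD(11) mderiv_const[OF cosymplecticD(1)])
  then have "\<eta> p (D p u \<xi>) = 0"
    using levi_civitaD(3)[OF LC open_UNIV UNIV_I \<xi> \<xi>, of p u] g(2)[of p "\<xi> p" "D p u \<xi>"]
    by (simp add: cosymplecticD(11))
  with 1 show ?thesis by simp
qed

end

section \<open>Anti-invariant submersions\<close>

theorem theorem15:
  fixes AM :: "('a::{t2_space,second_countable_topology}, 'e::euclidean_space) chart set"
    and AN :: "('b::{t2_space,second_countable_topology}, 'f::euclidean_space) chart set"
    and \<phi> :: "'a \<Rightarrow> 'e \<Rightarrow> 'e" and \<xi> :: "'a \<Rightarrow> 'e" and \<eta> :: "'a \<Rightarrow> 'e \<Rightarrow> real"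
    and gM :: "'a \<Rightarrow> 'e \<Rightarrow> 'e \<Rightarrow> real" and gN :: "'b \<Rightarrow> 'f \<Rightarrow> 'f \<Rightarrow> real"
    and F :: "'a \<Rightarrow> 'b"
    and nablaM :: "'a \<Rightarrow> 'e \<Rightarrow> ('a \<Rightarrow> 'e) \<Rightarrow> 'e"
    and nablaN :: "'b \<Rightarrow> 'f \<Rightarrow> ('b \<Rightarrow> 'f) \<Rightarrow> 'f"
    and nablaF :: "'a \<Rightarrow> 'e \<Rightarrow> ('a \<Rightarrow> 'f) \<Rightarrow> 'f"
  assumes "cosymplectic_manifold AM \<phi> \<xi> \<eta> gM"
    and "riemannian_manifold AN gN"
    and "levi_civita AM gM nablaM"
    and "levi_civita AN gN nablaN"
    and "riemannian_submersion AM AN gM gN F"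
    and "pullback_connection AM AN F nablaN nablaF"
    and "anti_invariant AM AN \<phi> gM F"
    and "\<And>p. is_direct_sum (horizontal AM AN gM F p) (\<phi> p ` vertical AM AN F p) (span {\<xi> p})"
  shows "totally_geodesic_map AM AN nablaM nablaF F \<longleftrightarrow>
    (\<forall>W \<in> vertical_fields AM AN F. \<forall>V \<in> vertical_fields AM AN F. \<forall>p.
       oneill_T AM AN gM nablaM F W (\<lambda>q. \<phi> q (V q)) p = 0) \<and>
    (\<forall>X \<in> horizontal_fields AM AN gM F. \<forall>W \<in> vertical_fields AM AN F. \<forall>p.
       oneill_A AM AN gM nablaM F X (\<lambda>q. \<phi> q (W q)) p = 0)"
proof -
  note cos = assms(1) and LC = assms(3) and sub = assms(5)
  have M: "riemannian_manifold AM gM"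
    using cos by (simp add: cosymplectic_manifold_def almost_contact_metric_def)
  note N = assms(2)
  note A = submersion_smooth(1)[OF M N sub]
  note g = riemannian_metricD[OF cosymplecticD(2)[OF cos LC]]
  note lin = linear_differential[OF submersion_smooth(1-3)[OF M N sub]]
  note sff = second_fundamental_form_vertical[OF M N sub LC assms(4,6)]
  let ?V = "vertical AM AN F" and ?H = "horizontal AM AN gM F"
  let ?ver = "ver_proj AM AN gM F" and ?hor = "hor_proj AM AN gM F"
  let ?B = "second_fundamental_form AM AN nablaM nablaF F"
  have anti: "\<phi> p v \<in> ?H p" if "v \<in> ?V p" for p v
    using assms(7) that by (auto simp: anti_invariant_def)
  have zero: "0 \<in> ?V p" for p using linear_0[OF lin] by (simp add: vertical_def)
  \<comment> \<open>The vertical vector 0 exhibits \<xi> as an element of the direct sum.\<close>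
  have xi: "\<xi> p \<in> ?H p" for p
  proof -
    have "\<xi> p = \<phi> p 0 + \<xi> p" by (simp add: linear_0[OF cosymplecticD(3)[OF cos LC]])
    moreover have "\<phi> p 0 \<in> \<phi> p ` ?V p" using zero by blast
    moreover have "\<xi> p \<in> span {\<xi> p}" by (simp add: span_base)
    ultimately show ?thesis using assms(8)[of p] unfolding is_direct_sum_def by blast
  qed
  have eta: "\<eta> p v = 0" if "v \<in> ?V p" for p v
    using xi[of p] that g(2)[of p v "\<xi> p"] by (auto simp: horizontal_def cosymplecticD(11)[OF cos LC])
  have key: "?ver p (nablaM p u (\<lambda>q. \<phi> q (V q))) = 0 \<longleftrightarrow> nablaM p u V \<in> ?V p"
    if V: "V \<in> vertical_fields AM AN F" for V p u
  proof -
    have Vf: "vector_field_on AM UNIV V" and Vv: "\<And>q. V q \<in> ?V q" using V by (auto simp: vertical_fields_def)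
    note \<phi>lin = linear_add[OF cosymplecticD(3)[OF cos LC]]
    define x where "x = nablaM p u V"
    have \<phi>x: "nablaM p u (\<lambda>q. \<phi> q (V q)) = \<phi> p x"
      unfolding x_def by (rule nabla_phi[OF cos LC open_UNIV UNIV_I Vf])
    \<comment> \<open>\<open>V\<close> is orthogonal to \<xi>; differentiating this, with
      \<nabla>\<xi> = 0, shows that its covariant derivative is so too.\<close>
    have "mderiv AM (\<lambda>q. gM q (V q) (\<xi> q)) p u = 0"
      using eta[OF Vv] by (simp add: cosymplecticD(11)[OF cos LC, symmetric] mderiv_const[OF A])
    then have x\<xi>: "gM p x (\<xi> p) = 0"
      using levi_civitaD(3)[OF LC open_UNIV UNIV_I Vf cosymplecticD(5)[OF cos LC], of p u]
      by (simp add: nabla_xi[OF cos LC] x_def bilinear_rzero[OF g(1)])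
    have "?hor p x \<in> ?H p" by (rule hor_proj_mem[OF M N sub])
    then obtain t s where t: "t \<in> ?V p" and hx: "?hor p x = \<phi> p t + s *\<^sub>R \<xi> p"
      using assms(8)[of p] unfolding is_direct_sum_def span_singleton by blast
    have x: "x = ?ver p x + ?hor p x" by (simp add: hor_proj_props(3)[OF M N sub])
    have "gM p (?hor p x) (\<xi> p) = 0"
      using x\<xi> eta[OF ver_proj_mem[OF M N sub, of p x]]
      by (simp add: hor_proj_props(3)[OF M N sub] cosymplecticD(11)[OF cos LC] bilinear_lsub[OF g(1)])
    \<comment> \<open>\<open>\<phi> p t\<close> is orthogonal to \<xi> as well, so pairing with
      \<xi> isolates \<open>s\<close>.\<close>
    then have "s = 0"
      using cosymplecticD(8,9)[OF cos LC, of p] unfolding hx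
      by (simp add: cosymplecticD(11)[OF cos LC] bilinear_ladd[OF g(1)] bilinear_lmul[OF g(1)])
    then have xt: "x = ?ver p x + \<phi> p t" using x hx by simp
    have \<phi>xt: "\<phi> p x = \<phi> p (?ver p x) - t"
      by (subst xt) (simp add: \<phi>lin cosymplecticD(6)[OF cos LC] eta[OF t])
    have \<phi>v: "\<phi> p (?ver p x) \<in> ?H p" by (rule anti[OF ver_proj_mem[OF M N sub]])
    have "x \<in> ?V p" if "?ver p (\<phi> p x) = 0"
    proof -
      have "\<phi> p x \<in> ?H p"
        using that hor_proj_mem[OF M N sub, of p "\<phi> p x"] by (simp add: hor_proj_props(3)[OF M N sub])
      \<comment> \<open>By the formula for \<open>\<phi> p x\<close>, the vertical vector
        \<open>t\<close> is a difference of two horizontal vectors, hence orthogonal to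
        itself.\<close>
      then have "gM p (\<phi> p x) t = 0" "gM p (\<phi> p (?ver p x)) t = 0" using t \<phi>v by (auto simp: horizontal_def)
      then have "gM p t t = 0" by (simp add: \<phi>xt bilinear_lsub[OF g(1)])
      then have "t = 0" using g(3)[of t p] by force
      then show ?thesis
        using xt ver_proj_mem[OF M N sub, of p x] by (simp add: linear_0[OF cosymplecticD(3)[OF cos LC]])
    qed
    moreover have "?ver p (\<phi> p x) = 0" if "x \<in> ?V p"
      by (rule ver_proj_horizontal[OF M N sub anti[OF that]])
    ultimately show ?thesis unfolding \<phi>x by (auto simp: x_def)
  qed
  have conn0: "nablaM p u (\<lambda>q. 0) = 0" for p u
    by (rule connection_zero[OF A A smooth_map_id[OF A] levi_civitaD(1)[OF LC]])
  \<comment> \<open>\<phi> V is horizontal, so its vertical part is the zero field and the first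
    summand of the tensor vanishes; what is left is the vertical part of the derivative of \<phi> V,
    to which \<open>key\<close> applies. In \<open>S\<close> below the surviving summand is the
    other one.\<close>
  have T: "oneill_T AM AN gM nablaM F W (\<lambda>q. \<phi> q (V q)) p = 0 \<longleftrightarrow> nablaM p (W p) V \<in> ?V p"
    if "W \<in> vertical_fields AM AN F" "V \<in> vertical_fields AM AN F" for V W p
    using that key[OF that(2)] zero
    by (simp add: oneill_T_def vertical_fields_def ver_proj_vertical[OF M N sub] anti
        ver_proj_horizontal[OF M N sub] hor_proj_horizontal[OF M N sub] conn0 hor_proj_vertical[OF M N sub])
  have S: "oneill_A AM AN gM nablaM F X (\<lambda>q. \<phi> q (V q)) p = 0 \<longleftrightarrow> nablaM p (X p) V \<in> ?V p"
    if "X \<in> horizontal_fields AM AN gM F" "V \<in> vertical_fields AM AN F" for V X p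
    using that key[OF that(2)] zero
    by (simp add: oneill_A_def vertical_fields_def horizontal_fields_def anti
        ver_proj_horizontal[OF M N sub] hor_proj_horizontal[OF M N sub] conn0 hor_proj_vertical[OF M N sub])
  have "totally_geodesic_map AM AN nablaM nablaF F \<longleftrightarrow>
    (\<forall>W \<in> vertical_fields AM AN F. \<forall>V \<in> vertical_fields AM AN F. \<forall>p. nablaM p (W p) V \<in> ?V p) \<and>
    (\<forall>X \<in> horizontal_fields AM AN gM F. \<forall>V \<in> vertical_fields AM AN F. \<forall>p. nablaM p (X p) V \<in> ?V p)"
    (is "_ \<longleftrightarrow> ?cond")
  proof
    assume "totally_geodesic_map AM AN nablaM nablaF F"
    then have "nablaM p (X p) V \<in> ?V p" if "vector_field_on AM UNIV X" "V \<in> vertical_fields AM AN F" for X V p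
      using that sff[of V X p] by (auto simp: totally_geodesic_map_def vertical_fields_def vertical_def)
    then show ?cond by (auto simp: vertical_fields_def horizontal_fields_def)
  next
    assume c: ?cond
    show "totally_geodesic_map AM AN nablaM nablaF F"
      unfolding totally_geodesic_map_def
    proof (intro allI impI)
      fix X Y p assume XY: "vector_field_on AM UNIV X \<and> vector_field_on AM UNIV Y"
      let ?ve = "\<lambda>X q. ?ver q (X q)" and ?ho = "\<lambda>X q. ?hor q (X q)"
      \<comment> \<open>\<open>?cond\<close> speaks of global vertical and horizontal fields; the
        projections of a global smooth field are such fields.\<close>
      have ve: "vector_field_on AM UNIV (?ve X)" "?ve X \<in> vertical_fields AM AN F"
        and ho: "vector_field_on AM UNIV (?ho X)" "?ho X \<in> horizontal_fields AM AN gM F"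
        if "vector_field_on AM UNIV X" for X
        using that vector_field_ver_proj[OF M N sub] vector_field_hor_proj[OF M N sub]
          ver_proj_mem[OF M N sub] hor_proj_mem[OF M N sub]
        by (auto simp: vertical_fields_def horizontal_fields_def)
      have split: "X q = ?ve X q + ?ho X q" for X q by (simp add: hor_proj_props(3)[OF M N sub])
      have vert: "?B Z (?ve Y) p = 0" if Z: "Z \<in> vertical_fields AM AN F \<or> Z \<in> horizontal_fields AM AN gM F"
        and Y: "vector_field_on AM UNIV Y" for Z Y
        using c ve(2)[OF Y] Z sff[of "?ve Y" Z p] ver_proj_mem[OF M N sub]
        by (auto simp: vertical_def)
      \<comment> \<open>Both connections are linear in the direction, so the first argument can be
        split at the single point \<open>p\<close>.\<close>
      have addX: "?B X Z p = ?B (?ve X) Z p + ?B (?ho X) Z p" if Z: "vector_field_on AM UNIV Z" for Z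
      proof -
        have l1: "linear (\<lambda>v. nablaM p v Z)" by (rule connection_linear[OF cos LC open_UNIV UNIV_I Z])
        have l2: "linear (\<lambda>v. nablaF p v (\<lambda>q. differential AM AN F q (Z q)))"
          by (rule connection_alongD(1)[OF pullback_connection_along[OF submersion_smooth(1-3)[OF M N sub]
                submersion_smooth(5)[OF M N sub] assms(4,6)] open_UNIV UNIV_I
                section_along_differential[OF submersion_smooth(1-3)[OF M N sub] open_UNIV Z]])
        show ?thesis
          unfolding second_fundamental_form_def
          by (subst (1 2) split[of X]) (simp add: linear_add[OF l1] linear_add[OF l2] linear_add[OF lin])
      qed
      \<comment> \<open>Symmetry moves the vertical field to the slot that is differentiated, where
        \<open>?cond\<close> applies.\<close>
      have "?B (?ve X) (?ho Y) p = ?B (?ho Y) (?ve X) p"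
        using second_fundamental_form_sym[OF M N sub LC assms(4,6) open_UNIV UNIV_I] ve ho XY by blast
      also have "\<dots> = 0" using vert ho XY by blast
      finally have 1: "?B (?ve X) (?ho Y) p = 0" .
      have 2: "?B (?ho X) (?ho Y) p = 0"
        using second_fundamental_form_horizontal[OF M N sub LC assms(4,6) open_UNIV UNIV_I] ho XY
          hor_proj_mem[OF M N sub] by blast
      have "?B X Y p = ?B X (\<lambda>q. ?ve Y q + ?ho Y q) p" using split[of Y] by presburger
      also have "\<dots> = ?B X (?ve Y) p + ?B X (?ho Y) p"
        using second_fundamental_form_add[OF M N sub LC assms(4,6) open_UNIV UNIV_I] ve ho XY by blast
      also have "\<dots> = 0" using addX[of "?ve Y"] addX[of "?ho Y"] vert[of _ Y] 1 2 ve ho XY by simp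
      finally show "?B X Y p = 0" .
    qed
  qed
  then show ?thesis using T S by simp
qed

end
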